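(* (i) Every regular $(LM)$-space is a quasi-$(DF)$-space. In particular, every infinite-dimensional metrizable non-normable locally convex space is a quasi-$(DF)$-space which is not a $(DF)$-space. (ii) The strong dual $E'_\beta$ of a regular $(LM)$-space $E$ is a quasi-$(DF)$-space. (iii) Countable locally convex direct sums of quasi-$(DF)$-spaces are quasi-$(DF)$-spaces. (iv) Every subspace of a quasi-$(DF)$-space is a quasi-$(DF)$-space. (v) Every countable product of quasi-$(DF)$-spaces is a quasi-$(DF)$-space. (vi) Every precompact subset of a quasi-$(DF)$-space is metrizable.
   Context: Order $\mathbb{N}^{\mathbb{N}}$ pointwise. A resolution in a set $\Omega$ is a family $\{A_\alpha:\alpha\in\mathbb{N}^{\mathbb{N}}\}$ covering $\Omega$ with $A_\alpha\subseteq A_\beta$ whenever $\alpha\le\beta$. A locally convex space $E$ has a fundamental bounded resolution if it has a resolution of bounded sets such that every bounded subset of $E$ lies in some member. $E$ belongs to the class $\mathfrak{G}$ if there is a resolution $\{A_\alpha\}$ of the weak* dual $(E',\sigma(E',E))$ such that every sequence contained in any $A_\alpha$ is equicontinuous. $E$ is a quasi-$(DF)$-space if it has a fundamental bounded resolution and belongs to the class $\mathfrak{G}$. $E$ is a $(DF)$-space if it has a fundamental sequence of bounded sets (every bounded set lies in one of them) and is $\aleph_0$-quasibarrelled (every strongly bounded subset of $E'$ which is a countable union of equicontinuous sets is equicontinuous). An $(LM)$-space is the locally convex inductive limit of an increasing sequence $(E_n,\tau_n)$ of metrizable locally convex spaces with $E=\bigcup_nE_n$ and $\tau_{n+1}|_{E_n}\le\tau_n$;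 it is regular if every bounded subset of $E$ is contained and bounded in some $E_n$. $E'_\beta=(E',\beta(E',E))$ is the strong dual. *)

theory Defs
  imports "HOL-Analysis.Analysis" "HOL-Library.Function_Algebras"
begin

instantiation "fun" :: (type, real_vector) real_vector
begin
definition scaleR_fun :: "real \<Rightarrow> ('a \<Rightarrow> 'b) \<Rightarrow> 'a \<Rightarrow> 'b"
  where "scaleR_fun c f = (\<lambda>x. c *\<^sub>R f x)"
instance
  by standard (auto simp: scaleR_fun_def fun_eq_iff scaleR_add_right scaleR_add_left)
end

text \<open>A locally convex space is a linear subspace E of a real vector space together
  with a family P of seminorms on E; its topology is the one generated by P.\<close>

definition seminorm_on :: "'a::real_vector set \<Rightarrow> ('a \<Rightarrow> real) \<Rightarrow> bool" where
  "seminorm_on E p \<longleftrightarrow>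
     (\<forall>x\<in>E. \<forall>y\<in>E. p (x + y) \<le> p x + p y) \<and>
     (\<forall>x\<in>E. \<forall>c. p (c *\<^sub>R x) = \<bar>c\<bar> * p x)"

definition lc_topology :: "'a::real_vector set \<Rightarrow> ('a \<Rightarrow> real) set \<Rightarrow> 'a topology" where
  "lc_topology E P = topology (\<lambda>U. U \<subseteq> E \<and>
     (\<forall>x\<in>U. \<exists>F \<epsilon>. finite F \<and> F \<subseteq> P \<and> \<epsilon> > 0 \<and>
        {y\<in>E. \<forall>p\<in>F. p (y - x) < \<epsilon>} \<subseteq> U))"

definition lcs :: "'a::real_vector set \<Rightarrow> ('a \<Rightarrow> real) set \<Rightarrow> bool" where
  "lcs E P \<longleftrightarrow> subspace E \<and> (\<forall>p\<in>P. seminorm_on E p) \<and>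
     (\<forall>x\<in>E. x \<noteq> 0 \<longrightarrow> (\<exists>p\<in>P. p x \<noteq> 0))"

text \<open>Not necessarily Hausdorff locally convex topology (used for the universal property
  of final locally convex topologies).\<close>
definition lc_family :: "'a::real_vector set \<Rightarrow> ('a \<Rightarrow> real) set \<Rightarrow> bool" where
  "lc_family E P \<longleftrightarrow> subspace E \<and> (\<forall>p\<in>P. seminorm_on E p)"

definition linear_on :: "'a::real_vector set \<Rightarrow> ('a \<Rightarrow> 'b::real_vector) \<Rightarrow> bool" where
  "linear_on E f \<longleftrightarrow> (\<forall>x\<in>E. \<forall>y\<in>E. f (x + y) = f x + f y) \<and>
     (\<forall>x\<in>E. \<forall>c. f (c *\<^sub>R x) = c *\<^sub>R f x)"

definition lc_bounded :: "'a::real_vector set \<Rightarrow> ('a \<Rightarrow> real) set \<Rightarrow> 'a set \<Rightarrow> bool" where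
  "lc_bounded E P B \<longleftrightarrow> B \<subseteq> E \<and>
     (\<forall>U. openin (lc_topology E P) U \<and> 0 \<in> U \<longrightarrow> (\<exists>t>0. B \<subseteq> (\<lambda>x. t *\<^sub>R x) ` U))"

definition lc_dual :: "'a::real_vector set \<Rightarrow> ('a \<Rightarrow> real) set \<Rightarrow> ('a \<Rightarrow> real) set" where
  "lc_dual E P = {f. linear_on E f \<and> continuous_map (lc_topology E P) euclideanreal f \<and>
                     (\<forall>x. x \<notin> E \<longrightarrow> f x = 0)}"

definition equicontinuous :: "'a::real_vector set \<Rightarrow> ('a \<Rightarrow> real) set \<Rightarrow> ('a \<Rightarrow> real) set \<Rightarrow> bool" where
  "equicontinuous E P H \<longleftrightarrow>
     (\<forall>x0\<in>E. \<forall>\<epsilon>>0. \<exists>U. openin (lc_topology E P) U \<and> x0 \<in> U \<and>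
        (\<forall>f\<in>H. \<forall>x\<in>U. \<bar>f x - f x0\<bar> < \<epsilon>))"

definition strong_seminorms :: "'a::real_vector set \<Rightarrow> ('a \<Rightarrow> real) set \<Rightarrow> (('a \<Rightarrow> real) \<Rightarrow> real) set" where
  "strong_seminorms E P = {(\<lambda>f. SUP x\<in>B. \<bar>f x\<bar>) | B. lc_bounded E P B \<and> B \<noteq> {}}"

definition resolution :: "'b set \<Rightarrow> ((nat \<Rightarrow> nat) \<Rightarrow> 'b set) \<Rightarrow> bool" where
  "resolution \<Omega> A \<longleftrightarrow> (\<Union>\<alpha>. A \<alpha>) = \<Omega> \<and> (\<forall>\<alpha> \<beta>. \<alpha> \<le> \<beta> \<longrightarrow> A \<alpha> \<subseteq> A \<beta>)"

definition fundamental_bounded_resolution :: "'a::real_vector set \<Rightarrow> ('a \<Rightarrow> real) set \<Rightarrow> bool" where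
  "fundamental_bounded_resolution E P \<longleftrightarrow>
     (\<exists>A. resolution E A \<and> (\<forall>\<alpha>. lc_bounded E P (A \<alpha>)) \<and>
          (\<forall>B. lc_bounded E P B \<longrightarrow> (\<exists>\<alpha>. B \<subseteq> A \<alpha>)))"

definition class_G :: "'a::real_vector set \<Rightarrow> ('a \<Rightarrow> real) set \<Rightarrow> bool" where
  "class_G E P \<longleftrightarrow>
     (\<exists>A. resolution (lc_dual E P) A \<and>
          (\<forall>\<alpha> (s :: nat \<Rightarrow> 'a \<Rightarrow> real). range s \<subseteq> A \<alpha> \<longrightarrow> equicontinuous E P (range s)))"

definition quasi_DF :: "'a::real_vector set \<Rightarrow> ('a \<Rightarrow> real) set \<Rightarrow> bool" where
  "quasi_DF E P \<longleftrightarrow> fundamental_bounded_resolution E P \<and> class_G E P"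

definition aleph0_quasibarrelled :: "'a::real_vector set \<Rightarrow> ('a \<Rightarrow> real) set \<Rightarrow> bool" where
  "aleph0_quasibarrelled E P \<longleftrightarrow>
     (\<forall>H. lc_bounded (lc_dual E P) (strong_seminorms E P) H \<and>
          (\<exists>Hn :: nat \<Rightarrow> ('a \<Rightarrow> real) set. (\<forall>n. equicontinuous E P (Hn n)) \<and> H = (\<Union>n. Hn n))
        \<longrightarrow> equicontinuous E P H)"

definition DF_space :: "'a::real_vector set \<Rightarrow> ('a \<Rightarrow> real) set \<Rightarrow> bool" where
  "DF_space E P \<longleftrightarrow>
     (\<exists>B :: nat \<Rightarrow> 'a set. (\<forall>n. lc_bounded E P (B n)) \<and>
          (\<forall>C. lc_bounded E P C \<longrightarrow> (\<exists>n. C \<subseteq> B n))) \<and>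
     aleph0_quasibarrelled E P"

definition lc_metrizable :: "'a::real_vector set \<Rightarrow> ('a \<Rightarrow> real) set \<Rightarrow> bool" where
  "lc_metrizable E P \<longleftrightarrow> metrizable_space (lc_topology E P)"

definition normable :: "'a::real_vector set \<Rightarrow> ('a \<Rightarrow> real) set \<Rightarrow> bool" where
  "normable E P \<longleftrightarrow> (\<exists>q. seminorm_on E q \<and> (\<forall>x\<in>E. q x = 0 \<longrightarrow> x = 0) \<and>
                         lc_topology E {q} = lc_topology E P)"

definition infinite_dimensional :: "'a::real_vector set \<Rightarrow> bool" where
  "infinite_dimensional E \<longleftrightarrow> \<not> (\<exists>S. finite S \<and> E \<subseteq> span S)"

definition precompact :: "'a::real_vector set \<Rightarrow> ('a \<Rightarrow> real) set \<Rightarrow> 'a set \<Rightarrow> bool" where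
  "precompact E P A \<longleftrightarrow> A \<subseteq> E \<and>
     (\<forall>U. openin (lc_topology E P) U \<and> 0 \<in> U \<longrightarrow>
        (\<exists>K. finite K \<and> K \<subseteq> E \<and> A \<subseteq> (\<Union>k\<in>K. (\<lambda>u. k + u) ` U)))"

definition final_lc ::
  "'a::real_vector set \<Rightarrow> ('a \<Rightarrow> real) set \<Rightarrow> 'i set \<Rightarrow> ('i \<Rightarrow> 'b::real_vector set) \<Rightarrow>
   ('i \<Rightarrow> ('b \<Rightarrow> real) set) \<Rightarrow> ('i \<Rightarrow> 'b \<Rightarrow> 'a) \<Rightarrow> bool" where
  "final_lc E P I X PX j \<longleftrightarrow>
     (\<forall>i\<in>I. linear_on (X i) (j i) \<and> j i ` X i \<subseteq> E \<and>
             continuous_map (lc_topology (X i) (PX i)) (lc_topology E P) (j i)) \<and>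
     (\<forall>Q. lc_family E Q \<and>
          (\<forall>i\<in>I. continuous_map (lc_topology (X i) (PX i)) (lc_topology E Q) (j i)) \<longrightarrow>
          (\<forall>U. openin (lc_topology E Q) U \<longrightarrow> openin (lc_topology E P) U))"

definition LM_space_wrt ::
  "'a::real_vector set \<Rightarrow> ('a \<Rightarrow> real) set \<Rightarrow> (nat \<Rightarrow> 'a set) \<Rightarrow> (nat \<Rightarrow> ('a \<Rightarrow> real) set) \<Rightarrow> bool" where
  "LM_space_wrt E P En Pn \<longleftrightarrow>
     lcs E P \<and>
     (\<forall>n. lcs (En n) (Pn n) \<and> lc_metrizable (En n) (Pn n)) \<and>
     (\<forall>n. En n \<subseteq> En (Suc n)) \<and> (\<Union>n. En n) = E \<and>
     (\<forall>n U. openin (subtopology (lc_topology (En (Suc n)) (Pn (Suc n))) (En n)) U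
              \<longrightarrow> openin (lc_topology (En n) (Pn n)) U) \<and>
     final_lc E P UNIV En Pn (\<lambda>n x. x)"

definition regular_LM_space :: "'a::real_vector set \<Rightarrow> ('a \<Rightarrow> real) set \<Rightarrow> bool" where
  "regular_LM_space E P \<longleftrightarrow>
     (\<exists>En Pn. LM_space_wrt E P En Pn \<and>
        (\<forall>B. lc_bounded E P B \<longrightarrow> (\<exists>n. B \<subseteq> En n \<and> lc_bounded (En n) (Pn n) B)))"

definition sum_carrier :: "nat set \<Rightarrow> (nat \<Rightarrow> 'a::real_vector set) \<Rightarrow> (nat \<Rightarrow> 'a) set" where
  "sum_carrier I Es = {x. (\<forall>n. x n \<in> (if n \<in> I then Es n else {0})) \<and> finite {n. x n \<noteq> 0}}"

definition prod_carrier :: "nat set \<Rightarrow> (nat \<Rightarrow> 'a::real_vector set) \<Rightarrow> (nat \<Rightarrow> 'a) set" where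
  "prod_carrier I Es = {x. \<forall>n. x n \<in> (if n \<in> I then Es n else {0})}"

definition prod_seminorms :: "nat set \<Rightarrow> (nat \<Rightarrow> ('a \<Rightarrow> real) set) \<Rightarrow> ((nat \<Rightarrow> 'a) \<Rightarrow> real) set" where
  "prod_seminorms I Ps = {(\<lambda>x. p (x n)) | n p. n \<in> I \<and> p \<in> Ps n}"

definition sum_injection :: "nat \<Rightarrow> 'a::zero \<Rightarrow> nat \<Rightarrow> 'a" where
  "sum_injection n v = (\<lambda>m. if m = n then v else 0)"

end

theory Submission
  imports Defs
begin

text \<open>
  All notions are expressed through continuous seminorms. In a metrizable step \<open>E\<^sub>n\<close> of an (LM)-space
  choose an increasing cofinal sequence of continuous seminorms \<open>q\<^sub>n\<^sub>,\<^sub>k\<close>. The bounded sets of the steps are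
  described by the values bounding the \<open>q\<^sub>n\<^sub>,\<^sub>k\<close>, and the equicontinuous sets of the dual by choosing one
  \<open>q\<^sub>n\<^sub>,\<^sub>k\<close> for every \<open>n\<close>; both are indexed by sequences of naturals. Since metrizable spaces
  are quasibarrelled, the same sets of functionals are the strongly bounded ones, and the class G
  resolution of the strong dual comes from the bounded resolution of the space itself. Sums and products are handled
  coordinatewise, coding a sequence of sequences by one sequence; subspaces need the Hahn--Banach theorem.

  A precompact set is metrizable as soon as the restrictions to it of the functionals form a separable
  space for the uniform norm. By Ascoli each sequence in a member of the class G resolution is totally
  bounded there. An uncountable separated set of functionals would contain an infinite sequence lying in one member,
  because indices agreeing with a fixed \<open>\<alpha>\<close> on longer and longer initial segments have a
  common upper bound.
\<close>

section \<open>Continuous seminorms\<close>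

text \<open>Class G gives equicontinuity of sequences only; a whole member of the resolution need
  not be equicontinuous. Every use of it therefore stays with countably many functionals inside one
  member: subspaces lift a sequence term by term, products and sums treat the components of one
  sequence, and the metrizability argument extracts a sequence from an uncountable set. Separability
  gives metrizability because evaluation at a countable dense set of functionals maps the precompact
  set \<open>K\<close> into a countable power of the reals. The inverse is continuous since, by
  Hahn-Banach, \<open>q (y - x)\<close> is the value of a functional dominated by \<open>q\<close>,
  and these functionals are totally bounded uniformly on \<open>K\<close>. Sums and products are
  dual to each other. Bounded sets of a sum and functionals on a product live on finitely many
  coordinates, so their resolutions carry one extra entry as a cut-off; bounded sets of a product
  and functionals on a sum involve all coordinates at once. A metrizable space with a fundamental
  sequence of bounded sets has a bounded ball by a diagonal argument, hence is normable; this
  excludes DF in (i).\<close>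

lemma linear_on_add: "linear_on E f \<Longrightarrow> x \<in> E \<Longrightarrow> y \<in> E \<Longrightarrow> f (x + y) = f x + f y"
  by (simp add: linear_on_def)

lemma linear_on_scale: "linear_on E f \<Longrightarrow> x \<in> E \<Longrightarrow> f (c *\<^sub>R x) = c *\<^sub>R f x"
  by (simp add: linear_on_def)

lemma linear_on_zero: "linear_on E f \<Longrightarrow> subspace E \<Longrightarrow> f 0 = 0"
  using linear_on_scale[of E f 0 0] subspace_0 by auto

lemma linear_on_diff:
  assumes "linear_on E f" "subspace E" "x \<in> E" "y \<in> E"
  shows "f (x - y) = f x - f y"
proof -
  have "f ((x - y) + y) = f (x - y) + f y"
    using assms subspace_diff[of E x y] unfolding linear_on_def by blast
  then show ?thesis by simp
qed

lemma seminorm_on_triangle: "seminorm_on E p \<Longrightarrow> x \<in> E \<Longrightarrow> y \<in> E \<Longrightarrow> p (x + y) \<le> p x + p y"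
  by (simp add: seminorm_on_def)

lemma seminorm_on_scale: "seminorm_on E p \<Longrightarrow> x \<in> E \<Longrightarrow> p (c *\<^sub>R x) = \<bar>c\<bar> * p x"
  by (simp add: seminorm_on_def)

lemma seminorm_on_zero: "subspace E \<Longrightarrow> seminorm_on E p \<Longrightarrow> p 0 = 0"
  using seminorm_on_scale[of E p 0 0] subspace_0 by auto

lemma seminorm_on_minus: "seminorm_on E p \<Longrightarrow> x \<in> E \<Longrightarrow> p (- x) = p x"
  using seminorm_on_scale[of E p x "-1"] by auto

lemma seminorm_on_nonneg:
  assumes "subspace E" "seminorm_on E p" "x \<in> E"
  shows "0 \<le> p x"
proof -
  have "p (x + - x) \<le> p x + p (- x)"
    using assms seminorm_on_triangle subspace_neg by blast
  then show ?thesis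
    using assms seminorm_on_minus[of E p x] seminorm_on_zero[of E p] by auto
qed

lemma seminorm_on_diff_triangle:
  assumes "subspace E" "seminorm_on E p" "x \<in> E" "y \<in> E" "z \<in> E"
  shows "p (x - z) \<le> p (x - y) + p (y - z)"
  using seminorm_on_triangle[of E p "x - y" "y - z"] subspace_diff[of E x y]
    subspace_diff[of E y z] assms by auto

lemma seminorm_on_add:
  "seminorm_on E p \<Longrightarrow> seminorm_on E q \<Longrightarrow> seminorm_on E (\<lambda>x. p x + q x)"
  unfolding seminorm_on_def by (force simp: algebra_simps)

lemma seminorm_on_mult:
  "seminorm_on E p \<Longrightarrow> 0 \<le> c \<Longrightarrow> seminorm_on E (\<lambda>x. c * p x)"
  unfolding seminorm_on_def by (simp add: mult_left_mono distrib_left[symmetric])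

lemma seminorm_on_const_zero: "seminorm_on E (\<lambda>x. 0)"
  by (simp add: seminorm_on_def)

lemma seminorm_on_subset: "seminorm_on E p \<Longrightarrow> F \<subseteq> E \<Longrightarrow> seminorm_on F p"
  unfolding seminorm_on_def by blast

lemma seminorm_on_comp:
  assumes "seminorm_on E p" "linear_on X j" "j ` X \<subseteq> E"
  shows "seminorm_on X (\<lambda>x. p (j x))"
  using assms unfolding seminorm_on_def linear_on_def by (auto simp: image_subset_iff)

lemma seminorm_on_abs: "linear_on E f \<Longrightarrow> seminorm_on E (\<lambda>x. \<bar>f x\<bar>)"
  by (auto simp: seminorm_on_def linear_on_def abs_mult)

text \<open>Serves polars and strong seminorms. Pointwise boundedness is what makes the real
  \<open>SUP\<close> a genuine supremum.\<close>

lemma seminorm_on_SUP: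
  fixes q :: "'i \<Rightarrow> 'a::real_vector \<Rightarrow> real"
  assumes "I \<noteq> {}" "\<And>i. i \<in> I \<Longrightarrow> seminorm_on E (q i)" "subspace E"
    and bdd: "\<And>x. x \<in> E \<Longrightarrow> bdd_above ((\<lambda>i. q i x) ` I)"
  shows "seminorm_on E (\<lambda>x. SUP i\<in>I. q i x)"
  unfolding seminorm_on_def
proof (intro conjI ballI allI)
  fix x y assume xy: "x \<in> E" "y \<in> E"
  show "(SUP i\<in>I. q i (x + y)) \<le> (SUP i\<in>I. q i x) + (SUP i\<in>I. q i y)"
  proof (rule cSUP_least)
    fix i assume i: "i \<in> I"
    have "q i (x + y) \<le> q i x + q i y"
      using assms(2) i xy seminorm_on_triangle by blast
    also have "\<dots> \<le> (SUP i\<in>I. q i x) + (SUP i\<in>I. q i y)"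
      by (intro add_mono cSUP_upper bdd xy i)
    finally show "q i (x + y) \<le> (SUP i\<in>I. q i x) + (SUP i\<in>I. q i y)" .
  qed fact
next
  fix x c assume x: "x \<in> E"
  have scale: "(SUP i\<in>I. q i (c *\<^sub>R x)) = (SUP i\<in>I. \<bar>c\<bar> * q i x)"
    by (rule SUP_cong) (auto simp: seminorm_on_scale[OF assms(2) x])
  also have "\<dots> = \<bar>c\<bar> * (SUP i\<in>I. q i x)"
  proof (cases "c = 0")
    case True
    then show ?thesis using assms(1) by simp
  next
    case False
    show ?thesis
    proof (rule antisym)
      show "(SUP i\<in>I. \<bar>c\<bar> * q i x) \<le> \<bar>c\<bar> * (SUP i\<in>I. q i x)"
        by (intro cSUP_least assms(1) mult_left_mono cSUP_upper bdd x) auto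
      obtain M where M: "\<And>i. i \<in> I \<Longrightarrow> q i x \<le> M"
        using bdd[OF x] by (auto simp: bdd_above_def)
      have "bdd_above ((\<lambda>i. \<bar>c\<bar> * q i x) ` I)"
        by (rule bdd_aboveI2[of _ _ "\<bar>c\<bar> * M"]) (simp add: M mult_left_mono)
      then have "q i x \<le> (SUP i\<in>I. \<bar>c\<bar> * q i x) / \<bar>c\<bar>" if "i \<in> I" for i
        using cSUP_upper[OF that, of "\<lambda>i. \<bar>c\<bar> * q i x"] False
        by (simp add: pos_le_divide_eq mult.commute)
      then have "(SUP i\<in>I. q i x) \<le> (SUP i\<in>I. \<bar>c\<bar> * q i x) / \<bar>c\<bar>"
        by (intro cSUP_least assms(1))
      then show "\<bar>c\<bar> * (SUP i\<in>I. q i x) \<le> (SUP i\<in>I. \<bar>c\<bar> * q i x)"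
        using False by (simp add: pos_le_divide_eq mult.commute)
    qed
  qed
  finally show "(SUP i\<in>I. q i (c *\<^sub>R x)) = \<bar>c\<bar> * (SUP i\<in>I. q i x)" .
qed

text \<open>Homogeneity spreads an estimate from the unit ball to the whole space. This turns
  statements about neighbourhoods of \<open>0\<close> into inequalities between seminorms.\<close>

lemma seminorm_le_if_unit_ball_le:
  assumes "subspace E" "seminorm_on E p" "seminorm_on E q"
    and ball: "\<And>x. x \<in> E \<Longrightarrow> q x < 1 \<Longrightarrow> p x \<le> 1"
    and x: "x \<in> E"
  shows "p x \<le> q x"
proof (rule ccontr)
  assume "\<not> p x \<le> q x"
  \<comment> \<open>A number strictly between the two values is positive even if
    \<open>q x = 0\<close>, so dividing by it is always possible.\<close>
  then obtain c where c: "q x < c" "c < p x" using dense[of "q x" "p x"] by auto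
  have pos: "0 < c" using seminorm_on_nonneg[OF assms(1,3) x] c by auto
  have "q ((1/c) *\<^sub>R x) < 1" "\<not> p ((1/c) *\<^sub>R x) \<le> 1"
    using seminorm_on_scale[OF assms(3) x, of "1/c"] seminorm_on_scale[OF assms(2) x, of "1/c"]
      pos c by auto
  then show False using ball[of "(1/c) *\<^sub>R x"] assms(1) x subspace_scale by blast
qed

section \<open>Calculus of continuous seminorms\<close>

text \<open>An algebraic form of continuity for \<open>lc_topology E P\<close>. For an
  \<open>lc_family\<close> it agrees with the topological one: unit balls of such seminorms are
  open, and a seminorm bounded on a neighbourhood of \<open>0\<close> is of this kind.\<close>

definition cont_seminorm :: "'a::real_vector set \<Rightarrow> ('a \<Rightarrow> real) set \<Rightarrow> ('a \<Rightarrow> real) \<Rightarrow> bool" where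
  "cont_seminorm E P q \<longleftrightarrow> seminorm_on E q \<and>
     (\<exists>F C. finite F \<and> F \<subseteq> P \<and> 0 \<le> C \<and> (\<forall>x\<in>E. q x \<le> C * (\<Sum>p\<in>F. p x)))"

lemma lcs_imp_lc_family: "lcs E P \<Longrightarrow> lc_family E P"
  by (simp add: lcs_def lc_family_def)

lemma lc_family_subspace: "lc_family E P \<Longrightarrow> subspace E"
  by (simp add: lc_family_def)

lemma lc_family_seminorm: "lc_family E P \<Longrightarrow> p \<in> P \<Longrightarrow> seminorm_on E p"
  by (simp add: lc_family_def)

lemma cont_seminorm_seminorm: "cont_seminorm E P q \<Longrightarrow> seminorm_on E q"
  by (simp add: cont_seminorm_def)

lemma cont_seminorm_member:
  assumes "lc_family E P" "p \<in> P"
  shows "cont_seminorm E P p"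
  unfolding cont_seminorm_def
  using assms lc_family_seminorm[OF assms] by (intro conjI exI[of _ "{p}"] exI[of _ 1]) auto

lemma cont_seminorm_mono:
  assumes "seminorm_on E p" "cont_seminorm E P q" "\<And>x. x \<in> E \<Longrightarrow> p x \<le> q x"
  shows "cont_seminorm E P p"
proof -
  obtain F C where "finite F" "F \<subseteq> P" "0 \<le> C" "\<And>x. x \<in> E \<Longrightarrow> q x \<le> C * (\<Sum>p\<in>F. p x)"
    using assms(2) unfolding cont_seminorm_def by blast
  then show ?thesis
    unfolding cont_seminorm_def using assms(1,3) by (meson order_trans)
qed

lemma cont_seminorm_mult:
  assumes "cont_seminorm E P q" "0 \<le> c"
  shows "cont_seminorm E P (\<lambda>x. c * q x)"
proof -
  obtain F C where F: "finite F" "F \<subseteq> P" "0 \<le> C" "\<And>x. x \<in> E \<Longrightarrow> q x \<le> C * (\<Sum>p\<in>F. p x)"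
    using assms(1) unfolding cont_seminorm_def by blast
  have "\<forall>x\<in>E. c * q x \<le> (c * C) * (\<Sum>p\<in>F. p x)"
    using F(4) assms(2) by (simp add: mult_left_mono mult.assoc)
  then show ?thesis
    unfolding cont_seminorm_def using F assms cont_seminorm_seminorm seminorm_on_mult
    by (metis mult_nonneg_nonneg)
qed

lemma cont_seminorm_add:
  assumes fam: "lc_family E P" and "cont_seminorm E P q" "cont_seminorm E P r"
  shows "cont_seminorm E P (\<lambda>x. q x + r x)"
proof -
  obtain F C where F: "finite F" "F \<subseteq> P" "0 \<le> C" "\<And>x. x \<in> E \<Longrightarrow> q x \<le> C * (\<Sum>p\<in>F. p x)"
    using assms(2) unfolding cont_seminorm_def by blast
  obtain G D where G: "finite G" "G \<subseteq> P" "0 \<le> D" "\<And>x. x \<in> E \<Longrightarrow> r x \<le> D * (\<Sum>p\<in>G. p x)"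
    using assms(3) unfolding cont_seminorm_def by blast
  have "q x + r x \<le> (C + D) * (\<Sum>p\<in>F \<union> G. p x)" if x: "x \<in> E" for x
  proof -
    have nonneg: "0 \<le> p x" if "p \<in> F \<union> G" for p
      using fam F(2) G(2) lc_family_subspace lc_family_seminorm seminorm_on_nonneg x that
      by blast
    have "(\<Sum>p\<in>F. p x) \<le> (\<Sum>p\<in>F \<union> G. p x)" "(\<Sum>p\<in>G. p x) \<le> (\<Sum>p\<in>F \<union> G. p x)"
      using nonneg F(1) G(1) by (auto intro!: sum_mono2)
    then have "C * (\<Sum>p\<in>F. p x) \<le> C * (\<Sum>p\<in>F \<union> G. p x)"
      "D * (\<Sum>p\<in>G. p x) \<le> D * (\<Sum>p\<in>F \<union> G. p x)"
      using F(3) G(3) by (auto intro: mult_left_mono)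
    then show ?thesis using F(4)[OF x] G(4)[OF x] by (simp add: distrib_right)
  qed
  moreover have "seminorm_on E (\<lambda>x. q x + r x)"
    using assms(2,3) cont_seminorm_seminorm seminorm_on_add by blast
  ultimately show ?thesis
    unfolding cont_seminorm_def
    using F(1-3) G(1-3) by (intro conjI exI[of _ "F \<union> G"] exI[of _ "C + D"]) auto
qed

lemma cont_seminorm_const_zero: "cont_seminorm E P (\<lambda>x. 0)"
  unfolding cont_seminorm_def
  by (intro conjI seminorm_on_const_zero exI[of _ "{}"] exI[of _ 0]) auto

lemma cont_seminorm_sum:
  assumes "lc_family E P" "\<And>i. i \<in> F \<Longrightarrow> cont_seminorm E P (q i)"
  shows "cont_seminorm E P (\<lambda>x. \<Sum>i\<in>F. q i x)"
  using assms(2)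
  by (induction F rule: infinite_finite_induct)
    (auto simp: cont_seminorm_const_zero cont_seminorm_add assms(1))

lemma cont_seminorm_restrict:
  assumes "cont_seminorm E P q" "F \<subseteq> E"
  shows "cont_seminorm F P q"
proof -
  obtain G C where "finite G" "G \<subseteq> P" "0 \<le> C" "\<forall>x\<in>E. q x \<le> C * (\<Sum>p\<in>G. p x)"
    using assms(1) unfolding cont_seminorm_def by blast
  moreover have "seminorm_on F q" using assms seminorm_on_subset cont_seminorm_seminorm by blast
  ultimately show ?thesis
    unfolding cont_seminorm_def using assms(2) by (intro conjI exI[of _ G] exI[of _ C]) auto
qed

section \<open>The topology generated by a family of seminorms\<close>

lemma istopology_lc:
  fixes E :: "'a::real_vector set" and P :: "('a \<Rightarrow> real) set"
  shows
  "istopology (\<lambda>U. U \<subseteq> E \<and>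
     (\<forall>x\<in>U. \<exists>F \<epsilon>. finite F \<and> F \<subseteq> P \<and> \<epsilon> > 0 \<and>
        {y\<in>E. \<forall>p\<in>F. p (y - x) < \<epsilon>} \<subseteq> U))"
  unfolding istopology_def
proof (intro conjI allI impI; (elim conjE)?)
  fix S T assume S: "S \<subseteq> E" "\<forall>x\<in>S. \<exists>F \<epsilon>. finite F \<and> F \<subseteq> P \<and> 0 < \<epsilon> \<and> {y \<in> E. \<forall>p\<in>F. p (y - x) < \<epsilon>} \<subseteq> S"
    and T: "T \<subseteq> E" "\<forall>x\<in>T. \<exists>F \<epsilon>. finite F \<and> F \<subseteq> P \<and> 0 < \<epsilon> \<and> {y \<in> E. \<forall>p\<in>F. p (y - x) < \<epsilon>} \<subseteq> T"
  show "S \<inter> T \<subseteq> E" using S by auto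
  show "\<forall>x\<in>S \<inter> T. \<exists>F \<epsilon>. finite F \<and> F \<subseteq> P \<and> 0 < \<epsilon> \<and> {y \<in> E. \<forall>p\<in>F. p (y - x) < \<epsilon>} \<subseteq> S \<inter> T"
  proof
    fix x assume "x \<in> S \<inter> T"
    then obtain F e G d where "finite F" "F \<subseteq> P" "0 < e" "{y \<in> E. \<forall>p\<in>F. p (y - x) < e} \<subseteq> S"
      "finite G" "G \<subseteq> P" "0 < d" "{y \<in> E. \<forall>p\<in>G. p (y - x) < d} \<subseteq> T"
      using bspec[OF S(2), of x] bspec[OF T(2), of x] by auto
    then have "finite (F \<union> G)" "F \<union> G \<subseteq> P" "0 < min e d"
      "{y \<in> E. \<forall>p\<in>F \<union> G. p (y - x) < min e d} \<subseteq> S \<inter> T"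
      by (auto simp: subset_iff)
    then show "\<exists>F \<epsilon>. finite F \<and> F \<subseteq> P \<and> 0 < \<epsilon> \<and> {y \<in> E. \<forall>p\<in>F. p (y - x) < \<epsilon>} \<subseteq> S \<inter> T"
      by (intro exI conjI)
  qed
next
  fix \<U> assume U: "\<forall>S\<in>\<U>. S \<subseteq> E \<and> (\<forall>x\<in>S. \<exists>F \<epsilon>. finite F \<and> F \<subseteq> P \<and> 0 < \<epsilon> \<and> {y \<in> E. \<forall>p\<in>F. p (y - x) < \<epsilon>} \<subseteq> S)"
  show "\<Union>\<U> \<subseteq> E" using U by auto
  show "\<forall>x\<in>\<Union>\<U>. \<exists>F \<epsilon>. finite F \<and> F \<subseteq> P \<and> 0 < \<epsilon> \<and> {y \<in> E. \<forall>p\<in>F. p (y - x) < \<epsilon>} \<subseteq> \<Union>\<U>"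
  proof
    fix x assume "x \<in> \<Union>\<U>"
    then obtain S where S: "S \<in> \<U>" "x \<in> S" by auto
    then obtain F e where "finite F" "F \<subseteq> P" "0 < e" "{y \<in> E. \<forall>p\<in>F. p (y - x) < e} \<subseteq> S"
      using bspec[OF conjunct2[OF bspec[OF U]], of S x] by auto
    moreover have "S \<subseteq> \<Union>\<U>" using S by auto
    ultimately show "\<exists>F \<epsilon>. finite F \<and> F \<subseteq> P \<and> 0 < \<epsilon> \<and> {y \<in> E. \<forall>p\<in>F. p (y - x) < \<epsilon>} \<subseteq> \<Union>\<U>"
      by (meson order_trans)
  qed
qed

lemma openin_lc_topology:
  "openin (lc_topology E P) U \<longleftrightarrow> U \<subseteq> E \<and>
     (\<forall>x\<in>U. \<exists>F \<epsilon>. finite F \<and> F \<subseteq> P \<and> \<epsilon> > 0 \<and>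
        {y\<in>E. \<forall>p\<in>F. p (y - x) < \<epsilon>} \<subseteq> U)"
  unfolding lc_topology_def using istopology_lc[of E P] by (simp add: topology_inverse')

lemma openin_lc_topologyE:
  assumes "openin (lc_topology E P) U" "x \<in> U"
  obtains F \<epsilon> where "finite F" "F \<subseteq> P" "\<epsilon> > 0" "{y\<in>E. \<forall>p\<in>F. p (y - x) < \<epsilon>} \<subseteq> U"
proof -
  have "\<forall>x\<in>U. \<exists>F \<epsilon>. finite F \<and> F \<subseteq> P \<and> \<epsilon> > 0 \<and> {y\<in>E. \<forall>p\<in>F. p (y - x) < \<epsilon>} \<subseteq> U"
    using assms(1) unfolding openin_lc_topology by (rule conjunct2)
  from bspec[OF this assms(2)] show thesis using that by (elim exE conjE)
qed

lemma topspace_lc_topology [simp]: "topspace (lc_topology E P) = E"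
proof -
  have "openin (lc_topology E P) E"
    unfolding openin_lc_topology
    by (intro conjI ballI exI[of _ "{}"] exI[of _ 1]) auto
  then show ?thesis
    by (metis openin_lc_topology openin_subset openin_topspace subset_antisym)
qed

text \<open>A finite set of generators and a radius merge into one rescaled sum; conversely the
  domination constant of a continuous seminorm yields a radius. Afterwards one seminorm and radius
  \<open>1\<close> describe every neighbourhood.\<close>

lemma openin_lc_topology_cont_seminorm:
  assumes fam: "lc_family E P"
  shows "openin (lc_topology E P) U \<longleftrightarrow> U \<subseteq> E \<and>
     (\<forall>x\<in>U. \<exists>q. cont_seminorm E P q \<and> {y\<in>E. q (y - x) < 1} \<subseteq> U)" (is "_ \<longleftrightarrow> ?R")
proof
  assume L: "openin (lc_topology E P) U"
  then have UE: "U \<subseteq> E" by (simp add: openin_lc_topology)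
  have "\<exists>q. cont_seminorm E P q \<and> {y\<in>E. q (y - x) < 1} \<subseteq> U" if x: "x \<in> U" for x
  proof -
    obtain F e where F: "finite F" "F \<subseteq> P" "0 < e" "{y \<in> E. \<forall>p\<in>F. p (y - x) < e} \<subseteq> U"
      using openin_lc_topologyE[OF L x] .
    let ?q = "\<lambda>x. (1/e) * (\<Sum>p\<in>F. p x)"
    have q: "cont_seminorm E P ?q"
      using F fam by (intro cont_seminorm_mult cont_seminorm_sum cont_seminorm_member) auto
    have "p (y - x) < e" if y: "y \<in> E" "?q (y - x) < 1" and p: "p \<in> F" for y p
    proof -
      have yx: "y - x \<in> E" using y(1) x UE fam lc_family_subspace subspace_diff by blast
      have "p (y - x) \<le> (\<Sum>p\<in>F. p (y - x))"
        using F fam lc_family_subspace lc_family_seminorm seminorm_on_nonneg yx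
        by (intro member_le_sum p) blast+
      also have "\<dots> < e" using y(2) F(3) by (simp add: field_simps)
      finally show ?thesis .
    qed
    then show ?thesis using q F(4) by (intro exI[of _ ?q]) auto
  qed
  then show ?R using UE by auto
next
  assume R: ?R
  have "\<exists>F e. finite F \<and> F \<subseteq> P \<and> 0 < e \<and> {y \<in> E. \<forall>p\<in>F. p (y - x) < e} \<subseteq> U" if x: "x \<in> U" for x
  proof -
    obtain q where q: "cont_seminorm E P q" "{y\<in>E. q (y - x) < 1} \<subseteq> U" using R x by blast
    obtain F C where F: "finite F" "F \<subseteq> P" "0 \<le> C" "\<And>x. x \<in> E \<Longrightarrow> q x \<le> C * (\<Sum>p\<in>F. p x)"
      using q(1) unfolding cont_seminorm_def by blast
    \<comment> \<open>The two \<open>+ 1\<close> keep \<open>e\<close> defined and positive when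
      \<open>C = 0\<close> or \<open>F\<close> is empty, and make the final estimate strict.\<close>
    define e where "e = 1 / ((C + 1) * (real (card F) + 1))"
    have e: "0 < e" using F(3) by (simp add: e_def)
    have "q (y - x) < 1" if y: "y \<in> E" "\<forall>p\<in>F. p (y - x) < e" for y
    proof -
      have yx: "y - x \<in> E" using y(1) x R fam lc_family_subspace subspace_diff by blast
      have "(\<Sum>p\<in>F. p (y - x)) \<le> real (card F) * e"
        using y(2) by (intro sum_bounded_above) auto
      then have "q (y - x) \<le> C * (real (card F) * e)"
        using F(3,4) yx mult_left_mono order_trans by blast
      also have "\<dots> < (C + 1) * ((real (card F) + 1) * e)"
      proof -
        have "C * (real (card F) * e) \<le> C * ((real (card F) + 1) * e)"
          using F(3) e by (intro mult_left_mono) auto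
        moreover have "0 < (real (card F) + 1) * e" using e by (intro mult_pos_pos) auto
        ultimately show ?thesis by (simp add: distrib_right)
      qed
      also have "\<dots> = 1"
      proof -
        have "(C + 1) * (real (card F) + 1) \<noteq> 0" using F(3) by simp
        then show ?thesis unfolding e_def by (simp add: mult.assoc[symmetric] del: mult_eq_0_iff)
      qed
      finally show ?thesis .
    qed
    then have "{y \<in> E. \<forall>p\<in>F. p (y - x) < e} \<subseteq> U" using q(2) by auto
    then show ?thesis using F(1,2) e by (intro exI[of _ F] exI[of _ e] conjI)
  qed
  then show "openin (lc_topology E P) U" using R by (simp add: openin_lc_topology)
qed

lemma nhd_0_seminorm_ball:
  assumes "lc_family E P" "openin (lc_topology E P) U" "0 \<in> U"
  obtains q where "cont_seminorm E P q" "{y\<in>E. q y < 1} \<subseteq> U"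
proof -
  have "\<forall>x\<in>U. \<exists>q. cont_seminorm E P q \<and> {y\<in>E. q (y - x) < 1} \<subseteq> U"
    using assms(2) unfolding openin_lc_topology_cont_seminorm[OF assms(1)] by (rule conjunct2)
  from bspec[OF this assms(3)] show thesis using that by auto
qed

lemma openin_seminorm_ball:
  assumes fam: "lc_family E P" and q: "cont_seminorm E P q" and x: "x \<in> E"
  shows "openin (lc_topology E P) {y\<in>E. q (y - x) < r}"
  unfolding openin_lc_topology_cont_seminorm[OF fam]
proof (intro conjI ballI)
  fix y assume "y \<in> {y\<in>E. q (y - x) < r}"
  then have y: "y \<in> E" "q (y - x) < r" by auto
  \<comment> \<open>The remaining distance to the boundary; rescaling \<open>q\<close> by
    \<open>1 / d\<close> gives a unit ball around \<open>y\<close> inside the given ball.\<close>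
  define d where "d = r - q (y - x)"
  have d: "d > 0" using y by (simp add: d_def)
  have "q (z - x) < r" if "z \<in> E" "1 / d * q (z - y) < 1" for z
    using seminorm_on_diff_triangle[OF lc_family_subspace[OF fam] cont_seminorm_seminorm[OF q] that(1) y(1) x]
      that(2) d by (simp add: d_def field_simps)
  then show "\<exists>p. cont_seminorm E P p \<and> {z\<in>E. p (z - y) < 1} \<subseteq> {y\<in>E. q (y - x) < r}"
    using cont_seminorm_mult[OF q, of "1/d"] d by (intro exI[of _ "\<lambda>x. 1/d * q x"]) auto
qed auto

lemma openin_seminorm_ball_0:
  assumes fam: "lc_family E P" and q: "cont_seminorm E P q"
  shows "openin (lc_topology E P) {y\<in>E. q y < r}"
  using openin_seminorm_ball[OF assms, of 0] subspace_0[OF lc_family_subspace[OF fam]] by simp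

text \<open>The neighbourhood contains the unit ball of some continuous seminorm, which then
  dominates \<open>q\<close> by homogeneity.\<close>

lemma cont_seminorm_if_bounded_on_nhd:
  assumes fam: "lc_family E P" and q: "seminorm_on E q"
    and U: "openin (lc_topology E P) U" "0 \<in> U" "\<And>x. x \<in> U \<Longrightarrow> q x \<le> 1"
  shows "cont_seminorm E P q"
proof -
  obtain p where p: "cont_seminorm E P p" "{y\<in>E. p y < 1} \<subseteq> U"
    using nhd_0_seminorm_ball[OF fam U(1,2)] .
  have "q x \<le> p x" if "x \<in> E" for x
    using U(3) p(2) that
    by (intro seminorm_le_if_unit_ball_le[OF lc_family_subspace[OF fam] q cont_seminorm_seminorm[OF p(1)]]) auto
  then show ?thesis using cont_seminorm_mono[OF q p(1)] by blast
qed

section \<open>Continuous linear maps and final topologies\<close>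

text \<open>The preimage of the unit ball of \<open>q\<close> is a neighbourhood of \<open>0\<close>
  on which the pulled-back seminorm is at most \<open>1\<close>.\<close>

lemma continuous_map_lc_imp_cont_seminorm:
  assumes X: "lc_family X Q" and E: "lc_family E P" and j: "linear_on X j" "j ` X \<subseteq> E"
    and cont: "continuous_map (lc_topology X Q) (lc_topology E P) j"
    and q: "cont_seminorm E P q"
  shows "cont_seminorm X Q (\<lambda>x. q (j x))"
proof (rule cont_seminorm_if_bounded_on_nhd[OF X])
  show "seminorm_on X (\<lambda>x. q (j x))"
    using seminorm_on_comp[OF cont_seminorm_seminorm[OF q] j] .
  have "openin (lc_topology X Q) {x \<in> topspace (lc_topology X Q). j x \<in> {y\<in>E. q y < 1}}"
    using cont openin_seminorm_ball_0[OF E q] openin_continuous_map_preimage by blast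
  then show "openin (lc_topology X Q) {x \<in> X. j x \<in> E \<and> q (j x) < 1}" by simp
  have "j 0 = 0" using linear_on_zero[OF j(1) lc_family_subspace[OF X]] .
  then show "0 \<in> {x \<in> X. j x \<in> E \<and> q (j x) < 1}"
    using subspace_0[OF lc_family_subspace[OF X]] subspace_0[OF lc_family_subspace[OF E]]
      seminorm_on_zero[OF lc_family_subspace[OF E] cont_seminorm_seminorm[OF q]] by simp
qed auto

text \<open>Linearity moves the test from an arbitrary point to differences, so pulling back the
  generators of the target is enough.\<close>

lemma continuous_map_lcI:
  assumes X: "lc_family X Q" and E: "lc_family E P" and j: "linear_on X j" "j ` X \<subseteq> E"
    and q: "\<And>q. q \<in> P \<Longrightarrow> cont_seminorm X Q (\<lambda>x. q (j x))"
  shows "continuous_map (lc_topology X Q) (lc_topology E P) j"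
  unfolding continuous_map_def
proof (intro conjI allI impI)
  show "j \<in> topspace (lc_topology X Q) \<rightarrow> topspace (lc_topology E P)" using j(2) by auto
  fix U assume U: "openin (lc_topology E P) U"
  have diff: "j (y - x) = j y - j x" if "x \<in> X" "y \<in> X" for x y
    using linear_on_diff[OF j(1) lc_family_subspace[OF X]] that by blast
  have "\<exists>r. cont_seminorm X Q r \<and> {y\<in>X. r (y - x) < 1} \<subseteq> {x\<in>X. j x \<in> U}"
    if x: "x \<in> X" "j x \<in> U" for x
  proof -
    obtain F e where F: "finite F" "F \<subseteq> P" "0 < e" "{y \<in> E. \<forall>p\<in>F. p (y - j x) < e} \<subseteq> U"
      using openin_lc_topologyE[OF U x(2)] .
    let ?r = "\<lambda>x. (1/e) * (\<Sum>p\<in>F. p (j x))"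
    have r: "cont_seminorm X Q ?r"
      using F X q by (intro cont_seminorm_mult cont_seminorm_sum) auto
    have "j y \<in> U" if y: "y \<in> X" "?r (y - x) < 1" for y
    proof -
      have mem: "j (y - x) \<in> E" using y(1) x X lc_family_subspace subspace_diff j(2) by blast
      have "p (j y - j x) < e" if p: "p \<in> F" for p
      proof -
        have "p (j (y - x)) \<le> (\<Sum>p\<in>F. p (j (y - x)))"
          using F E lc_family_subspace lc_family_seminorm seminorm_on_nonneg mem
          by (intro member_le_sum p) blast+
        also have "\<dots> < e" using y(2) F(3) by (simp add: field_simps)
        finally show ?thesis using diff x y by simp
      qed
      then show ?thesis using F(4) y(1) j(2) by blast
    qed
    then show ?thesis using r by (intro exI[of _ ?r]) auto
  qed
  then have "openin (lc_topology X Q) {x \<in> X. j x \<in> U}"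
    unfolding openin_lc_topology_cont_seminorm[OF X] by auto
  then show "openin (lc_topology X Q) {x \<in> topspace (lc_topology X Q). j x \<in> U}" by simp
qed

text \<open>The universal property is applied to the topology generated by \<open>q\<close> alone.
  That topology may fail to be Hausdorff, which is why \<open>final_lc\<close> quantifies over
  \<open>lc_family\<close> instead of \<open>lcs\<close>.\<close>

lemma final_lc_cont_seminorm:
  assumes E: "lc_family E P" and fin: "final_lc E P I X PX j"
    and X: "\<And>i. i \<in> I \<Longrightarrow> lc_family (X i) (PX i)"
    and q: "seminorm_on E q" "\<And>i. i \<in> I \<Longrightarrow> cont_seminorm (X i) (PX i) (\<lambda>x. q (j i x))"
  shows "cont_seminorm E P q"
proof -
  have Q: "lc_family E {q}" using E q(1) by (simp add: lc_family_def)
  have "continuous_map (lc_topology (X i) (PX i)) (lc_topology E {q}) (j i)" if "i \<in> I" for i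
    using fin q(2) that
    by (intro continuous_map_lcI[OF X[OF that] Q]) (auto simp: final_lc_def)
  then have le: "openin (lc_topology E P) U" if "openin (lc_topology E {q}) U" for U
    using fin Q that unfolding final_lc_def by blast
  show ?thesis
  proof (rule cont_seminorm_if_bounded_on_nhd[OF E q(1)])
    show "openin (lc_topology E P) {x\<in>E. q x < 1}"
      using le openin_seminorm_ball_0[OF Q cont_seminorm_member[OF Q]] by simp
    show "0 \<in> {x\<in>E. q x < 1}"
      using E q(1) lc_family_subspace seminorm_on_zero subspace_0 by fastforce
  qed auto
qed

lemma final_lc_comp_cont_seminorm:
  assumes E: "lc_family E P" and fin: "final_lc E P I X PX j" and i: "i \<in> I"
    and X: "lc_family (X i) (PX i)" and q: "cont_seminorm E P q"
  shows "cont_seminorm (X i) (PX i) (\<lambda>x. q (j i x))"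
proof -
  have "linear_on (X i) (j i)" "j i ` X i \<subseteq> E"
    "continuous_map (lc_topology (X i) (PX i)) (lc_topology E P) (j i)"
    using bspec[OF conjunct1[OF fin[unfolded final_lc_def]] i] by blast+
  from continuous_map_lc_imp_cont_seminorm[OF X E this q] show ?thesis .
qed

section \<open>Bounded sets, dual spaces and equicontinuity\<close>

lemma lc_boundedD:
  assumes E: "lc_family E P" and B: "lc_bounded E P B" and q: "cont_seminorm E P q"
  shows "\<exists>C\<ge>0. \<forall>x\<in>B. q x \<le> C"
proof -
  have "0 \<in> {x\<in>E. q x < 1}"
    using E q cont_seminorm_seminorm lc_family_subspace seminorm_on_zero subspace_0 by fastforce
  then obtain t where t: "t > 0" "B \<subseteq> (\<lambda>x. t *\<^sub>R x) ` {x\<in>E. q x < 1}"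
    using B openin_seminorm_ball_0[OF E q] unfolding lc_bounded_def by blast
  have "q x \<le> t" if x: "x \<in> B" for x
  proof -
    obtain y where y: "y \<in> E" "q y < 1" "x = t *\<^sub>R y" using t(2) x by blast
    then have "q x = t * q y" using q t cont_seminorm_seminorm seminorm_on_scale by fastforce
    also have "\<dots> \<le> t * 1" using y t by (intro mult_left_mono) auto
    finally show ?thesis by simp
  qed
  then show ?thesis using t by (intro exI[of _ t]) auto
qed

lemma lc_boundedI:
  assumes E: "lc_family E P" and B: "B \<subseteq> E" and bdd: "\<And>p. p \<in> P \<Longrightarrow> \<exists>C. \<forall>x\<in>B. p x \<le> C"
  shows "lc_bounded E P B"
  unfolding lc_bounded_def
proof (intro conjI allI impI B)
  fix U assume U: "openin (lc_topology E P) U \<and> 0 \<in> U"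
  then obtain F e where F: "finite F" "F \<subseteq> P" "0 < e" "{y \<in> E. \<forall>p\<in>F. p y < e} \<subseteq> U"
    using openin_lc_topologyE[of E P U 0] by auto
  obtain C where C: "\<And>p x. p \<in> P \<Longrightarrow> x \<in> B \<Longrightarrow> p x \<le> C p" using bdd by metis
  \<comment> \<open>Absolute values and the extra \<open>1\<close> give one positive bound that is
    strict for all \<open>p\<close> in \<open>F\<close>, also when \<open>F\<close> is
    empty.\<close>
  define D where "D = (\<Sum>p\<in>F. \<bar>C p\<bar>) + 1"
  have CD: "C p < D" if "p \<in> F" for p
  proof -
    have "\<bar>C p\<bar> \<le> (\<Sum>p\<in>F. \<bar>C p\<bar>)" by (rule member_le_sum) (use that F in auto)
    then show ?thesis by (simp add: D_def)
  qed
  have D: "D > 0" unfolding D_def by (smt (verit) sum_nonneg abs_ge_zero)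
  define t where "t = D / e"
  have t: "t > 0" using D F by (simp add: t_def)
  have "B \<subseteq> (\<lambda>x. t *\<^sub>R x) ` U"
  proof
    fix x assume x: "x \<in> B"
    have "p ((1/t) *\<^sub>R x) < e" if p: "p \<in> F" for p
    proof -
      have "p ((1/t) *\<^sub>R x) = p x / t"
        using seminorm_on_scale[OF lc_family_seminorm[OF E], of p x "1/t"] p F(2) x B t by auto
      also have "\<dots> < D / t"
        using C[of p x] CD[OF p] p F(2) x t by (intro divide_strict_right_mono) auto
      also have "\<dots> = e" using D F(3) by (simp add: t_def)
      finally show ?thesis .
    qed
    then have "(1/t) *\<^sub>R x \<in> U"
      using F(4) x B lc_family_subspace[OF E] by (auto simp: subspace_scale subset_iff)
    then show "x \<in> (\<lambda>x. t *\<^sub>R x) ` U"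
      using t by (intro image_eqI[of _ _ "(1/t) *\<^sub>R x"]) auto
  qed
  then show "\<exists>t>0. B \<subseteq> (\<lambda>x. t *\<^sub>R x) ` U" using t by auto
qed

lemma lc_bounded_subset: "lc_bounded E P B \<Longrightarrow> C \<subseteq> B \<Longrightarrow> lc_bounded E P C"
  unfolding lc_bounded_def by (meson order_trans)

lemma lc_bounded_carrier: "lc_bounded E P B \<Longrightarrow> B \<subseteq> E"
  by (simp add: lc_bounded_def)

lemma lc_bounded_singleton: "lc_family E P \<Longrightarrow> x \<in> E \<Longrightarrow> lc_bounded E P {x}"
  by (rule lc_boundedI) auto

lemma lc_bounded_insert:
  assumes "lc_family E P" "x \<in> E" "lc_bounded E P B"
  shows "lc_bounded E P (insert x B)"
proof (rule lc_boundedI)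
  fix p assume "p \<in> P"
  then obtain C where "\<forall>x\<in>B. p x \<le> C"
    using lc_boundedD[OF assms(1,3) cont_seminorm_member[OF assms(1)]] by blast
  then show "\<exists>C. \<forall>y\<in>insert x B. p y \<le> C" by (intro exI[of _ "max C (p x)"]) force
qed (use assms lc_bounded_carrier[OF assms(3)] in auto)

section \<open>Equicontinuity and duals through dominating seminorms\<close>

text \<open>Equicontinuity at \<open>0\<close> with tolerance \<open>1\<close> already yields a
  neighbourhood whose seminorm dominates all members of \<open>H\<close> by homogeneity.\<close>

lemma equicontinuousD:
  assumes E: "lc_family E P" and H: "equicontinuous E P H" and lin: "\<And>f. f \<in> H \<Longrightarrow> linear_on E f"
  shows "\<exists>q. cont_seminorm E P q \<and> (\<forall>f\<in>H. \<forall>x\<in>E. \<bar>f x\<bar> \<le> q x)"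
proof -
  note sub = lc_family_subspace[OF E]
  have "0 \<in> E" using sub subspace_0 by auto
  then obtain U where U: "openin (lc_topology E P) U" "0 \<in> U" "\<forall>f\<in>H. \<forall>x\<in>U. \<bar>f x - f 0\<bar> < 1"
    using H unfolding equicontinuous_def by (metis zero_less_one)
  obtain q where q: "cont_seminorm E P q" "{y\<in>E. q y < 1} \<subseteq> U"
    using nhd_0_seminorm_ball[OF E U(1,2)] .
  have "\<bar>f x\<bar> \<le> q x" if f: "f \<in> H" and x: "x \<in> E" for f x
  proof (rule seminorm_le_if_unit_ball_le[OF sub seminorm_on_abs[OF lin[OF f]] cont_seminorm_seminorm[OF q(1)] _ x])
    fix y assume "y \<in> E" "q y < 1"
    then have "\<bar>f y - f 0\<bar> < 1" using U(3) f q(2) by blast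
    then show "\<bar>f y\<bar> \<le> 1" using linear_on_zero[OF lin[OF f] sub] by simp
  qed
  then show ?thesis using q by blast
qed

text \<open>Linearity turns the common bound into
  \<open>\<bar>f x - f x0\<bar> \<le> q (x - x0)\<close>, so one ball around \<open>x0\<close>
  serves all \<open>f\<close>.\<close>

lemma equicontinuousI:
  assumes E: "lc_family E P" and lin: "\<And>f. f \<in> H \<Longrightarrow> linear_on E f"
    and q: "cont_seminorm E P q" "\<And>f x. f \<in> H \<Longrightarrow> x \<in> E \<Longrightarrow> \<bar>f x\<bar> \<le> q x"
  shows "equicontinuous E P H"
  unfolding equicontinuous_def
proof (intro ballI allI impI)
  fix x0 and e :: real assume x0: "x0 \<in> E" and e: "e > 0"
  note sub = lc_family_subspace[OF E]
  have "\<bar>f x - f x0\<bar> < e" if f: "f \<in> H" and x: "x \<in> E" "q (x - x0) < e" for f x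
    using q(2)[OF f subspace_diff[OF sub x(1) x0]] linear_on_diff[OF lin[OF f] sub x(1) x0] x(2)
    by auto
  moreover have "x0 \<in> {x\<in>E. q (x - x0) < e}"
    using x0 e seminorm_on_zero[OF sub cont_seminorm_seminorm[OF q(1)]] by simp
  ultimately show "\<exists>U. openin (lc_topology E P) U \<and> x0 \<in> U \<and> (\<forall>f\<in>H. \<forall>x\<in>U. \<bar>f x - f x0\<bar> < e)"
    using openin_seminorm_ball[OF E q(1) x0] by (intro exI[of _ "{x\<in>E. q (x - x0) < e}"]) auto
qed

text \<open>Continuity of one functional is equicontinuity of the singleton \<open>{f}\<close>, so
  both directions reduce to the two preceding lemmas.\<close>

lemma lc_dual_iff:
  assumes E: "lc_family E P"
  shows "f \<in> lc_dual E P \<longleftrightarrow> linear_on E f \<and> (\<forall>x. x \<notin> E \<longrightarrow> f x = 0) \<and>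
    (\<exists>q. cont_seminorm E P q \<and> (\<forall>x\<in>E. \<bar>f x\<bar> \<le> q x))"
proof -
  have "continuous_map (lc_topology E P) euclideanreal f \<longleftrightarrow>
      (\<exists>q. cont_seminorm E P q \<and> (\<forall>x\<in>E. \<bar>f x\<bar> \<le> q x))" if lin: "linear_on E f"
  proof
    assume c: "continuous_map (lc_topology E P) euclideanreal f"
    have "equicontinuous E P {f}"
      unfolding equicontinuous_def
    proof (intro ballI allI impI)
      fix x0 and e :: real assume x0: "x0 \<in> E" and e: "e > 0"
      have "openin (lc_topology E P) {x \<in> topspace (lc_topology E P). f x \<in> ball (f x0) e}"
        using openin_continuous_map_preimage[OF c] open_ball open_openin by blast
      then show "\<exists>U. openin (lc_topology E P) U \<and> x0 \<in> U \<and> (\<forall>f\<in>{f}. \<forall>x\<in>U. \<bar>f x - f x0\<bar> < e)"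
        using x0 e
        by (intro exI[of _ "{x \<in> E. f x \<in> ball (f x0) e}"]) (auto simp: dist_real_def abs_minus_commute)
    qed
    from equicontinuousD[OF E this] lin
    show "\<exists>q. cont_seminorm E P q \<and> (\<forall>x\<in>E. \<bar>f x\<bar> \<le> q x)" by auto
  next
    assume "\<exists>q. cont_seminorm E P q \<and> (\<forall>x\<in>E. \<bar>f x\<bar> \<le> q x)"
    then obtain q where q: "cont_seminorm E P q" "\<forall>x\<in>E. \<bar>f x\<bar> \<le> q x" by blast
    have eq: "equicontinuous E P {f}" by (rule equicontinuousI[OF E _ q(1)]) (use lin q in auto)
    show "continuous_map (lc_topology E P) euclideanreal f"
      unfolding continuous_map_def
    proof (intro conjI allI impI)
      fix V :: "real set" assume V: "openin euclideanreal V"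
      have "\<exists>U. openin (lc_topology E P) U \<and> x \<in> U \<and> U \<subseteq> {x\<in>E. f x \<in> V}"
        if x: "x \<in> E" "f x \<in> V" for x
      proof -
        obtain e where e: "e > 0" "ball (f x) e \<subseteq> V" using V x by (auto simp: open_contains_ball)
        obtain U where U: "openin (lc_topology E P) U" "x \<in> U" "\<forall>y\<in>U. \<bar>f y - f x\<bar> < e"
          using eq[unfolded equicontinuous_def, rule_format, OF x(1) e(1)] by auto
        have "U \<subseteq> E" using U(1) by (simp add: openin_lc_topology)
        moreover have "f y \<in> V" if "y \<in> U" for y
          using U(3) e(2) that by (auto simp: dist_real_def abs_minus_commute subset_iff)
        ultimately show ?thesis using U by auto
      qed
      then have "openin (lc_topology E P) {x\<in>E. f x \<in> V}"
        by (subst openin_subopen) auto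
      then show "openin (lc_topology E P) {x \<in> topspace (lc_topology E P). f x \<in> V}" by simp
    qed auto
  qed
  then show ?thesis unfolding lc_dual_def by auto
qed

lemma lc_dual_linear: "f \<in> lc_dual E P \<Longrightarrow> linear_on E f"
  by (simp add: lc_dual_def)

section \<open>Resolutions\<close>

lemma resolutionI:
  assumes "\<And>\<alpha>. A \<alpha> \<subseteq> \<Omega>" "\<And>x. x \<in> \<Omega> \<Longrightarrow> \<exists>\<alpha>. x \<in> A \<alpha>" "\<And>\<alpha> \<beta>. \<alpha> \<le> \<beta> \<Longrightarrow> A \<alpha> \<subseteq> A \<beta>"
  shows "resolution \<Omega> A"
  unfolding resolution_def using assms by (intro conjI antisym UN_least allI impI subsetI UN_iff[THEN iffD2]) blast+

lemma resolution_subset: "resolution \<Omega> A \<Longrightarrow> A \<alpha> \<subseteq> \<Omega>"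
  unfolding resolution_def by (metis UNIV_I UN_upper)

lemma resolution_mono: "resolution \<Omega> A \<Longrightarrow> \<alpha> \<le> \<beta> \<Longrightarrow> A \<alpha> \<subseteq> A \<beta>"
  unfolding resolution_def by simp

lemma resolution_cover: "resolution \<Omega> A \<Longrightarrow> x \<in> \<Omega> \<Longrightarrow> \<exists>\<alpha>. x \<in> A \<alpha>"
  unfolding resolution_def by (metis UN_E)

section \<open>The Hahn--Banach theorem\<close>

text \<open>The one-dimensional extension, phrased for graphs: the new value at \<open>x0\<close>
  must lie above all \<open>t - p (x - x0)\<close> and below all \<open>p (y + x0) - s\<close>. The
  triangle inequality leaves room for it.\<close>

lemma hahn_banach_step:
  fixes R :: "('a::real_vector \<times> real) set"
  assumes E: "subspace E" and p: "seminorm_on E p" and R: "subspace R"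
    and dom: "\<And>x t. (x, t) \<in> R \<Longrightarrow> x \<in> E \<and> t \<le> p x" and x0: "x0 \<in> E"
  shows "\<exists>R'. subspace R' \<and> (\<forall>x t. (x, t) \<in> R' \<longrightarrow> x \<in> E \<and> t \<le> p x) \<and> R \<subseteq> R' \<and> x0 \<in> fst ` R'"
proof -
  have sep: "t - p (x - x0) \<le> p (y + x0) - s" if "(x, t) \<in> R" "(y, s) \<in> R" for x t y s
  proof -
    have "(x + y, t + s) \<in> R" using subspace_add[OF R that] by simp
    then have "t + s \<le> p (x + y)" using dom by blast
    also have "x + y = (x - x0) + (y + x0)" by simp
    also have "p \<dots> \<le> p (x - x0) + p (y + x0)"
      using dom[OF that(1)] dom[OF that(2)] x0 E subspace_diff subspace_add
      by (intro seminorm_on_triangle[OF p]) blast+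
    finally show ?thesis by simp
  qed
  have zero: "(0, 0) \<in> R" using subspace_0[OF R] by (simp add: zero_prod_def)
  \<comment> \<open>The least admissible value at \<open>x0\<close>: the supremum of the lower
    bounds.\<close>
  define c where "c = (SUP (x, t)\<in>R. t - p (x - x0))"
  have ne: "R \<noteq> {}" using zero by auto
  have upper: "t - p (x - x0) \<le> c" if "(x, t) \<in> R" for x t
  proof -
    have "bdd_above ((\<lambda>(x, t). t - p (x - x0)) ` R)"
      using sep[OF _ zero] by (intro bdd_aboveI2[of _ _ "p x0"]) auto
    from cSUP_upper[OF that this] show ?thesis unfolding c_def by simp
  qed
  have lower: "c \<le> p (y + x0) - s" if "(y, s) \<in> R" for y s
    unfolding c_def using sep[OF _ that] by (intro cSUP_least[OF ne]) auto
  define R' where "R' = {r + a *\<^sub>R (x0, c) | r a. r \<in> R}"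
  have "subspace R'"
    unfolding subspace_def
  proof (intro conjI ballI allI)
    have "0 = 0 + 0 *\<^sub>R (x0, c)" by (simp add: zero_prod_def)
    then show "0 \<in> R'" unfolding R'_def using subspace_0[OF R] by blast
    fix u v assume "u \<in> R'" "v \<in> R'"
    then obtain r a r' a' where "u = r + a *\<^sub>R (x0, c)" "v = r' + a' *\<^sub>R (x0, c)" "r \<in> R" "r' \<in> R"
      unfolding R'_def by auto
    then have "u + v = (r + r') + (a + a') *\<^sub>R (x0, c)" "r + r' \<in> R"
      using subspace_add[OF R] by (auto simp: algebra_simps)
    then show "u + v \<in> R'" unfolding R'_def by blast
  next
    fix k u assume "u \<in> R'"
    then obtain r a where "u = r + a *\<^sub>R (x0, c)" "r \<in> R" unfolding R'_def by auto
    then have "k *\<^sub>R u = k *\<^sub>R r + (k * a) *\<^sub>R (x0, c)" "k *\<^sub>R r \<in> R"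
      using subspace_scale[OF R] by (auto simp: algebra_simps)
    then show "k *\<^sub>R u \<in> R'" unfolding R'_def by blast
  qed
  moreover have "x \<in> E \<and> t \<le> p x" if xt: "(x, t) \<in> R'" for x t
  proof -
    obtain y s a where ys: "(y, s) \<in> R" "x = y + a *\<^sub>R x0" "t = s + a * c"
      using xt unfolding R'_def by auto
    have yE: "y \<in> E" using dom ys(1) by blast
    have xE: "x \<in> E" using ys yE x0 E by (simp add: subspace_add subspace_scale)
    have scaled: "((1/b) *\<^sub>R y, s / b) \<in> R" for b
      using subspace_scale[OF R ys(1), of "1/b"] by simp
    \<comment> \<open>For nonzero \<open>a\<close> everything is divided by
      \<open>\<bar>a\<bar>\<close>: the upper bound on \<open>c\<close> settles positive
      \<open>a\<close>, the lower bound negative \<open>a\<close>.\<close>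
    consider "a = 0" | "a > 0" | "a < 0" by linarith
    then have "t \<le> p x"
    proof cases
      case 1
      then show ?thesis using dom ys by auto
    next
      case 2
      have "c \<le> p ((1/a) *\<^sub>R y + x0) - s / a" using lower[OF scaled] .
      moreover have "(1/a) *\<^sub>R y + x0 = (1/a) *\<^sub>R x" using 2 ys by (simp add: algebra_simps)
      moreover have "p ((1/a) *\<^sub>R x) = p x / a" using seminorm_on_scale[OF p xE, of "1/a"] 2 by simp
      ultimately show ?thesis using 2 ys by (simp add: field_simps)
    next
      case 3
      define b where "b = - a"
      have b: "b > 0" using 3 b_def by simp
      have "s / b - p ((1/b) *\<^sub>R y - x0) \<le> c" using upper[OF scaled] .
      moreover have "(1/b) *\<^sub>R y - x0 = (1/b) *\<^sub>R x" using b ys b_def by (simp add: algebra_simps)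
      moreover have "p ((1/b) *\<^sub>R x) = p x / b" using seminorm_on_scale[OF p xE, of "1/b"] b by simp
      moreover have "t = s - b * c" using ys b_def by simp
      ultimately show ?thesis using b by (simp add: field_simps)
    qed
    then show ?thesis using xE by blast
  qed
  moreover have "R \<subseteq> R'"
  proof
    fix r assume "r \<in> R"
    moreover have "r = r + 0 *\<^sub>R (x0, c)" by (simp add: zero_prod_def)
    ultimately show "r \<in> R'" unfolding R'_def by blast
  qed
  moreover have "(x0, c) \<in> R'"
  proof -
    have "(x0, c) = 0 + 1 *\<^sub>R (x0, c)" by (simp add: zero_prod_def)
    then show ?thesis unfolding R'_def using subspace_0[OF R] by blast
  qed
  ultimately show ?thesis by (intro exI[of _ R'] conjI) (auto intro: rev_image_eqI)
qed

text \<open>A linear functional dominated by \<open>p\<close> is the same thing as a linear subspace of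
  the product with the reals lying below the graph of \<open>p\<close>: a subspace of this kind is automatically
  single-valued, because \<open>(0, t)\<close> and \<open>(0, -t)\<close> below the graph force \<open>t = 0\<close>.\<close>

theorem hahn_banach:
  fixes E :: "'a::real_vector set"
  assumes E: "subspace E" and F: "subspace F" "F \<subseteq> E" and p: "seminorm_on E p"
    and f: "linear_on F f" "\<And>x. x \<in> F \<Longrightarrow> \<bar>f x\<bar> \<le> p x"
  obtains g where "linear_on E g" "\<And>x. x \<in> F \<Longrightarrow> g x = f x" "\<And>x. x \<in> E \<Longrightarrow> \<bar>g x\<bar> \<le> p x"
    "\<And>x. x \<notin> E \<Longrightarrow> g x = 0"
proof -
  define R0 where "R0 = (\<lambda>x. (x, f x)) ` F"
  define \<R> where "\<R> = {R. subspace R \<and> (\<forall>x t. (x, t) \<in> R \<longrightarrow> x \<in> E \<and> t \<le> p x) \<and> R0 \<subseteq> R}"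
  have sub0: "subspace R0"
    unfolding subspace_def R0_def
  proof (intro conjI ballI allI)
    show "0 \<in> (\<lambda>x. (x, f x)) ` F"
      using subspace_0[OF F(1)] linear_on_zero[OF f(1) F(1)]
      by (intro image_eqI[of _ _ 0]) (auto simp: zero_prod_def)
  qed (auto simp: linear_on_add[OF f(1)] linear_on_scale[OF f(1)] subspace_add[OF F(1)] subspace_scale[OF F(1)]
      intro!: image_eqI)
  have R0: "R0 \<in> \<R>"
    using sub0 F(2) f(2) unfolding \<R>_def R0_def by (auto simp: abs_le_iff)
  \<comment> \<open>The empty chain is treated apart because its union contains no zero;
    \<open>R0\<close> bounds it.\<close>
  have "\<exists>U\<in>\<R>. \<forall>X\<in>C. X \<subseteq> U" if C: "subset.chain \<R> C" for C
  proof (cases "C = {}")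
    case True
    then show ?thesis using R0 by auto
  next
    case False
    have sub: "subspace R" if "R \<in> C" for R using C that unfolding subset_chain_def \<R>_def by blast
    have "subspace (\<Union>C)"
      unfolding subspace_def
    proof (intro conjI ballI allI)
      show "0 \<in> \<Union>C" using False sub subspace_0 by blast
      fix u v assume "u \<in> \<Union>C" "v \<in> \<Union>C"
      then obtain X Y where XY: "X \<in> C" "Y \<in> C" "u \<in> X" "v \<in> Y" by blast
      then have "X \<subseteq> Y \<or> Y \<subseteq> X" using C unfolding subset_chain_def by blast
      then show "u + v \<in> \<Union>C"
      proof
        assume "X \<subseteq> Y"
        then have "u + v \<in> Y" using XY sub[OF XY(2)] subspace_add by blast
        then show ?thesis using XY by blast
      next
        assume "Y \<subseteq> X"
        then have "u + v \<in> X" using XY sub[OF XY(1)] subspace_add by blast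
        then show ?thesis using XY by blast
      qed
    next
      fix k u assume "u \<in> \<Union>C"
      then show "k *\<^sub>R u \<in> \<Union>C" using sub subspace_scale by blast
    qed
    moreover have "x \<in> E \<and> t \<le> p x" if "(x, t) \<in> \<Union>C" for x t
      using C that unfolding subset_chain_def \<R>_def by blast
    moreover have "R0 \<subseteq> \<Union>C"
      using C False unfolding subset_chain_def \<R>_def by blast
    ultimately have "\<Union>C \<in> \<R>" unfolding \<R>_def by blast
    then show ?thesis by blast
  qed
  from subset_Zorn[of \<R>, OF this]
  obtain M where M: "M \<in> \<R>" and max: "\<And>X. X \<in> \<R> \<Longrightarrow> M \<subseteq> X \<Longrightarrow> X = M"
    by auto
  have subM: "subspace M" and dom: "\<And>x t. (x, t) \<in> M \<Longrightarrow> x \<in> E \<and> t \<le> p x" and R0M: "R0 \<subseteq> M"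
    using M unfolding \<R>_def by blast+
  have total: "\<exists>t. (x, t) \<in> M" if x: "x \<in> E" for x
  proof -
    obtain R' where R': "subspace R'" "\<forall>x t. (x, t) \<in> R' \<longrightarrow> x \<in> E \<and> t \<le> p x" "M \<subseteq> R'" "x \<in> fst ` R'"
      using hahn_banach_step[OF E p subM dom x] by blast
    then have "R' = M" using max[of R'] R0M unfolding \<R>_def by blast
    then show ?thesis using R'(4) by auto
  qed
  have neg: "(- x, - t) \<in> M" if "(x, t) \<in> M" for x t
    using subspace_neg[OF subM that] by simp
  have unique: "s = t" if "(x, s) \<in> M" "(x, t) \<in> M" for x s t
  proof -
    have "(0, s - t) \<in> M" "(0, t - s) \<in> M"
      using subspace_diff[OF subM that] subspace_diff[OF subM that(2,1)] by auto
    then have "s - t \<le> p 0" "t - s \<le> p 0" using dom by blast+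
    then show ?thesis using seminorm_on_zero[OF E p] by simp
  qed
  \<comment> \<open>The value \<open>0\<close> outside \<open>E\<close> follows the convention built
    into \<open>lc_dual\<close>.\<close>
  define g where "g x = (if x \<in> E then THE t. (x, t) \<in> M else 0)" for x
  have gM: "(x, g x) \<in> M" if "x \<in> E" for x
  proof -
    have "\<exists>!t. (x, t) \<in> M" using total[OF that] unique by blast
    from theI'[OF this] show ?thesis using that by (simp add: g_def)
  qed
  have geq: "g x = t" if "(x, t) \<in> M" for x t
    using unique[OF gM that] dom[OF that] by blast
  show thesis
  proof
    show "linear_on E g"
      unfolding linear_on_def
    proof (intro conjI ballI allI)
      fix x y assume "x \<in> E" "y \<in> E"
      then show "g (x + y) = g x + g y"
        using subspace_add[OF subM gM gM, of x y] by (intro geq) simp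
    next
      fix x c assume "x \<in> E"
      then show "g (c *\<^sub>R x) = c *\<^sub>R g x"
        using subspace_scale[OF subM gM, of x c] by (intro geq) simp
    qed
    show "g x = f x" if "x \<in> F" for x
      using R0M that unfolding R0_def by (intro geq) auto
    show "\<bar>g x\<bar> \<le> p x" if x: "x \<in> E" for x
      using dom[OF gM[OF x]] dom[OF neg[OF gM[OF x]]] seminorm_on_minus[OF p x] by auto
    show "g x = 0" if "x \<notin> E" for x using that by (simp add: g_def)
  qed
qed

text \<open>Extends \<open>c *\<^sub>R x \<mapsto> c * p x\<close> from the line through
  \<open>x\<close>. Through it a seminorm can be recovered from the functionals it
  dominates.\<close>

lemma hahn_banach_attained:
  assumes E: "subspace E" and p: "seminorm_on E p" and x: "x \<in> E"
  obtains g where "linear_on E g" "g x = p x" "\<And>y. y \<in> E \<Longrightarrow> \<bar>g y\<bar> \<le> p y" "\<And>y. y \<notin> E \<Longrightarrow> g y = 0"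
proof (cases "x = 0")
  case True
  then show ?thesis
    using that[of "\<lambda>_. 0"] seminorm_on_zero[OF E p] seminorm_on_nonneg[OF E p]
    by (auto simp: linear_on_def)
next
  case False
  \<comment> \<open>The coefficient is unique only for nonzero \<open>x\<close>, hence the separate
    case \<open>x = 0\<close>.\<close>
  define f where "f y = (THE c. y = c *\<^sub>R x) * p x" for y
  have f: "f (c *\<^sub>R x) = c * p x" for c
  proof -
    have "(THE d. c *\<^sub>R x = d *\<^sub>R x) = c" using False by (intro the_equality) auto
    then show ?thesis by (simp add: f_def)
  qed
  have sp: "span {x} = range (\<lambda>c. c *\<^sub>R x)" using span_singleton by auto
  obtain g where g: "linear_on E g" "\<And>y. y \<in> span {x} \<Longrightarrow> g y = f y"
    "\<And>y. y \<in> E \<Longrightarrow> \<bar>g y\<bar> \<le> p y" "\<And>y. y \<notin> E \<Longrightarrow> g y = 0"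
  proof (rule hahn_banach[OF E subspace_span _ p])
    show "span {x} \<subseteq> E" using E x by (simp add: span_minimal)
    show "linear_on (span {x}) f"
      unfolding linear_on_def sp by (auto simp: f scaleR_add_left[symmetric] algebra_simps simp del: scaleR_add_left)
    show "\<bar>f y\<bar> \<le> p y" if "y \<in> span {x}" for y
      using that seminorm_on_scale[OF p x] seminorm_on_nonneg[OF E p x]
      unfolding sp by (auto simp: f abs_mult)
  qed blast
  have "g x = p x" using g(2)[of x] f[of 1] by (simp add: span_base)
  then show thesis using that g by blast
qed

section \<open>Subspaces\<close>

lemma lc_family_subset: "lc_family E P \<Longrightarrow> subspace F \<Longrightarrow> F \<subseteq> E \<Longrightarrow> lc_family F P"
  unfolding lc_family_def by (auto intro: seminorm_on_subset)

lemma lc_bounded_subspace_iff: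
  assumes E: "lc_family E P" and F: "subspace F" "F \<subseteq> E"
  shows "lc_bounded F P B \<longleftrightarrow> B \<subseteq> F \<and> lc_bounded E P B"
proof
  assume B: "lc_bounded F P B"
  have BF: "B \<subseteq> F" using lc_bounded_carrier[OF B] .
  moreover have "lc_bounded E P B"
    using lc_boundedD[OF lc_family_subset[OF assms] B cont_seminorm_member[OF lc_family_subset[OF assms]]] BF F(2)
    by (intro lc_boundedI[OF E]) blast+
  ultimately show "B \<subseteq> F \<and> lc_bounded E P B" by blast
next
  assume B: "B \<subseteq> F \<and> lc_bounded E P B"
  then show "lc_bounded F P B"
    using lc_boundedD[OF E _ cont_seminorm_member[OF E]]
    by (intro lc_boundedI[OF lc_family_subset[OF assms]]) blast+
qed

lemma lc_dual_restrict:
  assumes E: "lc_family E P" and F: "subspace F" "F \<subseteq> E" and g: "g \<in> lc_dual E P"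
  shows "(\<lambda>x. if x \<in> F then g x else 0) \<in> lc_dual F P"
proof -
  obtain q where q: "cont_seminorm E P q" "\<forall>x\<in>E. \<bar>g x\<bar> \<le> q x" and lin: "linear_on E g"
    using g unfolding lc_dual_iff[OF E] by blast
  have "linear_on F (\<lambda>x. if x \<in> F then g x else 0)"
    using F lin unfolding linear_on_def by (auto simp: subspace_add subspace_scale subset_iff)
  then show ?thesis
    unfolding lc_dual_iff[OF lc_family_subset[OF E F]]
    using cont_seminorm_restrict[OF q(1) F(2)] q(2) F(2) by auto
qed

text \<open>Hahn-Banach applies once the bound for \<open>f\<close> is a seminorm on all of
  \<open>E\<close>; this makes restriction of functionals surjective.\<close>

lemma lc_dual_extend:
  assumes E: "lc_family E P" and F: "subspace F" "F \<subseteq> E" and f: "f \<in> lc_dual F P"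
  obtains g where "g \<in> lc_dual E P" "f = (\<lambda>x. if x \<in> F then g x else 0)"
proof -
  obtain q where q: "cont_seminorm F P q" "\<forall>x\<in>F. \<bar>f x\<bar> \<le> q x" and lin: "linear_on F f"
    and out: "\<forall>x. x \<notin> F \<longrightarrow> f x = 0"
    using f unfolding lc_dual_iff[OF lc_family_subset[OF E F]] by blast
  obtain G C where G: "finite G" "G \<subseteq> P" "0 \<le> C" "\<forall>x\<in>F. q x \<le> C * (\<Sum>p\<in>G. p x)"
    using q(1) unfolding cont_seminorm_def by blast
  \<comment> \<open>\<open>q\<close> is known to be a seminorm on \<open>F\<close> only, so it is
    replaced by its majorant built from generators, which lives on \<open>E\<close>.\<close>
  let ?r = "\<lambda>x. C * (\<Sum>p\<in>G. p x)"
  have r: "cont_seminorm E P ?r"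
    using G E by (intro cont_seminorm_mult cont_seminorm_sum cont_seminorm_member) auto
  have fr: "\<bar>f x\<bar> \<le> ?r x" if "x \<in> F" for x
    using q(2) G(4) that by (meson order_trans)
  obtain g where g: "linear_on E g" "\<And>x. x \<in> F \<Longrightarrow> g x = f x" "\<And>x. x \<in> E \<Longrightarrow> \<bar>g x\<bar> \<le> ?r x"
    "\<And>x. x \<notin> E \<Longrightarrow> g x = 0"
    using hahn_banach[OF lc_family_subspace[OF E] F cont_seminorm_seminorm[OF r] lin fr] by blast
  have "g \<in> lc_dual E P" unfolding lc_dual_iff[OF E] using g r by blast
  moreover have "f = (\<lambda>x. if x \<in> F then g x else 0)" using g(2) out by auto
  ultimately show thesis using that by blast
qed

lemma fundamental_bounded_resolution_subspace:
  assumes E: "lc_family E P" and F: "subspace F" "F \<subseteq> E" and fbr: "fundamental_bounded_resolution E P"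
  shows "fundamental_bounded_resolution F P"
proof -
  obtain A where A: "resolution E A" "\<forall>\<alpha>. lc_bounded E P (A \<alpha>)"
    "\<forall>B. lc_bounded E P B \<longrightarrow> (\<exists>\<alpha>. B \<subseteq> A \<alpha>)"
    using fbr unfolding fundamental_bounded_resolution_def by blast
  show ?thesis
    unfolding fundamental_bounded_resolution_def
  proof (intro exI[of _ "\<lambda>\<alpha>. A \<alpha> \<inter> F"] conjI allI impI)
    show "resolution F (\<lambda>\<alpha>. A \<alpha> \<inter> F)"
    proof (rule resolutionI)
      show "\<exists>\<alpha>. x \<in> A \<alpha> \<inter> F" if "x \<in> F" for x
        using resolution_cover[OF A(1), of x] that F(2) by auto
      show "A \<alpha> \<inter> F \<subseteq> A \<beta> \<inter> F" if "\<alpha> \<le> \<beta>" for \<alpha> \<beta>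
        using resolution_mono[OF A(1) that] by auto
    qed auto
    show "lc_bounded F P (A \<alpha> \<inter> F)" for \<alpha>
      unfolding lc_bounded_subspace_iff[OF E F]
      using lc_bounded_subset[OF A(2)[rule_format], of "A \<alpha> \<inter> F" \<alpha>] by blast
    show "\<exists>\<alpha>. B \<subseteq> A \<alpha> \<inter> F" if "lc_bounded F P B" for B
      using that A(3) unfolding lc_bounded_subspace_iff[OF E F] by blast
  qed
qed

text \<open>The members are restricted to \<open>F\<close>; they cover the dual of \<open>F\<close>
  because every functional there extends.\<close>

lemma class_G_subspace:
  assumes E: "lc_family E P" and F: "subspace F" "F \<subseteq> E" and G: "class_G E P"
  shows "class_G F P"
proof -
  obtain A where A: "resolution (lc_dual E P) A"
    and eq: "\<And>\<alpha> (s :: nat \<Rightarrow> 'a \<Rightarrow> real). range s \<subseteq> A \<alpha> \<Longrightarrow> equicontinuous E P (range s)"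
    using G unfolding class_G_def by blast
  define restr where "restr g = (\<lambda>x. if x \<in> F then g x else (0::real))" for g :: "'a \<Rightarrow> real"
  have Adual: "A \<alpha> \<subseteq> lc_dual E P" for \<alpha> using resolution_subset[OF A] .
  show ?thesis
    unfolding class_G_def
  proof (intro exI[of _ "\<lambda>\<alpha>. restr ` A \<alpha>"] conjI allI impI)
    show "resolution (lc_dual F P) (\<lambda>\<alpha>. restr ` A \<alpha>)"
    proof (rule resolutionI)
      show "restr ` A \<alpha> \<subseteq> lc_dual F P" for \<alpha>
        using lc_dual_restrict[OF E F] Adual unfolding restr_def by blast
      show "\<exists>\<alpha>. f \<in> restr ` A \<alpha>" if f: "f \<in> lc_dual F P" for f
      proof -
        obtain g where g: "g \<in> lc_dual E P" "f = restr g"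
          using lc_dual_extend[OF E F f] unfolding restr_def by blast
        then show ?thesis using resolution_cover[OF A] by blast
      qed
      show "restr ` A \<alpha> \<subseteq> restr ` A \<beta>" if "\<alpha> \<le> \<beta>" for \<alpha> \<beta>
        using resolution_mono[OF A that] by blast
    qed
    fix \<alpha> and s :: "nat \<Rightarrow> 'a \<Rightarrow> real" assume s: "range s \<subseteq> restr ` A \<alpha>"
    \<comment> \<open>Each term is lifted within the same member \<open>A \<alpha>\<close>, so the
      lifted sequence is equicontinuous on \<open>E\<close> and the bound passes to
      \<open>F\<close>.\<close>
    then have "\<forall>n. \<exists>g. g \<in> A \<alpha> \<and> s n = restr g" by blast
    then obtain t where t: "\<And>n. t n \<in> A \<alpha>" "\<And>n. s n = restr (t n)" by metis
    have "\<exists>q. cont_seminorm E P q \<and> (\<forall>f\<in>range t. \<forall>x\<in>E. \<bar>f x\<bar> \<le> q x)"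
      using t(1) Adual lc_dual_linear by (intro equicontinuousD[OF E] eq[of t \<alpha>]) blast+
    then obtain q where q: "cont_seminorm E P q" "\<And>n x. x \<in> E \<Longrightarrow> \<bar>t n x\<bar> \<le> q x" by blast
    show "equicontinuous F P (range s)"
    proof (rule equicontinuousI[OF lc_family_subset[OF E F] _ cont_seminorm_restrict[OF q(1) F(2)]])
      show "linear_on F f" if f: "f \<in> range s" for f
      proof -
        obtain g where "g \<in> A \<alpha>" "f = restr g" using s f by blast
        then have "f \<in> lc_dual F P"
          using lc_dual_restrict[OF E F] Adual unfolding restr_def by blast
        then show ?thesis using lc_dual_linear by blast
      qed
      show "\<bar>f x\<bar> \<le> q x" if "f \<in> range s" "x \<in> F" for f x
        using that q(2) t(2) F(2) unfolding restr_def by auto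
    qed
  qed
qed

lemma quasi_DF_subspace:
  assumes "lc_family E P" "quasi_DF E P" "subspace F" "F \<subseteq> E"
  shows "quasi_DF F P"
  using assms class_G_subspace fundamental_bounded_resolution_subspace
  unfolding quasi_DF_def by blast

section \<open>Precompact sets\<close>

text \<open>A quantitative Ascoli theorem. Up to small \<open>q\<close>-errors \<open>K\<close> is a
  finite set \<open>T\<close>, and functionals dominated by \<open>q\<close> take values on
  \<open>T\<close> in bounded intervals, which are discretised. The net is chosen inside
  \<open>H\<close>.\<close>

lemma equicontinuous_totally_bounded_on_precompact:
  assumes E: "lc_family E P" and K: "precompact E P K" and q: "cont_seminorm E P q"
    and H: "\<And>f. f \<in> H \<Longrightarrow> linear_on E f" "\<And>f x. f \<in> H \<Longrightarrow> x \<in> E \<Longrightarrow> \<bar>f x\<bar> \<le> q x"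
    and e: "e > 0"
  shows "\<exists>N. finite N \<and> N \<subseteq> H \<and> (\<forall>f\<in>H. \<exists>g\<in>N. \<forall>x\<in>K. \<bar>f x - g x\<bar> < e)"
proof -
  note sub = lc_family_subspace[OF E] and qs = cont_seminorm_seminorm[OF q]
  \<comment> \<open>Three errors are added below: the difference at the centre \<open>k\<close>, and
    the values of \<open>f\<close> and of \<open>g\<close> at the remainder
    \<open>u\<close>.\<close>
  define d where "d = e / 3"
  have d: "d > 0" using e by (simp add: d_def)
  have "0 \<in> {y\<in>E. q y < d}" using subspace_0[OF sub] seminorm_on_zero[OF sub qs] d by simp
  then obtain T where T: "finite T" "T \<subseteq> E" "K \<subseteq> (\<Union>k\<in>T. (\<lambda>u. k + u) ` {y\<in>E. q y < d})"
    using K openin_seminorm_ball_0[OF E q, of d] unfolding precompact_def by blast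
  \<comment> \<open>Values on \<open>T\<close> rounded to multiples of \<open>d\<close>. Equal codes
    mean a difference below \<open>d\<close> on \<open>T\<close>, and the bound by \<open>q\<close>
    leaves finitely many codes.\<close>
  define code where "code f = restrict (\<lambda>k. \<lfloor>f k / d\<rfloor>) T" for f :: "'a \<Rightarrow> real"
  have range: "code ` H \<subseteq> (\<Pi>\<^sub>E k\<in>T. {\<lfloor>- q k / d\<rfloor>..\<lfloor>q k / d\<rfloor>})"
  proof
    fix c assume "c \<in> code ` H"
    then obtain f where f: "f \<in> H" "c = code f" by blast
    have "- q k \<le> f k \<and> f k \<le> q k" if "k \<in> T" for k
      using H(2)[OF f(1), of k] that T(2) by (auto simp: abs_le_iff)
    then show "c \<in> (\<Pi>\<^sub>E k\<in>T. {\<lfloor>- q k / d\<rfloor>..\<lfloor>q k / d\<rfloor>})"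
      unfolding f(2) code_def using d
      by (auto intro!: floor_mono divide_right_mono simp: minus_divide_left simp del: divide_minus_left)
  qed
  have "finite (code ` H)"
    by (rule finite_subset[OF range]) (auto intro: finite_PiE T(1))
  then obtain N where N: "N \<subseteq> H" "finite N" "code ` H = code ` N"
    using finite_subset_image[of "code ` H" code H] by auto
  have "\<exists>g\<in>N. \<forall>x\<in>K. \<bar>f x - g x\<bar> < e" if f: "f \<in> H" for f
  proof -
    obtain g where g: "g \<in> N" "code f = code g" using N(3) f by (metis image_iff)
    have gH: "g \<in> H" using g N by blast
    have "\<bar>f x - g x\<bar> < e" if x: "x \<in> K" for x
    proof -
      obtain k u where k: "k \<in> T" "u \<in> E" "q u < d" "x = k + u" using T(3) x by blast
      have "\<lfloor>f k / d\<rfloor> = \<lfloor>g k / d\<rfloor>"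
        using fun_cong[OF g(2), of k] k(1) unfolding code_def by simp
      then have "\<bar>f k / d - g k / d\<bar> < 1" by linarith
      then have "\<bar>(f k - g k) / d\<bar> < 1" by (simp add: diff_divide_distrib)
      then have fg: "\<bar>f k - g k\<bar> < d" using d by (simp add: abs_divide)
      have kE: "k \<in> E" using k T by blast
      have "f x - g x = (f k - g k) + f u - g u"
        using linear_on_add[OF H(1)[OF f] kE k(2)] linear_on_add[OF H(1)[OF gH] kE k(2)] k(4) by simp
      moreover have "\<bar>f u\<bar> < d" "\<bar>g u\<bar> < d" using H(2)[OF f k(2)] H(2)[OF gH k(2)] k(3) by auto
      ultimately show ?thesis using fg unfolding d_def by linarith
    qed
    then show ?thesis using g(1) by blast
  qed
  then show ?thesis using N by blast
qed

section \<open>Separability of the dual, uniformly on a precompact set\<close>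

text \<open>Recursive choice: at stage \<open>k\<close> only finitely many values are used up, and
  \<open>T k\<close> is infinite.\<close>

lemma injective_selection:
  fixes T :: "nat \<Rightarrow> 'b set"
  assumes "\<And>k. infinite (T k)"
  obtains s where "inj s" "\<And>k. s k \<in> T k"
proof -
  have "\<exists>s. \<forall>k. s k \<in> T k \<and> s k \<notin> s ` {..<k}"
  proof (rule dependent_wellorder_choice)
    fix r and f g :: "nat \<Rightarrow> 'b" and k :: nat assume "\<And>y. y < k \<Longrightarrow> f y = g y"
    then have "f ` {..<k} = g ` {..<k}" by (intro image_cong) auto
    then show "(r \<in> T k \<and> r \<notin> f ` {..<k}) = (r \<in> T k \<and> r \<notin> g ` {..<k})" by simp
  next
    fix k :: nat and f :: "nat \<Rightarrow> 'b"
    have "infinite (T k - f ` {..<k})" using assms by (intro Diff_infinite_finite) auto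
    then have "T k - f ` {..<k} \<noteq> {}" by (metis finite.emptyI)
    then show "\<exists>r. r \<in> T k \<and> r \<notin> f ` {..<k}" by blast
  qed
  then obtain s where s: "\<And>k. s k \<in> T k" "\<And>k. s k \<notin> s ` {..<k}" by blast
  have "s i \<noteq> s j" if "i < j" for i j
    using s(2)[of j] that imageI[of i "{..<j}" s] by (metis lessThan_iff)
  then have "inj s" by (intro injI) (metis linorder_neqE_nat)
  then show thesis using that s by blast
qed

text \<open>If \<open>\<beta>\<^sub>k\<close> agrees with a fixed \<open>\<alpha>\<close> below \<open>k\<close>, then the sequence \<open>\<beta>\<^sub>k\<close> is bounded above in the
  pointwise order; this is what makes resolutions indexed by sequences useful.\<close>

lemma uncountable_resolution_sequence:
  assumes A: "resolution \<Omega> A" and S: "S \<subseteq> \<Omega>" "uncountable S"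
  obtains \<gamma> and s :: "nat \<Rightarrow> 'b" where "inj s" "range s \<subseteq> A \<gamma> \<inter> S"
proof -
  \<comment> \<open>The union of all members whose index starts with the first \<open>k\<close>
    entries of \<open>\<alpha>\<close>.\<close>
  define C where "C \<alpha> k = (\<Union>\<beta>\<in>{\<beta>. \<forall>i<k. \<beta> i = \<alpha> i}. A \<beta>)" for \<alpha> :: "nat \<Rightarrow> nat" and k
  \<comment> \<open>\<open>C \<alpha> k\<close> is the countable union of its refinements by the
    entry at position \<open>k\<close>; if \<open>S\<close> met each of them in a countable set, it
    would meet \<open>C \<alpha> k\<close> in one.\<close>
  have step: "\<exists>\<beta>. uncountable (S \<inter> C \<beta> (Suc k)) \<and> (\<forall>i<k. \<beta> i = \<alpha> i)"
    if unc: "uncountable (S \<inter> C \<alpha> k)" for \<alpha> k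
  proof (rule ccontr)
    assume "\<nexists>\<beta>. uncountable (S \<inter> C \<beta> (Suc k)) \<and> (\<forall>i<k. \<beta> i = \<alpha> i)"
    then have "countable (S \<inter> C (\<alpha>(k := n)) (Suc k))" for n by auto
    then have "countable (\<Union>n. S \<inter> C (\<alpha>(k := n)) (Suc k))" by (intro countable_UN) auto
    moreover have "S \<inter> C \<alpha> k \<subseteq> (\<Union>n. S \<inter> C (\<alpha>(k := n)) (Suc k))"
    proof
      fix x assume x: "x \<in> S \<inter> C \<alpha> k"
      then obtain \<beta> where \<beta>: "\<forall>i<k. \<beta> i = \<alpha> i" "x \<in> A \<beta>" unfolding C_def by auto
      then have "x \<in> C (\<alpha>(k := \<beta> k)) (Suc k)" unfolding C_def by (auto simp: less_Suc_eq)
      then show "x \<in> (\<Union>n. S \<inter> C (\<alpha>(k := n)) (Suc k))" using x by auto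
    qed
    ultimately show False using unc countable_subset by blast
  qed
  have "C \<alpha> 0 = \<Omega>" for \<alpha> unfolding C_def using A unfolding resolution_def by simp
  then have base: "uncountable (S \<inter> C \<alpha> 0)" for \<alpha> using S by (simp add: Int_absorb2)
  obtain a where a: "\<And>k. uncountable (S \<inter> C (a k) k)" "\<And>k. \<forall>i<k. a (Suc k) i = a k i"
    using dependent_nat_choice[of "\<lambda>k \<alpha>. uncountable (S \<inter> C \<alpha> k)" "\<lambda>k \<alpha> \<beta>. \<forall>i<k. \<beta> i = \<alpha> i"] base step
    by metis
  \<comment> \<open>The limit branch: entry \<open>i\<close> is fixed from stage
    \<open>Suc i\<close> on.\<close>
  define \<alpha> where "\<alpha> i = a (Suc i) i" for i
  have agree: "a k i = \<alpha> i" if "i < k" for i k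
    using that
  proof (induction k)
    case (Suc k)
    then show ?case using a(2)[of k] by (cases "i = k") (auto simp: \<alpha>_def)
  qed simp
  have "C (a k) k = C \<alpha> k" for k unfolding C_def by (rule SUP_cong) (auto simp: agree)
  then have "infinite (S \<inter> C \<alpha> k)" for k using a(1)[of k] countable_finite by auto
  then obtain s where s: "inj s" "\<And>k. s k \<in> S \<inter> C \<alpha> k"
    using injective_selection[of "\<lambda>k. S \<inter> C \<alpha> k"] by blast
  have "\<forall>k. \<exists>\<beta>. (\<forall>i<k. \<beta> i = \<alpha> i) \<and> s k \<in> A \<beta>" using s(2) unfolding C_def by auto
  then obtain b where b: "\<And>k i. i < k \<Longrightarrow> b k i = \<alpha> i" "\<And>k. s k \<in> A (b k)" by metis
  \<comment> \<open>At position \<open>i\<close> only the indices \<open>b k\<close> with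
    \<open>k \<le> i\<close> can differ from \<open>\<alpha>\<close>, so this maximum of finitely
    many numbers bounds all of them.\<close>
  define \<gamma> where "\<gamma> i = Max (insert (\<alpha> i) ((\<lambda>k. b k i) ` {..i}))" for i
  have "b k \<le> \<gamma>" for k
  proof (rule le_funI)
    fix i
    have "b k i \<in> insert (\<alpha> i) ((\<lambda>k. b k i) ` {..i})" using b(1)[of i k] by (cases "i < k") auto
    then show "b k i \<le> \<gamma> i" unfolding \<gamma>_def by (intro Max_ge) auto
  qed
  then have "s k \<in> A \<gamma> \<inter> S" for k using resolution_mono[OF A, of "b k" \<gamma>] b(2)[of k] s(2)[of k] by auto
  then have "range s \<subseteq> A \<gamma> \<inter> S" by auto
  then show thesis using that s(1) by blast
qed

text \<open>For each tolerance a maximal separated set of functionals is automatically a net;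
  countability of these sets is the point where class G enters. The nets for the tolerances
  \<open>inverse (Suc n)\<close> are then united.\<close>

lemma class_G_dual_separable_on_precompact:
  assumes E: "lc_family E P" and G: "class_G E P" and K: "precompact E P K"
  obtains D where "countable D" "D \<subseteq> lc_dual E P"
    "\<And>f e. f \<in> lc_dual E P \<Longrightarrow> e > 0 \<Longrightarrow> \<exists>g\<in>D. \<forall>x\<in>K. \<bar>f x - g x\<bar> < e"
proof -
  obtain A where A: "resolution (lc_dual E P) A"
    and eq: "\<And>\<alpha> (s :: nat \<Rightarrow> 'a \<Rightarrow> real). range s \<subseteq> A \<alpha> \<Longrightarrow> equicontinuous E P (range s)"
    using G unfolding class_G_def by blast
  have net: "\<exists>D. countable D \<and> D \<subseteq> lc_dual E P \<and> (\<forall>f\<in>lc_dual E P. \<exists>g\<in>D. \<forall>x\<in>K. \<bar>f x - g x\<bar> < e)"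
    if e: "e > 0" for e :: real
  proof -
    define near where "near f g \<longleftrightarrow> (\<forall>x\<in>K. \<bar>f x - g x\<bar> < e)" for f g :: "'a \<Rightarrow> real"
    define \<S> where "\<S> = {D. D \<subseteq> lc_dual E P \<and> (\<forall>f\<in>D. \<forall>g\<in>D. f \<noteq> g \<longrightarrow> \<not> near f g)}"
    have "\<Union>C \<in> \<S>" if C: "subset.chain \<S> C" for C
    proof -
      have "\<not> near f g" if fg: "f \<in> \<Union>C" "g \<in> \<Union>C" "f \<noteq> g" for f g
      proof -
        obtain X Y where XY: "X \<in> C" "Y \<in> C" "f \<in> X" "g \<in> Y" using fg by blast
        then have "X \<subseteq> Y \<or> Y \<subseteq> X" "X \<in> \<S>" "Y \<in> \<S>" using C unfolding subset_chain_def by blast+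
        then show ?thesis using XY fg(3) unfolding \<S>_def by blast
      qed
      moreover have "\<Union>C \<subseteq> lc_dual E P" using C unfolding subset_chain_def \<S>_def by blast
      ultimately show ?thesis unfolding \<S>_def by blast
    qed
    from subset_Zorn'[of \<S>, OF this] obtain D where D: "D \<in> \<S>" and max: "\<And>X. X \<in> \<S> \<Longrightarrow> D \<subseteq> X \<Longrightarrow> X = D"
      by auto
    have Ddual: "D \<subseteq> lc_dual E P" and sep: "\<And>f g. f \<in> D \<Longrightarrow> g \<in> D \<Longrightarrow> f \<noteq> g \<Longrightarrow> \<not> near f g"
      using D unfolding \<S>_def by blast+
    have "countable D"
    proof (rule ccontr)
      assume "uncountable D"
      then obtain \<gamma> and s :: "nat \<Rightarrow> 'a \<Rightarrow> real" where s: "inj s" "range s \<subseteq> A \<gamma> \<inter> D"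
        by (rule uncountable_resolution_sequence[OF A Ddual])
      have lin: "linear_on E f" if "f \<in> range s" for f
        using that s(2) Ddual lc_dual_linear by blast
      have "equicontinuous E P (range s)" using eq[of s \<gamma>] s(2) by blast
      from equicontinuousD[OF E this lin]
      obtain q where q: "cont_seminorm E P q" "\<forall>f\<in>range s. \<forall>x\<in>E. \<bar>f x\<bar> \<le> q x" by blast
      have "\<exists>N. finite N \<and> N \<subseteq> range s \<and> (\<forall>f\<in>range s. \<exists>g\<in>N. \<forall>x\<in>K. \<bar>f x - g x\<bar> < e)"
        by (rule equicontinuous_totally_bounded_on_precompact[OF E K q(1) lin])
          (use q(2) e in auto)
      then obtain N where N: "finite N" "N \<subseteq> range s" "\<And>f. f \<in> range s \<Longrightarrow> \<exists>g\<in>N. near f g"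
        unfolding near_def by blast
      \<comment> \<open>The finite net \<open>N\<close> consists of terms of the sequence itself, so
        a term outside \<open>N\<close> would be near a different element of the separated set
        \<open>D\<close>.\<close>
      have "infinite (range s)" using range_inj_infinite[OF s(1)] .
      then have "\<not> range s \<subseteq> N" using N(1) finite_subset[of "range s" N] by auto
      then obtain f where f: "f \<in> range s" "f \<notin> N" by auto
      then obtain g where g: "g \<in> N" "near f g" using N(3) by blast
      then have "f \<noteq> g" "f \<in> D" "g \<in> D" using f N(2) s(2) by blast+
      then show False using sep g(2) by blast
    qed
    moreover have "\<exists>g\<in>D. near f g" if f: "f \<in> lc_dual E P" for f
    proof (rule ccontr)
      assume no: "\<not> (\<exists>g\<in>D. near f g)"
      have sym: "near g h = near h g" for g h unfolding near_def by (simp add: abs_minus_commute)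
      have "insert f D \<in> \<S>"
        unfolding \<S>_def using f Ddual sep no sym by auto
      then have "f \<in> D" using max[of "insert f D"] by blast
      then show False using no e unfolding near_def by auto
    qed
    ultimately show ?thesis using Ddual unfolding near_def by blast
  qed
  have "\<forall>n::nat. \<exists>D. countable D \<and> D \<subseteq> lc_dual E P \<and>
      (\<forall>f\<in>lc_dual E P. \<exists>g\<in>D. \<forall>x\<in>K. \<bar>f x - g x\<bar> < inverse (Suc n))"
    using net by simp
  then obtain D where D: "\<And>n::nat. countable (D n)" "\<And>n. D n \<subseteq> lc_dual E P"
    "\<And>n f. f \<in> lc_dual E P \<Longrightarrow> \<exists>g\<in>D n. \<forall>x\<in>K. \<bar>f x - g x\<bar> < inverse (Suc n)"
    by metis
  show thesis
  proof
    show "countable (\<Union>n. D n)" using D(1) by auto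
    show "(\<Union>n. D n) \<subseteq> lc_dual E P" using D(2) by auto
    fix f and e :: real assume f: "f \<in> lc_dual E P" and e: "e > 0"
    obtain n where n: "inverse (Suc n) < e" using reals_Archimedean[OF e] by auto
    obtain g where "g \<in> D n" "\<forall>x\<in>K. \<bar>f x - g x\<bar> < inverse (Suc n)" using D(3)[OF f] by blast
    then show "\<exists>g\<in>\<Union>n. D n. \<forall>x\<in>K. \<bar>f x - g x\<bar> < e" using n by force
  qed
qed

text \<open>Evaluation at the dense sequence \<open>d\<close> is a homeomorphism of \<open>K\<close>
  onto a subspace of \<open>nat \<Rightarrow> real\<close>.\<close>

lemma class_G_precompact_metrizable:
  assumes lcs: "lcs E P" and G: "class_G E P" and K: "precompact E P K"
  shows "metrizable_space (subtopology (lc_topology E P) K)"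
proof -
  have E: "lc_family E P" using lcs lcs_imp_lc_family by blast
  note sub = lc_family_subspace[OF E]
  have KE: "K \<subseteq> E" using K unfolding precompact_def by blast
  obtain D where D: "countable D" "D \<subseteq> lc_dual E P"
    "\<And>f e. f \<in> lc_dual E P \<Longrightarrow> e > 0 \<Longrightarrow> \<exists>g\<in>D. \<forall>x\<in>K. \<bar>f x - g x\<bar> < e"
    using class_G_dual_separable_on_precompact[OF E G K] by blast
  have "(\<lambda>x. 0) \<in> lc_dual E P"
    unfolding lc_dual_iff[OF E] using cont_seminorm_const_zero[of E P]
    by (auto simp: linear_on_def)
  then have "D \<noteq> {}" using D(3)[of "\<lambda>x. 0" 1] by auto
  then obtain d :: "nat \<Rightarrow> 'a \<Rightarrow> real" where d: "range d = D" using D(1) uncountable_def by blast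
  have ddual: "d n \<in> lc_dual E P" for n using d D(2) by blast
  have dense: "\<exists>n. \<forall>x\<in>K. \<bar>f x - d n x\<bar> < e" if "f \<in> lc_dual E P" "e > 0" for f e
    using D(3)[OF that] d by blast
  \<comment> \<open>Finitely many \<open>d n\<close> control \<open>q\<close> on differences in
    \<open>K\<close>. Write \<open>q (y - x) = f y - f x\<close> with \<open>f\<close> dominated by
    \<open>q\<close>; passing from \<open>f\<close> to \<open>g\<close> and from \<open>g\<close> to
    \<open>d (n g)\<close> costs \<open>1/8\<close> at each of the two points, and closeness adds
    \<open>1/4\<close>, in total \<open>3/4\<close>.\<close>
  have key: "\<exists>N. finite N \<and> (\<forall>x\<in>K. \<forall>y\<in>K. (\<forall>n\<in>N. \<bar>d n y - d n x\<bar> < 1/4) \<longrightarrow> q (y - x) < 1)"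
    if q: "cont_seminorm E P q" for q
  proof -
    define H where "H = {f. linear_on E f \<and> (\<forall>x\<in>E. \<bar>f x\<bar> \<le> q x) \<and> (\<forall>x. x \<notin> E \<longrightarrow> f x = 0)}"
    have "\<exists>M. finite M \<and> M \<subseteq> H \<and> (\<forall>f\<in>H. \<exists>g\<in>M. \<forall>x\<in>K. \<bar>f x - g x\<bar> < 1/8)"
      by (rule equicontinuous_totally_bounded_on_precompact[OF E K q]) (auto simp: H_def)
    then obtain M where M: "finite M" "M \<subseteq> H" "\<And>f. f \<in> H \<Longrightarrow> \<exists>g\<in>M. \<forall>x\<in>K. \<bar>f x - g x\<bar> < 1/8"
      by blast
    have "H \<subseteq> lc_dual E P"
      unfolding lc_dual_iff[OF E] H_def subset_iff mem_Collect_eq using q by blast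
    then have "\<forall>g\<in>M. \<exists>n. \<forall>x\<in>K. \<bar>g x - d n x\<bar> < 1/8" using M(2) dense[of _ "1/8"] by auto
    then obtain n where n: "\<And>g x. g \<in> M \<Longrightarrow> x \<in> K \<Longrightarrow> \<bar>g x - d (n g) x\<bar> < 1/8" by metis
    have "q (y - x) < 1" if x: "x \<in> K" and y: "y \<in> K" and close: "\<forall>m\<in>n ` M. \<bar>d m y - d m x\<bar> < 1/4" for x y
    proof -
      have xy: "y - x \<in> E" "x \<in> E" "y \<in> E" using x y KE subspace_diff[OF sub] by auto
      obtain f where f: "linear_on E f" "f (y - x) = q (y - x)" "\<And>z. z \<in> E \<Longrightarrow> \<bar>f z\<bar> \<le> q z"
        "\<And>z. z \<notin> E \<Longrightarrow> f z = 0"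
        using hahn_banach_attained[OF sub cont_seminorm_seminorm[OF q] xy(1)] by blast
      have "f \<in> H" using f unfolding H_def by auto
      then obtain g where g: "g \<in> M" "\<forall>x\<in>K. \<bar>f x - g x\<bar> < 1/8" using M(3) by blast
      have "\<bar>f x - g x\<bar> < 1/8" "\<bar>f y - g y\<bar> < 1/8" "\<bar>g x - d (n g) x\<bar> < 1/8" "\<bar>g y - d (n g) y\<bar> < 1/8"
        "\<bar>d (n g) y - d (n g) x\<bar> < 1/4"
        using g x y n close by auto
      moreover have "q (y - x) = f y - f x" using f(2) linear_on_diff[OF f(1) sub xy(3,2)] by simp
      ultimately show ?thesis by linarith
    qed
    then show ?thesis using M(1) by (intro exI[of _ "n ` M"]) auto
  qed
  define \<Phi> where "\<Phi> x = (\<lambda>n. d n x)" for x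
  let ?X = "subtopology (lc_topology E P) K"
  have topX: "topspace ?X = K" using KE by auto
  have inj: "inj_on \<Phi> K"
  proof (rule inj_onI, rule ccontr)
    fix x y assume xy: "x \<in> K" "y \<in> K" "\<Phi> x = \<Phi> y" "x \<noteq> y"
    have yx: "y - x \<in> E" "y - x \<noteq> 0" using xy KE subspace_diff[OF sub] by auto
    then obtain p where p: "p \<in> P" "p (y - x) \<noteq> 0" using lcs unfolding lcs_def by blast
    have pos: "p (y - x) > 0" using p seminorm_on_nonneg[OF sub lc_family_seminorm[OF E p(1)] yx(1)] by simp
    \<comment> \<open>Rescaled to take the value \<open>1\<close> at \<open>y - x\<close>, in
      conflict with the strict bound from \<open>key\<close> when all \<open>d n\<close> agree at
      \<open>x\<close> and \<open>y\<close>.\<close>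
    have "cont_seminorm E P (\<lambda>z. (1 / p (y - x)) * p z)"
      using pos by (intro cont_seminorm_mult cont_seminorm_member[OF E p(1)]) simp
    from key[OF this] obtain N where
      "\<forall>x'\<in>K. \<forall>y'\<in>K. (\<forall>n\<in>N. \<bar>d n y' - d n x'\<bar> < 1/4) \<longrightarrow> (1 / p (y - x)) * p (y' - x') < 1" by blast
    moreover have "\<forall>n\<in>N. \<bar>d n y - d n x\<bar> < 1/4" using fun_cong[OF xy(3)] by (simp add: \<Phi>_def)
    ultimately have "(1 / p (y - x)) * p (y - x) < 1" using xy(1,2) by blast
    then show False using pos by simp
  qed
  have cont: "continuous_map ?X euclidean \<Phi>"
  proof -
    have "continuous_map ?X euclideanreal (d n)" for n
      using ddual[of n] unfolding lc_dual_def by (auto intro: continuous_map_from_subtopology)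
    then have "continuous_map ?X (product_topology (\<lambda>_. euclideanreal) UNIV) \<Phi>"
      unfolding continuous_map_componentwise_UNIV \<Phi>_def by simp
    then show ?thesis by (simp add: euclidean_product_topology)
  qed
  have "homeomorphic_map ?X (subtopology euclidean (\<Phi> ` K)) \<Phi>"
  proof (rule bijective_open_imp_homeomorphic_map)
    show "continuous_map ?X (subtopology euclidean (\<Phi> ` K)) \<Phi>"
      using cont topX by (auto simp: continuous_map_in_subtopology)
    show "\<Phi> ` topspace ?X = topspace (subtopology euclidean (\<Phi> ` K))" using topX by simp
    show "inj_on \<Phi> (topspace ?X)" using inj topX by simp
    show "open_map ?X (subtopology euclidean (\<Phi> ` K)) \<Phi>"
      unfolding open_map_def
    proof (intro allI impI)
      fix U assume U: "openin ?X U"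
      then obtain V where V: "openin (lc_topology E P) V" "U = V \<inter> K" by (auto simp: openin_subtopology)
      show "openin (subtopology euclidean (\<Phi> ` K)) (\<Phi> ` U)"
      proof (subst openin_subopen, intro ballI)
        fix z assume "z \<in> \<Phi> ` U"
        then obtain x where x: "x \<in> U" "z = \<Phi> x" by blast
        then have xV: "x \<in> V" "x \<in> K" using V by auto
        obtain q where q: "cont_seminorm E P q" "{y\<in>E. q (y - x) < 1} \<subseteq> V"
          using bspec[OF conjunct2[OF V(1)[unfolded openin_lc_topology_cont_seminorm[OF E]]] xV(1)] by blast
        obtain N where N: "finite N"
          "\<forall>x\<in>K. \<forall>y\<in>K. (\<forall>n\<in>N. \<bar>d n y - d n x\<bar> < 1/4) \<longrightarrow> q (y - x) < 1"
          using key[OF q(1)] by blast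
        \<comment> \<open>A basic open set of the product topology; its radius \<open>1/4\<close> is
          the closeness demanded in \<open>key\<close>.\<close>
        define W where "W = (\<Inter>n\<in>N. {w :: nat \<Rightarrow> real. w n \<in> ball (z n) (1/4)})"
        have "open {w :: nat \<Rightarrow> real. w n \<in> ball (z n) (1/4)}" for n
          using open_vimage[OF open_ball[of "z n" "1/4"] continuous_on_product_coordinates[of n]]
          unfolding vimage_def .
        then have "open W" unfolding W_def using N(1) by (intro open_INT) auto
        then have "openin (subtopology euclidean (\<Phi> ` K)) (\<Phi> ` K \<inter> W)"
          by (simp add: openin_open_Int)
        moreover have "z \<in> \<Phi> ` K \<inter> W" using x xV unfolding W_def by auto
        moreover have "\<Phi> ` K \<inter> W \<subseteq> \<Phi> ` U"
        proof
          fix w assume w: "w \<in> \<Phi> ` K \<inter> W"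
          then obtain y where y: "y \<in> K" "w = \<Phi> y" by blast
          have "\<bar>d n y - d n x\<bar> < 1/4" if "n \<in> N" for n
            using w that unfolding W_def y(2) x(2) \<Phi>_def by (auto simp: dist_real_def abs_minus_commute)
          then have "q (y - x) < 1" using N(2) y(1) xV(2) by blast
          then have "y \<in> U" using q(2) y(1) KE V(2) by auto
          then show "w \<in> \<Phi> ` U" using y by blast
        qed
        ultimately show "\<exists>T. openin (subtopology euclidean (\<Phi> ` K)) T \<and> z \<in> T \<and> T \<subseteq> \<Phi> ` U"
          by blast
      qed
    qed
  qed
  then have "?X homeomorphic_space (subtopology euclidean (\<Phi> ` K))"
    using homeomorphic_space by blast
  then show ?thesis
    using homeomorphic_metrizable_space metrizable_space_subtopology metrizable_space_euclidean by blast
qed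

section \<open>Metrizable spaces\<close>

lemma cont_seminorm_trans:
  assumes E: "lc_family E P" and Q: "\<And>p. p \<in> Q \<Longrightarrow> cont_seminorm E P p" and r: "cont_seminorm E Q r"
  shows "cont_seminorm E P r"
proof -
  obtain F C where F: "finite F" "F \<subseteq> Q" "0 \<le> C" "\<And>x. x \<in> E \<Longrightarrow> r x \<le> C * (\<Sum>p\<in>F. p x)"
    using r unfolding cont_seminorm_def by blast
  have "cont_seminorm E P (\<lambda>x. C * (\<Sum>p\<in>F. p x))"
    using F Q by (intro cont_seminorm_mult cont_seminorm_sum E) auto
  then show ?thesis using cont_seminorm_mono[OF cont_seminorm_seminorm[OF r]] F(4) by blast
qed

lemma lc_topology_cong:
  assumes E: "lc_family E P" "lc_family E Q" and "\<And>p. p \<in> P \<Longrightarrow> cont_seminorm E Q p"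
    and "\<And>p. p \<in> Q \<Longrightarrow> cont_seminorm E P p"
  shows "lc_topology E P = lc_topology E Q"
proof -
  have "cont_seminorm E P r \<longleftrightarrow> cont_seminorm E Q r" for r
    using assms cont_seminorm_trans by blast
  then show ?thesis
    unfolding topology_eq openin_lc_topology_cont_seminorm[OF E(1)] openin_lc_topology_cont_seminorm[OF E(2)]
    by simp
qed

text \<open>The metric supplies a countable base of balls at \<open>0\<close>, each containing the
  unit ball of a continuous seminorm. Partial sums make the sequence increasing, and inclusion of
  unit balls gives domination without a constant.\<close>

lemma metrizable_cofinal_seminorms:
  assumes E: "lc_family E P" and met: "lc_metrizable E P"
  shows "\<exists>q :: nat \<Rightarrow> 'a::real_vector \<Rightarrow> real. (\<forall>k. cont_seminorm E P (q k)) \<and>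
    (\<forall>k m x. k \<le> m \<longrightarrow> x \<in> E \<longrightarrow> q k x \<le> q m x) \<and>
    (\<forall>p. cont_seminorm E P p \<longrightarrow> (\<exists>k. \<forall>x\<in>E. p x \<le> q k x))"
proof -
  note sub = lc_family_subspace[OF E]
  obtain M d where Md: "Metric_space M d" "lc_topology E P = Metric_space.mtopology M d"
    using met unfolding lc_metrizable_def metrizable_space_def by blast
  interpret Metric_space M d by fact
  have M: "M = E" using topspace_mtopology Md(2) topspace_lc_topology by metis
  have zero: "0 \<in> M" using subspace_0[OF sub] M by simp
  define V where "V n = mball 0 (inverse (Suc n))" for n :: nat
  have V: "openin (lc_topology E P) (V n)" "0 \<in> V n" for n
    unfolding V_def Md(2) using zero by auto
  have "\<forall>n. \<exists>r. cont_seminorm E P r \<and> {y\<in>E. r y < 1} \<subseteq> V n"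
    using nhd_0_seminorm_ball[OF E V] by metis
  from choice[OF this] obtain r where r: "\<And>n. cont_seminorm E P (r n)" "\<And>n. {y\<in>E. r n y < 1} \<subseteq> V n"
    by auto
  define q where "q k x = (\<Sum>n\<le>k. r n x)" for k x
  have nonneg: "0 \<le> r n x" if "x \<in> E" for n x
    using seminorm_on_nonneg[OF sub cont_seminorm_seminorm[OF r(1)] that] .
  show ?thesis
  proof (intro exI[of _ q] conjI allI impI)
    show "cont_seminorm E P (q k)" for k
      using cont_seminorm_sum[OF E, of "{..k}" r] r(1) unfolding q_def by simp
    show "q k x \<le> q m x" if "k \<le> m" "x \<in> E" for k m x
      unfolding q_def using that nonneg by (intro sum_mono2) auto
    fix p assume p: "cont_seminorm E P p"
    have "openin mtopology {x\<in>E. p x < 1}"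
      using openin_seminorm_ball_0[OF E p] Md(2) by simp
    moreover have "0 \<in> {x\<in>E. p x < 1}"
      using subspace_0[OF sub] seminorm_on_zero[OF sub cont_seminorm_seminorm[OF p]] by simp
    ultimately obtain e where e: "e > 0" "mball 0 e \<subseteq> {x\<in>E. p x < 1}"
      unfolding openin_mtopology by blast
    obtain n where n: "inverse (Suc n) < e" using reals_Archimedean[OF e(1)] by auto
    have "p x \<le> r n x" if x: "x \<in> E" for x
    proof (rule seminorm_le_if_unit_ball_le[OF sub cont_seminorm_seminorm[OF p] cont_seminorm_seminorm[OF r(1)] _ x])
      fix y assume "y \<in> E" "r n y < 1"
      then have "y \<in> V n" using r(2) by blast
      then have "y \<in> mball 0 e" unfolding V_def using n by auto
      then show "p y \<le> 1" using e(2) by auto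
    qed
    moreover have "r n x \<le> q n x" if "x \<in> E" for x
      unfolding q_def using nonneg that by (intro member_le_sum) auto
    ultimately show "\<exists>k. \<forall>x\<in>E. p x \<le> q k x" by (intro exI[of _ n]) force
  qed
qed

text \<open>For \<open>m \<ge> k\<close> monotonicity gives
  \<open>q k (y m) \<le> q m (y m) \<le> 1\<close>; the finitely many earlier points are absorbed
  into the constant.\<close>

lemma lc_bounded_cofinal_sequence:
  fixes q :: "nat \<Rightarrow> 'a::real_vector \<Rightarrow> real"
  assumes E: "lc_family E P"
    and mono: "\<And>k m x. k \<le> m \<Longrightarrow> x \<in> E \<Longrightarrow> q k x \<le> q m x"
    and cofinal: "\<And>p. cont_seminorm E P p \<Longrightarrow> \<exists>k. \<forall>x\<in>E. p x \<le> q k x"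
    and y: "\<And>k. y k \<in> E" "\<And>k. q k (y k) \<le> 1"
  shows "lc_bounded E P (range y)"
proof (rule lc_boundedI[OF E])
  show "range y \<subseteq> E" using y(1) by auto
  fix p assume "p \<in> P"
  then obtain k where k: "\<forall>x\<in>E. p x \<le> q k x" using cofinal[OF cont_seminorm_member[OF E]] by blast
  define C where "C = 1 + (\<Sum>m<k. \<bar>q k (y m)\<bar>)"
  have "p (y m) \<le> C" for m
  proof (cases "m < k")
    case True
    have "p (y m) \<le> \<bar>q k (y m)\<bar>" using bspec[OF k y(1)[of m]] by linarith
    also have "\<dots> \<le> (\<Sum>m<k. \<bar>q k (y m)\<bar>)" using True by (intro member_le_sum) auto
    finally show ?thesis by (simp add: C_def)
  next
    case False
    then have "p (y m) \<le> 1" using bspec[OF k y(1)[of m]] mono[of k m "y m"] y(1)[of m] y(2)[of m] by simp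
    moreover have "0 \<le> (\<Sum>m<k. \<bar>q k (y m)\<bar>)" by (intro sum_nonneg) auto
    ultimately show ?thesis unfolding C_def by linarith
  qed
  then show "\<exists>C. \<forall>x\<in>range y. p x \<le> C" by auto
qed

section \<open>Fundamental sequences of bounded sets and normability\<close>

lemma metrizable_fundamental_sequence_normable:
  fixes B :: "nat \<Rightarrow> 'a::real_vector set"
  assumes lcs: "lcs E P" and met: "lc_metrizable E P"
    and B: "\<And>n. lc_bounded E P (B n)" "\<And>C. lc_bounded E P C \<Longrightarrow> \<exists>n. C \<subseteq> B n"
  shows "normable E P"
proof -
  have E: "lc_family E P" using lcs lcs_imp_lc_family by blast
  note sub = lc_family_subspace[OF E]
  obtain q :: "nat \<Rightarrow> 'a \<Rightarrow> real" where q': "\<forall>k. cont_seminorm E P (q k)"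
    "\<forall>k m x. k \<le> m \<longrightarrow> x \<in> E \<longrightarrow> q k x \<le> q m x"
    "\<forall>p. cont_seminorm E P p \<longrightarrow> (\<exists>k. \<forall>x\<in>E. p x \<le> q k x)"
    using metrizable_cofinal_seminorms[OF E met] by (elim exE conjE)
  note q = q'[rule_format]
  \<comment> \<open>Otherwise a point of the \<open>k\<close>-th ball outside \<open>B k\<close>,
    taken for every \<open>k\<close>, gives a bounded sequence contained in no \<open>B n\<close>.
    Hence some ball is bounded and its \<open>q k\<close> dominates every generator up to a
    constant.\<close>
  have "\<exists>k. \<forall>x\<in>E. q k x \<le> 1 \<longrightarrow> x \<in> B k"
  proof (rule ccontr)
    assume "\<not> ?thesis"
    then have "\<forall>k. \<exists>x. x \<in> E \<and> q k x \<le> 1 \<and> x \<notin> B k" by blast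
    from choice[OF this] obtain x where x: "\<And>k. x k \<in> E" "\<And>k. q k (x k) \<le> 1" "\<And>k. x k \<notin> B k" by auto
    have "lc_bounded E P (range x)" by (rule lc_bounded_cofinal_sequence[OF E q(2,3) x(1,2)])
    then obtain n where "range x \<subseteq> B n" using B(2) by blast
    then show False using x(3)[of n] by auto
  qed
  then obtain k where k: "\<And>x. x \<in> E \<Longrightarrow> q k x \<le> 1 \<Longrightarrow> x \<in> B k" by blast
  have dom: "\<exists>C\<ge>0. \<forall>x\<in>E. p x \<le> C * q k x" if p: "p \<in> P" for p
  proof -
    obtain C where C: "C \<ge> 0" "\<forall>x\<in>B k. p x \<le> C" using lc_boundedD[OF E B(1) cont_seminorm_member[OF E p]] by blast
    \<comment> \<open>The divisor \<open>C + 1\<close> avoids division by zero when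
      \<open>C = 0\<close>.\<close>
    have "(1 / (C + 1)) * p x \<le> q k x" if x: "x \<in> E" for x
    proof (rule seminorm_le_if_unit_ball_le[OF sub _ cont_seminorm_seminorm[OF q(1)] _ x])
      show "seminorm_on E (\<lambda>x. (1 / (C + 1)) * p x)"
        using C(1) by (intro seminorm_on_mult lc_family_seminorm[OF E p]) auto
      fix y assume "y \<in> E" "q k y < 1"
      then have "p y \<le> C" using k C(2) by auto
      then show "(1 / (C + 1)) * p y \<le> 1" using C(1) by (simp add: divide_simps)
    qed
    then have "p x \<le> (C + 1) * q k x" if "x \<in> E" for x using that C(1) by (simp add: divide_simps mult.commute)
    then show ?thesis using C(1) by (intro exI[of _ "C + 1"]) auto
  qed
  have Q: "lc_family E {q k}" using sub cont_seminorm_seminorm[OF q(1)] by (simp add: lc_family_def)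
  have "lc_topology E {q k} = lc_topology E P"
  proof (rule lc_topology_cong[OF Q E])
    fix p assume p: "p \<in> P"
    obtain C where C: "C \<ge> 0" "\<forall>x\<in>E. p x \<le> C * q k x" using dom[OF p] by blast
    have "cont_seminorm E {q k} (\<lambda>x. C * q k x)"
      using C(1) by (intro cont_seminorm_mult cont_seminorm_member[OF Q]) auto
    then show "cont_seminorm E {q k} p"
      using cont_seminorm_mono[OF lc_family_seminorm[OF E p]] C(2) by blast
  qed (use q(1) in auto)
  moreover have "x = 0" if x: "x \<in> E" "q k x = 0" for x
  proof (rule ccontr)
    assume "x \<noteq> 0"
    then obtain p where p: "p \<in> P" "p x \<noteq> 0" using lcs x(1) unfolding lcs_def by blast
    obtain C where "\<forall>x\<in>E. p x \<le> C * q k x" using dom[OF p(1)] by blast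
    then have "p x \<le> 0" using x by force
    then show False using p(2) seminorm_on_nonneg[OF sub lc_family_seminorm[OF E p(1)] x(1)] by simp
  qed
  ultimately show ?thesis
    unfolding normable_def using cont_seminorm_seminorm[OF q(1)[of k]] by (intro exI[of _ "q k"]) auto
qed

section \<open>Regular (LM)-spaces\<close>

lemma lc_bounded_finite_UN:
  assumes E: "lc_family E P" and I: "finite I" "\<And>i. i \<in> I \<Longrightarrow> lc_bounded E P (B i)"
  shows "lc_bounded E P (\<Union>i\<in>I. B i)"
proof (rule lc_boundedI[OF E])
  show "(\<Union>i\<in>I. B i) \<subseteq> E" using I(2) lc_bounded_carrier by blast
  fix p assume "p \<in> P"
  then have "\<forall>i\<in>I. \<exists>C. \<forall>x\<in>B i. p x \<le> C"
    using lc_boundedD[OF E I(2) cont_seminorm_member[OF E]] by blast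
  from bchoice[OF this] obtain C where C: "\<forall>i\<in>I. \<forall>x\<in>B i. p x \<le> C i" by blast
  have "p x \<le> (\<Sum>i\<in>I. \<bar>C i\<bar>)" if "i \<in> I" "x \<in> B i" for i x
  proof -
    have "p x \<le> \<bar>C i\<bar>" using C that by force
    also have "\<dots> \<le> (\<Sum>i\<in>I. \<bar>C i\<bar>)" using that I(1) by (intro member_le_sum) auto
    finally show ?thesis .
  qed
  then show "\<exists>C. \<forall>x\<in>\<Union>i\<in>I. B i. p x \<le> C" by blast
qed

text \<open>The cofinal seminorms of the steps are parameters, so that bounded sets, polars and the
  strong dual all refer to the same choice; \<open>metrizable_cofinal_seminorms\<close> provides
  them.\<close>

locale LM_space =
  fixes E :: "'a::real_vector set" and P En Pn and q :: "nat \<Rightarrow> nat \<Rightarrow> 'a \<Rightarrow> real"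
  assumes LM: "LM_space_wrt E P En Pn"
    and q_cont: "\<And>n k. cont_seminorm (En n) (Pn n) (q n k)"
    and q_mono: "\<And>n k m x. k \<le> m \<Longrightarrow> x \<in> En n \<Longrightarrow> q n k x \<le> q n m x"
    and q_cofinal: "\<And>n p. cont_seminorm (En n) (Pn n) p \<Longrightarrow> \<exists>k. \<forall>x\<in>En n. p x \<le> q n k x"
begin

lemma E: "lc_family E P"
  using LM lcs_imp_lc_family unfolding LM_space_wrt_def by blast

lemma En: "lc_family (En n) (Pn n)"
  using LM lcs_imp_lc_family unfolding LM_space_wrt_def by blast

lemma En_subset: "En n \<subseteq> E"
proof -
  have "(\<Union>n. En n) = E" using LM unfolding LM_space_wrt_def by (elim conjE)
  then show ?thesis by blast
qed

lemma En_cover: "x \<in> E \<Longrightarrow> \<exists>n. x \<in> En n"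
proof -
  have "(\<Union>n. En n) = E" using LM unfolding LM_space_wrt_def by (elim conjE)
  then show "x \<in> E \<Longrightarrow> ?thesis" by blast
qed

lemma final: "final_lc E P UNIV En Pn (\<lambda>n x. x)"
  using LM unfolding LM_space_wrt_def by (elim conjE)

lemma cont_seminorm_En: "cont_seminorm E P p \<Longrightarrow> cont_seminorm (En n) (Pn n) p"
  using final_lc_comp_cont_seminorm[OF E final UNIV_I En] by simp

lemma cont_seminormI:
  assumes "seminorm_on E p" "\<And>n. cont_seminorm (En n) (Pn n) p"
  shows "cont_seminorm E P p"
  using final_lc_cont_seminorm[OF E final En] assms by simp

lemma lc_bounded_En: "lc_bounded (En n) (Pn n) B \<Longrightarrow> lc_bounded E P B"
proof (rule lc_boundedI[OF E])
  assume B: "lc_bounded (En n) (Pn n) B"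
  show "B \<subseteq> E" using lc_bounded_carrier[OF B] En_subset by blast
  fix p assume "p \<in> P"
  then have "cont_seminorm (En n) (Pn n) p" using cont_seminorm_En cont_seminorm_member[OF E] by blast
  from lc_boundedD[OF En B this] show "\<exists>C. \<forall>x\<in>B. p x \<le> C" by blast
qed

lemma lc_bounded_EnI:
  assumes "B \<subseteq> En n" "\<And>k. \<exists>C. \<forall>x\<in>B. q n k x \<le> C"
  shows "lc_bounded (En n) (Pn n) B"
proof (rule lc_boundedI[OF En assms(1)])
  fix p assume "p \<in> Pn n"
  then obtain k where k: "\<forall>x\<in>En n. p x \<le> q n k x" using q_cofinal cont_seminorm_member[OF En] by blast
  obtain C where "\<forall>x\<in>B. q n k x \<le> C" using assms(2) by blast
  then have "\<forall>x\<in>B. p x \<le> C" using k assms(1) by force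
  then show "\<exists>C. \<forall>x\<in>B. p x \<le> C" by blast
qed

text \<open>By regularity a bounded set is described by the number of a step and a bound for each
  seminorm of that step; entry \<open>0\<close> of \<open>\<alpha>\<close> holds the former, the
  other entries the latter.\<close>

lemma fundamental_bounded_resolution:
  assumes regular: "\<And>B. lc_bounded E P B \<Longrightarrow> \<exists>n. B \<subseteq> En n \<and> lc_bounded (En n) (Pn n) B"
  shows "fundamental_bounded_resolution E P"
proof -
  \<comment> \<open>The union over all \<open>n \<le> \<alpha> 0\<close>, not just the step
    \<open>\<alpha> 0\<close>, makes the family monotone; being finite, it stays bounded.\<close>
  define A where "A \<alpha> = (\<Union>n\<in>{..\<alpha> 0}. {x\<in>En n. \<forall>k. q n k x \<le> real (\<alpha> (Suc (prod_encode (n, k))))})"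
    for \<alpha> :: "nat \<Rightarrow> nat"
  have bdd: "lc_bounded E P (A \<alpha>)" for \<alpha>
    unfolding A_def
  proof (rule lc_bounded_finite_UN[OF E])
    fix n
    show "lc_bounded E P {x\<in>En n. \<forall>k. q n k x \<le> real (\<alpha> (Suc (prod_encode (n, k))))}"
      by (rule lc_bounded_En[of n], rule lc_bounded_EnI) blast+
  qed simp
  have fund: "\<exists>\<alpha>. B \<subseteq> A \<alpha>" if B: "lc_bounded E P B" for B
  proof -
    obtain n where n: "B \<subseteq> En n" "lc_bounded (En n) (Pn n) B" using regular[OF B] by blast
    have "\<forall>k. \<exists>C. \<forall>x\<in>B. q n k x \<le> C" using lc_boundedD[OF En n(2) q_cont] by blast
    from choice[OF this] obtain C where C: "\<And>k x. x \<in> B \<Longrightarrow> q n k x \<le> C k" by blast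
    define \<alpha> where "\<alpha> i = (case i of 0 \<Rightarrow> n | Suc m \<Rightarrow> nat \<lceil>C (snd (prod_decode m))\<rceil>)" for i
    have "q n k x \<le> real (\<alpha> (Suc (prod_encode (n, k))))" if "x \<in> B" for k x
      using C[OF that, of k] real_nat_ceiling_ge[of "C k"] by (simp add: \<alpha>_def)
    moreover have "\<alpha> 0 = n" by (simp add: \<alpha>_def)
    ultimately have "B \<subseteq> A \<alpha>" unfolding A_def using n(1) by auto
    then show ?thesis by blast
  qed
  have "resolution E A"
  proof (rule resolutionI)
    show "A \<alpha> \<subseteq> E" for \<alpha> using lc_bounded_carrier[OF bdd] .
    show "\<exists>\<alpha>. x \<in> A \<alpha>" if "x \<in> E" for x
      using fund[OF lc_bounded_singleton[OF E that]] by simp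
    show "A \<alpha> \<subseteq> A \<beta>" if le: "\<alpha> \<le> \<beta>" for \<alpha> \<beta>
    proof
      fix x assume "x \<in> A \<alpha>"
      then obtain n where n: "n \<le> \<alpha> 0" "x \<in> En n" "\<And>k. q n k x \<le> real (\<alpha> (Suc (prod_encode (n, k))))"
        unfolding A_def by blast
      have "n \<le> \<beta> 0" using n(1) le_funD[OF le, of 0] by simp
      moreover have "q n k x \<le> real (\<beta> (Suc (prod_encode (n, k))))" for k
        using n(3)[of k] le_funD[OF le, of "Suc (prod_encode (n, k))"] by linarith
      ultimately show "x \<in> A \<beta>" unfolding A_def using n(2) by blast
    qed
  qed
  then show ?thesis
    unfolding fundamental_bounded_resolution_def using bdd fund by (intro exI[of _ A] conjI allI impI)
qed

text \<open>By homogeneity this is the polar of the union of the balls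
  \<open>{x \<in> En n. q n (\<alpha> n) x \<le> 1}\<close> over all \<open>n\<close>. Here
  \<open>\<alpha>\<close> selects seminorms and does not bound values.\<close>

definition polar where
  "polar \<alpha> = {f\<in>lc_dual E P. \<forall>n. \<forall>x\<in>En n. \<bar>f x\<bar> \<le> q n (\<alpha> n) x}"

lemma polar_mono: "\<alpha> \<le> \<beta> \<Longrightarrow> polar \<alpha> \<subseteq> polar \<beta>"
proof
  fix f assume le: "\<alpha> \<le> \<beta>" and f: "f \<in> polar \<alpha>"
  have "\<bar>f x\<bar> \<le> q n (\<beta> n) x" if "x \<in> En n" for n x
  proof -
    have "\<bar>f x\<bar> \<le> q n (\<alpha> n) x" using f that unfolding polar_def by blast
    also have "\<dots> \<le> q n (\<beta> n) x" using q_mono[OF le_funD[OF le] that] .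
    finally show ?thesis .
  qed
  then show "f \<in> polar \<beta>" using f unfolding polar_def by blast
qed

lemma polar_cover: "f \<in> lc_dual E P \<Longrightarrow> \<exists>\<alpha>. f \<in> polar \<alpha>"
proof -
  assume f: "f \<in> lc_dual E P"
  then obtain p where p: "cont_seminorm E P p" "\<forall>x\<in>E. \<bar>f x\<bar> \<le> p x" unfolding lc_dual_iff[OF E] by blast
  have "\<forall>n. \<exists>k. \<forall>x\<in>En n. p x \<le> q n k x" using q_cofinal[OF cont_seminorm_En[OF p(1)]] by blast
  from choice[OF this] obtain \<alpha> where \<alpha>: "\<forall>n. \<forall>x\<in>En n. p x \<le> q n (\<alpha> n) x" by blast
  have "\<bar>f x\<bar> \<le> q n (\<alpha> n) x" if "x \<in> En n" for n x
    using \<alpha> p(2) that En_subset by (meson order_trans subsetD)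
  then have "f \<in> polar \<alpha>" using f unfolding polar_def by blast
  then show ?thesis by blast
qed

lemma resolution_polar: "resolution (lc_dual E P) polar"
  by (rule resolutionI[OF _ polar_cover polar_mono]) (auto simp: polar_def)

text \<open>The supremum of a polar is a seminorm which is continuous on every step, hence on the limit.\<close>

lemma polar_equicontinuous:
  assumes "H \<subseteq> polar \<alpha>" "H \<noteq> {}"
  shows "equicontinuous E P H"
proof -
  have H: "f \<in> lc_dual E P" "x \<in> En n \<Longrightarrow> \<bar>f x\<bar> \<le> q n (\<alpha> n) x" if "f \<in> H" for f n x
    using assms(1) that unfolding polar_def by blast+
  have lin: "linear_on E f" if "f \<in> H" for f using H(1)[OF that] lc_dual_linear by blast
  have bdd: "bdd_above ((\<lambda>f. \<bar>f x\<bar>) ` H)" if x: "x \<in> E" for x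
  proof -
    obtain n where "x \<in> En n" using En_cover[OF x] by blast
    then show ?thesis using H(2) by (intro bdd_aboveI2[of _ _ "q n (\<alpha> n) x"]) blast
  qed
  define r where "r x = (SUP f\<in>H. \<bar>f x\<bar>)" for x
  have r: "seminorm_on E r"
    unfolding r_def using lin bdd
    by (intro seminorm_on_SUP assms(2) seminorm_on_abs lc_family_subspace[OF E])
  have "cont_seminorm (En n) (Pn n) r" for n
  proof (rule cont_seminorm_mono[OF seminorm_on_subset[OF r En_subset] q_cont[of n "\<alpha> n"]])
    show "r x \<le> q n (\<alpha> n) x" if "x \<in> En n" for x
      unfolding r_def using H(2) that by (intro cSUP_least[OF assms(2)]) blast
  qed
  then have "cont_seminorm E P r" using cont_seminormI[OF r] by blast
  moreover have "\<bar>f x\<bar> \<le> r x" if "f \<in> H" "x \<in> E" for f x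
    unfolding r_def using cSUP_upper[OF that(1) bdd[OF that(2)]] .
  ultimately show ?thesis using equicontinuousI[OF E lin] by blast
qed

lemma class_G: "class_G E P"
  unfolding class_G_def
proof (intro exI[of _ polar] conjI allI impI resolution_polar)
  fix \<alpha> and s :: "nat \<Rightarrow> 'a \<Rightarrow> real" assume "range s \<subseteq> polar \<alpha>"
  then show "equicontinuous E P (range s)" by (rule polar_equicontinuous) simp
qed

end

lemma LM_space_exists_seminorms:
  assumes "LM_space_wrt E P En Pn"
  obtains q where "LM_space E P En Pn q"
proof -
  have "lc_family (En n) (Pn n)" "lc_metrizable (En n) (Pn n)" for n
    using assms lcs_imp_lc_family unfolding LM_space_wrt_def by blast+
  then have "\<forall>n. \<exists>q :: nat \<Rightarrow> 'a \<Rightarrow> real. (\<forall>k. cont_seminorm (En n) (Pn n) (q k)) \<and>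
      (\<forall>k m x. k \<le> m \<longrightarrow> x \<in> En n \<longrightarrow> q k x \<le> q m x) \<and>
      (\<forall>p. cont_seminorm (En n) (Pn n) p \<longrightarrow> (\<exists>k. \<forall>x\<in>En n. p x \<le> q k x))"
    using metrizable_cofinal_seminorms by blast
  from choice[OF this] obtain q :: "nat \<Rightarrow> nat \<Rightarrow> 'a \<Rightarrow> real" where
    q: "\<And>n. (\<forall>k. cont_seminorm (En n) (Pn n) (q n k)) \<and>
      (\<forall>k m x. k \<le> m \<longrightarrow> x \<in> En n \<longrightarrow> q n k x \<le> q n m x) \<and>
      (\<forall>p. cont_seminorm (En n) (Pn n) p \<longrightarrow> (\<exists>k. \<forall>x\<in>En n. p x \<le> q n k x))" by blast
  have "LM_space E P En Pn q" by unfold_locales (use assms q in simp_all)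
  then show thesis using that by blast
qed

lemma regular_LM_space_quasi_DF:
  assumes "regular_LM_space E P"
  shows "quasi_DF E P"
proof -
  obtain En Pn where LM: "LM_space_wrt E P En Pn"
    and reg: "\<And>B. lc_bounded E P B \<Longrightarrow> \<exists>n. B \<subseteq> En n \<and> lc_bounded (En n) (Pn n) B"
    using assms unfolding regular_LM_space_def by blast
  obtain q where "LM_space E P En Pn q" using LM_space_exists_seminorms[OF LM] by blast
  then interpret LM_space E P En Pn q .
  show ?thesis unfolding quasi_DF_def using fundamental_bounded_resolution[OF reg] class_G by blast
qed

text \<open>All steps are taken equal to \<open>E\<close>; the universal property is then continuity
  of the identity.\<close>

lemma metrizable_regular_LM_space:
  assumes "lcs E P" "lc_metrizable E P"
  shows "regular_LM_space E P"
proof -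
  have "final_lc E P (UNIV :: nat set) (\<lambda>_. E) (\<lambda>_. P) (\<lambda>n x. x)"
    unfolding final_lc_def
  proof (intro conjI ballI allI impI)
    show "linear_on E (\<lambda>x. x)" by (simp add: linear_on_def)
    show "continuous_map (lc_topology E P) (lc_topology E P) (\<lambda>x. x)"
      using continuous_map_id unfolding id_def .
    fix Q U
    assume Q: "lc_family E Q \<and> (\<forall>i\<in>UNIV :: nat set. continuous_map (lc_topology E P) (lc_topology E Q) (\<lambda>x. x))"
      and U: "openin (lc_topology E Q) U"
    then have "openin (lc_topology E P) {x \<in> topspace (lc_topology E P). x \<in> U}"
      using openin_continuous_map_preimage by blast
    moreover have "{x \<in> topspace (lc_topology E P). x \<in> U} = U" using openin_subset[OF U] by auto
    ultimately show "openin (lc_topology E P) U" by simp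
  qed simp
  moreover have "subtopology (lc_topology E P) E = lc_topology E P"
    using subtopology_topspace[of "lc_topology E P"] by simp
  ultimately have "LM_space_wrt E P (\<lambda>_. E) (\<lambda>_. P)"
    unfolding LM_space_wrt_def using assms by simp
  then show ?thesis
    unfolding regular_LM_space_def
    by (intro exI[of _ "\<lambda>_. E"] exI[of _ "\<lambda>_. P"]) (simp add: lc_bounded_carrier)
qed

lemma metrizable_DF_space_normable:
  assumes "lcs E P" "lc_metrizable E P" "DF_space E P"
  shows "normable E P"
proof -
  obtain B :: "nat \<Rightarrow> 'a set" where "\<And>n. lc_bounded E P (B n)" "\<And>C. lc_bounded E P C \<Longrightarrow> \<exists>n. C \<subseteq> B n"
    using assms(3) unfolding DF_space_def by blast
  then show ?thesis using metrizable_fundamental_sequence_normable[OF assms(1,2)] by blast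
qed

section \<open>Strong duals\<close>

lemma subspace_lc_dual:
  assumes E: "lc_family E P"
  shows "subspace (lc_dual E P)"
  unfolding subspace_def
proof (intro conjI ballI allI)
  show "0 \<in> lc_dual E P"
    unfolding lc_dual_iff[OF E] using cont_seminorm_const_zero[of E P]
    by (auto simp: linear_on_def)
  fix f g assume f: "f \<in> lc_dual E P" and g: "g \<in> lc_dual E P"
  obtain p where p: "cont_seminorm E P p" "\<forall>x\<in>E. \<bar>f x\<bar> \<le> p x" using f unfolding lc_dual_iff[OF E] by blast
  obtain r where r: "cont_seminorm E P r" "\<forall>x\<in>E. \<bar>g x\<bar> \<le> r x" using g unfolding lc_dual_iff[OF E] by blast
  have "\<bar>(f + g) x\<bar> \<le> p x + r x" if "x \<in> E" for x
    using bspec[OF p(2) that] bspec[OF r(2) that] by auto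
  moreover have "linear_on E (f + g)" "\<forall>x. x \<notin> E \<longrightarrow> (f + g) x = 0"
    using f g unfolding lc_dual_def linear_on_def by (auto simp: algebra_simps)
  ultimately show "f + g \<in> lc_dual E P"
    unfolding lc_dual_iff[OF E] using cont_seminorm_add[OF E p(1) r(1)] by blast
next
  fix c f assume f: "f \<in> lc_dual E P"
  obtain p where p: "cont_seminorm E P p" "\<forall>x\<in>E. \<bar>f x\<bar> \<le> p x" using f unfolding lc_dual_iff[OF E] by blast
  have "\<bar>(c *\<^sub>R f) x\<bar> \<le> \<bar>c\<bar> * p x" if "x \<in> E" for x
    using bspec[OF p(2) that] by (simp add: scaleR_fun_def abs_mult mult_left_mono)
  moreover have "linear_on E (c *\<^sub>R f)" "\<forall>x. x \<notin> E \<longrightarrow> (c *\<^sub>R f) x = 0"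
    using f unfolding lc_dual_def linear_on_def by (auto simp: algebra_simps scaleR_fun_def)
  ultimately show "c *\<^sub>R f \<in> lc_dual E P"
    unfolding lc_dual_iff[OF E] using cont_seminorm_mult[OF p(1), of "\<bar>c\<bar>"] by auto
qed

lemma lc_dual_bounded_on_bounded:
  assumes E: "lc_family E P" and f: "f \<in> lc_dual E P" and B: "lc_bounded E P B"
  shows "bdd_above ((\<lambda>x. \<bar>f x\<bar>) ` B)"
proof -
  obtain p where p: "cont_seminorm E P p" "\<forall>x\<in>E. \<bar>f x\<bar> \<le> p x" using f unfolding lc_dual_iff[OF E] by blast
  obtain C where C: "\<forall>x\<in>B. p x \<le> C" using lc_boundedD[OF E B p(1)] by blast
  have "\<bar>f x\<bar> \<le> C" if "x \<in> B" for x
    using C p(2) that lc_bounded_carrier[OF B] by (meson order_trans subsetD)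
  then show ?thesis by (intro bdd_aboveI2)
qed

lemma lc_family_strong_dual:
  assumes E: "lc_family E P"
  shows "lc_family (lc_dual E P) (strong_seminorms E P)"
  unfolding lc_family_def
proof (intro conjI ballI subspace_lc_dual[OF E])
  fix r assume "r \<in> strong_seminorms E P"
  then obtain B where B: "r = (\<lambda>f. SUP x\<in>B. \<bar>f x\<bar>)" "lc_bounded E P B" "B \<noteq> {}"
    unfolding strong_seminorms_def by blast
  have "seminorm_on (lc_dual E P) (\<lambda>f. \<bar>f x\<bar>)" for x
    unfolding seminorm_on_def by (simp add: scaleR_fun_def abs_mult abs_triangle_ineq)
  then show "seminorm_on (lc_dual E P) r"
    unfolding B(1) using lc_dual_bounded_on_bounded[OF E _ B(2)]
    by (intro seminorm_on_SUP B(3) subspace_lc_dual[OF E])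
qed

text \<open>Replaces the suprema by uniform bounds on bounded sets. The empty set is treated apart
  because strong seminorms are indexed by nonempty sets.\<close>

lemma strongly_bounded_iff:
  assumes E: "lc_family E P"
  shows "lc_bounded (lc_dual E P) (strong_seminorms E P) H \<longleftrightarrow>
    H \<subseteq> lc_dual E P \<and> (\<forall>B. lc_bounded E P B \<longrightarrow> (\<exists>C. \<forall>f\<in>H. \<forall>x\<in>B. \<bar>f x\<bar> \<le> C))"
proof (intro iffI conjI allI impI)
  assume H: "lc_bounded (lc_dual E P) (strong_seminorms E P) H"
  show HE: "H \<subseteq> lc_dual E P" using lc_bounded_carrier[OF H] .
  fix B assume B: "lc_bounded E P B"
  show "\<exists>C. \<forall>f\<in>H. \<forall>x\<in>B. \<bar>f x\<bar> \<le> C"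
  proof (cases "B = {}")
    case False
    then have "(\<lambda>f. SUP x\<in>B. \<bar>f x\<bar>) \<in> strong_seminorms E P"
      unfolding strong_seminorms_def using B by blast
    from lc_boundedD[OF lc_family_strong_dual[OF E] H cont_seminorm_member[OF lc_family_strong_dual[OF E] this]]
    obtain C where C: "\<forall>f\<in>H. (SUP x\<in>B. \<bar>f x\<bar>) \<le> C" by blast
    have "\<bar>f x\<bar> \<le> C" if "f \<in> H" "x \<in> B" for f x
    proof -
      have "\<bar>f x\<bar> \<le> (SUP x\<in>B. \<bar>f x\<bar>)"
        using lc_dual_bounded_on_bounded[OF E _ B] HE that by (intro cSUP_upper) auto
      also have "\<dots> \<le> C" using C that(1) by blast
      finally show ?thesis .
    qed
    then show ?thesis by blast
  qed simp
next
  assume H: "H \<subseteq> lc_dual E P \<and> (\<forall>B. lc_bounded E P B \<longrightarrow> (\<exists>C. \<forall>f\<in>H. \<forall>x\<in>B. \<bar>f x\<bar> \<le> C))"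
  show "lc_bounded (lc_dual E P) (strong_seminorms E P) H"
  proof (rule lc_boundedI[OF lc_family_strong_dual[OF E]])
    show "H \<subseteq> lc_dual E P" using H by blast
    fix r assume "r \<in> strong_seminorms E P"
    then obtain B where B: "r = (\<lambda>f. SUP x\<in>B. \<bar>f x\<bar>)" "lc_bounded E P B" "B \<noteq> {}"
      unfolding strong_seminorms_def by blast
    obtain C where C: "\<forall>f\<in>H. \<forall>x\<in>B. \<bar>f x\<bar> \<le> C" using H B(2) by blast
    have "r f \<le> C" if "f \<in> H" for f
      unfolding B(1) using C that by (intro cSUP_least[OF B(3)]) blast
    then show "\<exists>C. \<forall>f\<in>H. r f \<le> C" by blast
  qed
qed

text \<open>A finite union of bounded sets is bounded, and a sum of suprema is at most the number of
  terms times the supremum over the union. Inserting \<open>0\<close> keeps the index set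
  nonempty.\<close>

lemma strong_dual_cont_seminorm:
  assumes E: "lc_family E P" and r: "cont_seminorm (lc_dual E P) (strong_seminorms E P) r"
  obtains B C where "lc_bounded E P B" "0 \<le> C"
    "\<And>f. f \<in> lc_dual E P \<Longrightarrow> r f \<le> C * (SUP x\<in>insert 0 B. \<bar>f x\<bar>)"
proof -
  obtain F C where F: "finite F" "F \<subseteq> strong_seminorms E P" "0 \<le> C"
    "\<And>f. f \<in> lc_dual E P \<Longrightarrow> r f \<le> C * (\<Sum>p\<in>F. p f)"
    using r unfolding cont_seminorm_def by blast
  have "\<forall>p\<in>F. \<exists>B. p = (\<lambda>f. SUP x\<in>B. \<bar>f x\<bar>) \<and> lc_bounded E P B \<and> B \<noteq> {}"
    using F(2) unfolding strong_seminorms_def by blast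
  from bchoice[OF this] obtain B where
    B: "\<And>p. p \<in> F \<Longrightarrow> p = (\<lambda>f. SUP x\<in>B p. \<bar>f x\<bar>)" "\<And>p. p \<in> F \<Longrightarrow> lc_bounded E P (B p)" "\<And>p. p \<in> F \<Longrightarrow> B p \<noteq> {}"
    by blast
  define U where "U = (\<Union>p\<in>F. B p)"
  have U: "lc_bounded E P U" unfolding U_def using lc_bounded_finite_UN[OF E F(1) B(2)] .
  then have U0: "lc_bounded E P (insert 0 U)"
    using lc_bounded_insert[OF E subspace_0[OF lc_family_subspace[OF E]]] by blast
  have "r f \<le> (C * card F) * (SUP x\<in>insert 0 U. \<bar>f x\<bar>)" if f: "f \<in> lc_dual E P" for f
  proof -
    have "p f \<le> (SUP x\<in>insert 0 U. \<bar>f x\<bar>)" if p: "p \<in> F" for p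
    proof -
      have "p f = (SUP x\<in>B p. \<bar>f x\<bar>)" using fun_cong[OF B(1)[OF p], of f] .
      also have "\<dots> \<le> (SUP x\<in>insert 0 U. \<bar>f x\<bar>)"
        using p unfolding U_def
        by (intro cSUP_subset_mono B(3)[OF p] lc_dual_bounded_on_bounded[OF E f] U0[unfolded U_def]) auto
      finally show ?thesis .
    qed
    then have "(\<Sum>p\<in>F. p f) \<le> card F * (SUP x\<in>insert 0 U. \<bar>f x\<bar>)" by (intro sum_bounded_above)
    then have "C * (\<Sum>p\<in>F. p f) \<le> C * (card F * (SUP x\<in>insert 0 U. \<bar>f x\<bar>))" using F(3) by (rule mult_left_mono)
    then show ?thesis using F(4)[OF f] by (simp add: mult.assoc)
  qed
  moreover have "0 \<le> C * card F" using F(3) by simp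
  ultimately show thesis using that[OF U] by blast
qed

text \<open>A continuous functional on the strong dual is dominated by a multiple of the supremum
  over one bounded set of \<open>E\<close>, and that set lies in some
  \<open>A \<alpha>\<close>.\<close>

lemma class_G_strong_dual:
  assumes E: "lc_family E P" and fbr: "fundamental_bounded_resolution E P"
  shows "class_G (lc_dual E P) (strong_seminorms E P)"
proof -
  note E' = lc_family_strong_dual[OF E]
  obtain A where A: "resolution E A" "\<And>\<alpha>. lc_bounded E P (A \<alpha>)"
    "\<And>B. lc_bounded E P B \<Longrightarrow> \<exists>\<alpha>. B \<subseteq> A \<alpha>"
    using fbr unfolding fundamental_bounded_resolution_def by blast
  have bdd: "lc_bounded E P (insert 0 (A \<alpha>))" for \<alpha>
    using lc_bounded_insert[OF E subspace_0[OF lc_family_subspace[OF E]] A(2)] .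
  define s where "s \<alpha> f = (SUP x\<in>insert 0 (A \<alpha>). \<bar>f x\<bar>)" for \<alpha> and f :: "'a \<Rightarrow> real"
  have s_cont: "cont_seminorm (lc_dual E P) (strong_seminorms E P) (s \<alpha>)" for \<alpha>
  proof (rule cont_seminorm_member[OF E'])
    have "s \<alpha> = (\<lambda>f. SUP x\<in>insert 0 (A \<alpha>). \<bar>f x\<bar>)" by (simp add: s_def fun_eq_iff)
    then show "s \<alpha> \<in> strong_seminorms E P" unfolding strong_seminorms_def using bdd by blast
  qed
  have s_nonneg: "0 \<le> s \<alpha> f" if "f \<in> lc_dual E P" for \<alpha> f
    using seminorm_on_nonneg[OF lc_family_subspace[OF E'] cont_seminorm_seminorm[OF s_cont] that] .
  have s_mono: "(SUP x\<in>insert 0 B. \<bar>f x\<bar>) \<le> s \<alpha> f" if "f \<in> lc_dual E P" "B \<subseteq> A \<alpha>" for B \<alpha> f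
    unfolding s_def using that
    by (intro cSUP_subset_mono lc_dual_bounded_on_bounded[OF E _ bdd]) auto
  \<comment> \<open>Entry \<open>0\<close> bounds the multiple and the shifted sequence indexes the
    bounded set. Each \<open>G \<alpha>\<close> is dominated by a single continuous
    seminorm.\<close>
  define G where "G \<alpha> = {\<phi>\<in>lc_dual (lc_dual E P) (strong_seminorms E P).
      \<forall>f\<in>lc_dual E P. \<bar>\<phi> f\<bar> \<le> real (\<alpha> 0) * s (\<lambda>i. \<alpha> (Suc i)) f}" for \<alpha> :: "nat \<Rightarrow> nat"
  have "resolution (lc_dual (lc_dual E P) (strong_seminorms E P)) G"
  proof (rule resolutionI)
    show "G \<alpha> \<subseteq> lc_dual (lc_dual E P) (strong_seminorms E P)" for \<alpha> unfolding G_def by blast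
    show "\<exists>\<alpha>. \<phi> \<in> G \<alpha>" if \<phi>: "\<phi> \<in> lc_dual (lc_dual E P) (strong_seminorms E P)" for \<phi>
    proof -
      obtain r where r: "cont_seminorm (lc_dual E P) (strong_seminorms E P) r" "\<forall>f\<in>lc_dual E P. \<bar>\<phi> f\<bar> \<le> r f"
        using \<phi> unfolding lc_dual_iff[OF E'] by blast
      obtain B C where BC: "lc_bounded E P B" "0 \<le> C"
        "\<And>f. f \<in> lc_dual E P \<Longrightarrow> r f \<le> C * (SUP x\<in>insert 0 B. \<bar>f x\<bar>)"
        using strong_dual_cont_seminorm[OF E r(1)] by blast
      obtain \<alpha> where \<alpha>: "B \<subseteq> A \<alpha>" using A(3)[OF BC(1)] by blast
      define \<beta> where "\<beta> i = (case i of 0 \<Rightarrow> nat \<lceil>C\<rceil> | Suc j \<Rightarrow> \<alpha> j)" for i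
      have "\<bar>\<phi> f\<bar> \<le> real (\<beta> 0) * s (\<lambda>i. \<beta> (Suc i)) f" if f: "f \<in> lc_dual E P" for f
      proof -
        have "\<bar>\<phi> f\<bar> \<le> C * (SUP x\<in>insert 0 B. \<bar>f x\<bar>)" using bspec[OF r(2) f] BC(3)[OF f] by simp
        also have "\<dots> \<le> C * s \<alpha> f" using s_mono[OF f \<alpha>] BC(2) by (rule mult_left_mono)
        also have "\<dots> \<le> real (nat \<lceil>C\<rceil>) * s \<alpha> f"
          using s_nonneg[OF f] real_nat_ceiling_ge by (intro mult_right_mono)
        finally show ?thesis by (simp add: \<beta>_def)
      qed
      then have "\<phi> \<in> G \<beta>" using \<phi> unfolding G_def by blast
      then show ?thesis by blast
    qed
    show "G \<alpha> \<subseteq> G \<beta>" if le: "\<alpha> \<le> \<beta>" for \<alpha> \<beta>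
    proof
      fix \<phi> assume \<phi>: "\<phi> \<in> G \<alpha>"
      have tail: "(\<lambda>i. \<alpha> (Suc i)) \<le> (\<lambda>i. \<beta> (Suc i))" using le by (simp add: le_fun_def)
      have "\<bar>\<phi> f\<bar> \<le> real (\<beta> 0) * s (\<lambda>i. \<beta> (Suc i)) f" if f: "f \<in> lc_dual E P" for f
      proof -
        have "\<bar>\<phi> f\<bar> \<le> real (\<alpha> 0) * s (\<lambda>i. \<alpha> (Suc i)) f" using \<phi> f unfolding G_def by blast
        also have "\<dots> \<le> real (\<beta> 0) * s (\<lambda>i. \<beta> (Suc i)) f"
        proof (rule mult_mono)
          show "s (\<lambda>i. \<alpha> (Suc i)) f \<le> s (\<lambda>i. \<beta> (Suc i)) f"
            using s_mono[OF f resolution_mono[OF A(1) tail]] by (simp add: s_def)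
        qed (use le_funD[OF le, of 0] s_nonneg[OF f] in auto)
        finally show ?thesis .
      qed
      then show "\<phi> \<in> G \<beta>" using \<phi> unfolding G_def by blast
    qed
  qed
  moreover have "equicontinuous (lc_dual E P) (strong_seminorms E P) (range t)"
    if t: "range t \<subseteq> G \<alpha>" for \<alpha> and t :: "nat \<Rightarrow> ('a \<Rightarrow> real) \<Rightarrow> real"
  proof (rule equicontinuousI[OF E'])
    show "cont_seminorm (lc_dual E P) (strong_seminorms E P) (\<lambda>f. real (\<alpha> 0) * s (\<lambda>i. \<alpha> (Suc i)) f)"
      using cont_seminorm_mult[OF s_cont] by simp
    show "linear_on (lc_dual E P) \<phi>" if "\<phi> \<in> range t" for \<phi>
      using that t lc_dual_linear unfolding G_def by blast
    show "\<bar>\<phi> f\<bar> \<le> real (\<alpha> 0) * s (\<lambda>i. \<alpha> (Suc i)) f" if "\<phi> \<in> range t" "f \<in> lc_dual E P" for \<phi> f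
      using that t unfolding G_def by blast
  qed
  ultimately show ?thesis unfolding class_G_def by (intro exI[of _ G]) auto
qed

section \<open>Strongly bounded sets of functionals on an (LM)-space\<close>

context LM_space
begin

text \<open>A strongly bounded set is equicontinuous on each metrizable step, since otherwise it would
  be unbounded on a null sequence of that step.\<close>

lemma strongly_bounded_subset_polar:
  assumes H: "lc_bounded (lc_dual E P) (strong_seminorms E P) H"
  shows "\<exists>\<alpha>. H \<subseteq> polar \<alpha>"
proof -
  have HE: "H \<subseteq> lc_dual E P" and Hb: "\<And>B. lc_bounded E P B \<Longrightarrow> \<exists>C. \<forall>f\<in>H. \<forall>x\<in>B. \<bar>f x\<bar> \<le> C"
    using H unfolding strongly_bounded_iff[OF E] by blast+
  have "\<exists>k. \<forall>f\<in>H. \<forall>x\<in>En n. \<bar>f x\<bar> \<le> q n k x" for n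
  proof -
    note sub = lc_family_subspace[OF En]
    have "\<exists>k. \<forall>f\<in>H. \<forall>x\<in>En n. \<bar>f x\<bar> \<le> (real k + 1) * q n k x"
    proof (rule ccontr)
      assume "\<not> ?thesis"
      \<comment> \<open>Functional and point are packed into a pair so that one application of
        \<open>choice\<close> selects both.\<close>
      then have "\<forall>k. \<exists>z. fst z \<in> H \<and> snd z \<in> En n \<and> (real k + 1) * q n k (snd z) < \<bar>fst z (snd z)\<bar>"
        unfolding not_le[symmetric] by (simp add: Bex_def)
      from choice[OF this] obtain z where z: "\<And>k. fst (z k) \<in> H" "\<And>k. snd (z k) \<in> En n"
        "\<And>k. (real k + 1) * q n k (snd (z k)) < \<bar>fst (z k) (snd (z k))\<bar>" by blast
      define f where "f k = fst (z k)" for k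
      define x where "x k = snd (z k)" for k
      \<comment> \<open>This factor makes \<open>\<bar>f k (y k)\<bar>\<close> equal to
        \<open>k + 1\<close> and keeps \<open>q n k (y k) \<le> 1\<close>: the points
        \<open>y k\<close> form a bounded set on which \<open>H\<close> is unbounded.\<close>
      define c where "c k = (real k + 1) / \<bar>f k (x k)\<bar>" for k
      define y where "y k = c k *\<^sub>R x k" for k
      have fx: "f k \<in> H" "x k \<in> En n" "(real k + 1) * q n k (x k) < \<bar>f k (x k)\<bar>" for k
        using z unfolding f_def x_def by auto
      have pos: "0 < \<bar>f k (x k)\<bar>" for k
      proof -
        have "0 \<le> (real k + 1) * q n k (x k)"
          using seminorm_on_nonneg[OF sub cont_seminorm_seminorm[OF q_cont] fx(2)] by simp
        then show ?thesis using fx(3)[of k] by linarith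
      qed
      have c: "0 < c k" for k unfolding c_def using pos[of k] by (intro divide_pos_pos) auto
      have yE: "y k \<in> En n" for k unfolding y_def using subspace_scale[OF sub fx(2)] .
      have qy: "q n k (y k) \<le> 1" for k
      proof -
        have "q n k (y k) = c k * q n k (x k)"
          unfolding y_def using seminorm_on_scale[OF cont_seminorm_seminorm[OF q_cont] fx(2)] c[of k] by simp
        also have "\<dots> = ((real k + 1) * q n k (x k)) / \<bar>f k (x k)\<bar>" by (simp add: c_def)
        also have "\<dots> \<le> 1" using fx(3)[of k] pos[of k] by (subst pos_divide_le_eq) auto
        finally show ?thesis .
      qed
      have "lc_bounded (En n) (Pn n) (range y)"
        by (rule lc_bounded_cofinal_sequence[OF En q_mono q_cofinal yE qy])
      then obtain C where C: "\<forall>f\<in>H. \<forall>x\<in>range y. \<bar>f x\<bar> \<le> C" using Hb[OF lc_bounded_En] by blast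
      have "real k + 1 \<le> C" for k
      proof -
        have "f k (y k) = c k * f k (x k)"
          using linear_on_scale[OF lc_dual_linear, of "f k" E P "x k" "c k"] HE fx(1)[of k] fx(2)[of k] En_subset[of n]
          unfolding y_def by auto
        then have "\<bar>f k (y k)\<bar> = c k * \<bar>f k (x k)\<bar>" using c[of k] by (simp add: abs_mult)
        also have "\<dots> = real k + 1" using pos[of k] by (simp add: c_def)
        finally show ?thesis using bspec[OF bspec[OF C fx(1)[of k]], of "y k"] by simp
      qed
      moreover obtain k where "C < real k" using reals_Archimedean2 by auto
      ultimately have "real k + 1 \<le> C" "C < real k" by auto
      then show False by linarith
    qed
    then obtain k where k: "\<forall>f\<in>H. \<forall>x\<in>En n. \<bar>f x\<bar> \<le> (real k + 1) * q n k x" by blast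
    \<comment> \<open>Cofinality absorbs the constant \<open>k + 1\<close> into a later seminorm, as
      \<open>polar\<close> admits no constants.\<close>
    have "cont_seminorm (En n) (Pn n) (\<lambda>x. (real k + 1) * q n k x)"
      by (intro cont_seminorm_mult q_cont) simp
    then obtain m where m: "\<forall>x\<in>En n. (real k + 1) * q n k x \<le> q n m x" using q_cofinal by blast
    have "\<bar>f x\<bar> \<le> q n m x" if "f \<in> H" "x \<in> En n" for f x
      using bspec[OF bspec[OF k that(1)] that(2)] bspec[OF m that(2)] by linarith
    then show ?thesis by blast
  qed
  then have "\<forall>n. \<exists>k. \<forall>f\<in>H. \<forall>x\<in>En n. \<bar>f x\<bar> \<le> q n k x" by blast
  from choice[OF this] obtain \<alpha> where "\<forall>n. \<forall>f\<in>H. \<forall>x\<in>En n. \<bar>f x\<bar> \<le> q n (\<alpha> n) x" by blast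
  then have "H \<subseteq> polar \<alpha>" unfolding polar_def using HE by blast
  then show ?thesis by blast
qed

text \<open>Regularity puts a bounded set into one step, where the single seminorm
  \<open>q n (\<alpha> n)\<close> bounds the whole polar on it.\<close>

lemma polar_strongly_bounded:
  assumes regular: "\<And>B. lc_bounded E P B \<Longrightarrow> \<exists>n. B \<subseteq> En n \<and> lc_bounded (En n) (Pn n) B"
  shows "lc_bounded (lc_dual E P) (strong_seminorms E P) (polar \<alpha>)"
  unfolding strongly_bounded_iff[OF E]
proof (intro conjI allI impI)
  show "polar \<alpha> \<subseteq> lc_dual E P" unfolding polar_def by blast
  fix B assume "lc_bounded E P B"
  then obtain n where n: "B \<subseteq> En n" "lc_bounded (En n) (Pn n) B" using regular by blast
  obtain C where C: "\<forall>x\<in>B. q n (\<alpha> n) x \<le> C" using lc_boundedD[OF En n(2) q_cont] by blast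
  have "\<bar>f x\<bar> \<le> C" if f: "f \<in> polar \<alpha>" and x: "x \<in> B" for f x
  proof -
    have "\<bar>f x\<bar> \<le> q n (\<alpha> n) x" using f x n(1) unfolding polar_def by blast
    then show ?thesis using bspec[OF C x] by linarith
  qed
  then show "\<exists>C. \<forall>f\<in>polar \<alpha>. \<forall>x\<in>B. \<bar>f x\<bar> \<le> C" by blast
qed

lemma fundamental_bounded_resolution_strong_dual:
  assumes regular: "\<And>B. lc_bounded E P B \<Longrightarrow> \<exists>n. B \<subseteq> En n \<and> lc_bounded (En n) (Pn n) B"
  shows "fundamental_bounded_resolution (lc_dual E P) (strong_seminorms E P)"
  unfolding fundamental_bounded_resolution_def
  using resolution_polar polar_strongly_bounded[OF regular] strongly_bounded_subset_polar
  by (intro exI[of _ polar] conjI allI impI)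

end

lemma strong_dual_quasi_DF:
  assumes "regular_LM_space E P"
  shows "quasi_DF (lc_dual E P) (strong_seminorms E P)"
proof -
  obtain En Pn where LM: "LM_space_wrt E P En Pn"
    and reg: "\<And>B. lc_bounded E P B \<Longrightarrow> \<exists>n. B \<subseteq> En n \<and> lc_bounded (En n) (Pn n) B"
    using assms unfolding regular_LM_space_def by blast
  obtain q where "LM_space E P En Pn q" using LM_space_exists_seminorms[OF LM] by blast
  then interpret LM_space E P En Pn q .
  show ?thesis
    unfolding quasi_DF_def
    using fundamental_bounded_resolution_strong_dual[OF reg]
      class_G_strong_dual[OF E fundamental_bounded_resolution[OF reg]] by blast
qed

section \<open>Sums and products\<close>

text \<open>Entry \<open>0\<close> is kept apart for a cut-off on the coordinates;
  \<open>prod_encode\<close> splits the other entries into one sequence for each coordinate.\<close>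

definition coded_row :: "(nat \<Rightarrow> nat) \<Rightarrow> nat \<Rightarrow> nat \<Rightarrow> nat" where
  "coded_row \<alpha> n k = \<alpha> (Suc (prod_encode (n, k)))"

lemma coded_row_mono: "\<alpha> \<le> \<beta> \<Longrightarrow> coded_row \<alpha> n \<le> coded_row \<beta> n"
  by (simp add: coded_row_def le_fun_def)

lemma coded_row_exists:
  obtains \<alpha> where "\<alpha> 0 = N" "\<And>n. coded_row \<alpha> n = a n"
proof
  let ?\<alpha> = "\<lambda>i. case i of 0 \<Rightarrow> N | Suc m \<Rightarrow> a (fst (prod_decode m)) (snd (prod_decode m))"
  show "?\<alpha> 0 = N" by simp
  show "coded_row ?\<alpha> n = a n" for n by (simp add: coded_row_def fun_eq_iff)
qed

lemma sum_injection_apply: "sum_injection n v m = (if m = n then v else 0)"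
  by (simp add: sum_injection_def)

lemma linear_on_sum_injection: "linear_on X (sum_injection n)"
  by (auto simp: linear_on_def sum_injection_def fun_eq_iff scaleR_fun_def)

lemma linear_on_comp:
  "linear_on E f \<Longrightarrow> linear_on X j \<Longrightarrow> j ` X \<subseteq> E \<Longrightarrow> linear_on X (\<lambda>x. f (j x))"
  unfolding linear_on_def by (auto simp: image_subset_iff)

lemma sum_fun_apply: "(\<Sum>i\<in>F. g i) x = (\<Sum>i\<in>F. g i x)" for g :: "'i \<Rightarrow> 'b \<Rightarrow> 'c::comm_monoid_add"
  by (induction F rule: infinite_finite_induct) auto

lemma sum_injection_mem_prod:
  "\<forall>m\<in>I. 0 \<in> Es m \<Longrightarrow> n \<in> I \<Longrightarrow> sum_injection n v \<in> prod_carrier I Es \<longleftrightarrow> v \<in> Es n"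
  by (auto simp: prod_carrier_def sum_injection_def)

lemma sum_injection_mem_sum:
  assumes "\<forall>m\<in>I. 0 \<in> Es m" "n \<in> I"
  shows "sum_injection n v \<in> sum_carrier I Es \<longleftrightarrow> v \<in> Es n"
proof -
  have "finite {m. sum_injection n v m \<noteq> 0}"
    by (rule finite_subset[of _ "{n}"]) (auto simp: sum_injection_def)
  then show ?thesis using assms by (auto simp: sum_carrier_def sum_injection_def)
qed

lemma subspace_prod_carrier:
  assumes "\<And>n. n \<in> I \<Longrightarrow> subspace (Es n)"
  shows "subspace (prod_carrier I Es)"
  unfolding subspace_def prod_carrier_def
  using assms by (auto simp: scaleR_fun_def subspace_0 subspace_add subspace_scale)

lemma sum_carrier_subset: "sum_carrier I Es \<subseteq> prod_carrier I Es"
  by (auto simp: sum_carrier_def prod_carrier_def)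

lemma linear_on_sum:
  assumes "linear_on E f" "subspace E" "\<And>i. i \<in> F \<Longrightarrow> g i \<in> E"
  shows "f (\<Sum>i\<in>F. g i) = (\<Sum>i\<in>F. f (g i))"
  using assms(3)
proof (induction F rule: infinite_finite_induct)
  case (insert x F)
  then have "(\<Sum>i\<in>F. g i) \<in> E" using assms(2) by (intro subspace_sum) auto
  then show ?case using insert linear_on_add[OF assms(1)] by simp
qed (auto simp: linear_on_zero[OF assms(1,2)])

lemma seminorm_on_sum_le:
  assumes "seminorm_on E p" "subspace E" "\<And>i. i \<in> F \<Longrightarrow> g i \<in> E"
  shows "p (\<Sum>i\<in>F. g i) \<le> (\<Sum>i\<in>F. p (g i))"
  using assms(3)
proof (induction F rule: infinite_finite_induct)
  case (insert x F)
  then have "(\<Sum>i\<in>F. g i) \<in> E" using assms(2) by (intro subspace_sum) auto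
  then have "p (g x + (\<Sum>i\<in>F. g i)) \<le> p (g x) + p (\<Sum>i\<in>F. g i)"
    using insert seminorm_on_triangle[OF assms(1)] by simp
  then show ?case using insert by simp
qed (auto simp: seminorm_on_zero[OF assms(2,1)])

lemma sum_of_injections:
  assumes "finite F" "\<And>n. n \<notin> F \<Longrightarrow> x n = 0"
  shows "x = (\<Sum>n\<in>F. sum_injection n (x n))"
proof
  fix m
  have "(\<Sum>n\<in>F. sum_injection n (x n)) m = (\<Sum>n\<in>F. if m = n then x n else 0)"
    by (simp add: sum_fun_apply sum_injection_def)
  also have "\<dots> = x m" using assms by (simp add: sum.delta')
  finally show "x m = (\<Sum>n\<in>F. sum_injection n (x n)) m" by simp
qed

locale lc_sequence =
  fixes I :: "nat set" and Es :: "nat \<Rightarrow> 'a::real_vector set" and Ps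
  assumes lcs: "\<And>n. n \<in> I \<Longrightarrow> lcs (Es n) (Ps n)"
    and quasi_DF: "\<And>n. n \<in> I \<Longrightarrow> quasi_DF (Es n) (Ps n)"
begin

lemma Es: "n \<in> I \<Longrightarrow> lc_family (Es n) (Ps n)"
  using lcs lcs_imp_lc_family by blast

lemma sub: "n \<in> I \<Longrightarrow> subspace (Es n)"
  using Es lc_family_subspace by blast

lemma zero_mem: "\<forall>n\<in>I. 0 \<in> Es n"
  using sub subspace_0 by blast

lemma bounded_resolutions:
  "\<exists>A. \<forall>n\<in>I. resolution (Es n) (A n) \<and> (\<forall>\<alpha>. lc_bounded (Es n) (Ps n) (A n \<alpha>)) \<and>
     (\<forall>B. lc_bounded (Es n) (Ps n) B \<longrightarrow> (\<exists>\<alpha>. B \<subseteq> A n \<alpha>))"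
  using quasi_DF unfolding quasi_DF_def fundamental_bounded_resolution_def
  by (intro bchoice) blast

text \<open>Chooses the resolutions for all coordinates at once, with equicontinuity restated as
  domination by a seminorm so that bounds from different coordinates can be added.\<close>

lemma dual_resolutions:
  "\<exists>A. \<forall>n\<in>I. resolution (lc_dual (Es n) (Ps n)) (A n) \<and>
     (\<forall>\<alpha> (s :: nat \<Rightarrow> 'a \<Rightarrow> real). range s \<subseteq> A n \<alpha> \<longrightarrow>
       (\<exists>q. cont_seminorm (Es n) (Ps n) q \<and> (\<forall>i. \<forall>x\<in>Es n. \<bar>s i x\<bar> \<le> q x)))"
proof (intro bchoice ballI)
  fix n assume n: "n \<in> I"
  obtain A where A: "resolution (lc_dual (Es n) (Ps n)) A"
    and eq: "\<And>\<alpha> (s :: nat \<Rightarrow> 'a \<Rightarrow> real). range s \<subseteq> A \<alpha> \<Longrightarrow> equicontinuous (Es n) (Ps n) (range s)"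
    using quasi_DF[OF n] unfolding quasi_DF_def class_G_def by blast
  have "\<exists>q. cont_seminorm (Es n) (Ps n) q \<and> (\<forall>i. \<forall>x\<in>Es n. \<bar>s i x\<bar> \<le> q x)"
    if s: "range s \<subseteq> A \<alpha>" for \<alpha> and s :: "nat \<Rightarrow> 'a \<Rightarrow> real"
  proof -
    have "linear_on (Es n) f" if "f \<in> range s" for f
      using s that resolution_subset[OF A, of \<alpha>] lc_dual_linear by blast
    from equicontinuousD[OF Es[OF n] eq[OF s] this] show ?thesis by simp
  qed
  then show "\<exists>A. resolution (lc_dual (Es n) (Ps n)) A \<and>
     (\<forall>\<alpha> (s :: nat \<Rightarrow> 'a \<Rightarrow> real). range s \<subseteq> A \<alpha> \<longrightarrow>
       (\<exists>q. cont_seminorm (Es n) (Ps n) q \<and> (\<forall>i. \<forall>x\<in>Es n. \<bar>s i x\<bar> \<le> q x)))"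
    using A by (intro exI[of _ A]) simp
qed

subsection \<open>Products\<close>

lemma lc_family_prod: "lc_family (prod_carrier I Es) (prod_seminorms I Ps)"
  unfolding lc_family_def
proof (intro conjI ballI)
  show "subspace (prod_carrier I Es)" using subspace_prod_carrier sub by blast
  fix r assume "r \<in> prod_seminorms I Ps"
  then obtain n p where r: "r = (\<lambda>x. p (x n))" "n \<in> I" "p \<in> Ps n" unfolding prod_seminorms_def by blast
  have "linear_on (prod_carrier I Es) (\<lambda>x. x n)" by (simp add: linear_on_def scaleR_fun_def)
  moreover have "(\<lambda>x. x n) ` prod_carrier I Es \<subseteq> Es n" using r(2) by (auto simp: prod_carrier_def)
  ultimately show "seminorm_on (prod_carrier I Es) r"
    unfolding r(1) using seminorm_on_comp[OF lc_family_seminorm[OF Es[OF r(2)] r(3)]] by blast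
qed

lemma prod_mem: "x \<in> prod_carrier I Es \<Longrightarrow> n \<in> I \<Longrightarrow> x n \<in> Es n"
  by (auto simp: prod_carrier_def dest: spec[of _ n])

lemma cont_seminorm_prod_coordinate:
  assumes n: "n \<in> I" and q: "cont_seminorm (Es n) (Ps n) q"
  shows "cont_seminorm (prod_carrier I Es) (prod_seminorms I Ps) (\<lambda>x. q (x n))"
proof -
  obtain F C where F: "finite F" "F \<subseteq> Ps n" "0 \<le> C" "\<And>v. v \<in> Es n \<Longrightarrow> q v \<le> C * (\<Sum>p\<in>F. p v)"
    using q unfolding cont_seminorm_def by blast
  have "cont_seminorm (prod_carrier I Es) (prod_seminorms I Ps) (\<lambda>x. C * (\<Sum>p\<in>F. p (x n)))"
  proof (intro cont_seminorm_mult cont_seminorm_sum lc_family_prod cont_seminorm_member F(3))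
    fix p assume "p \<in> F"
    then show "(\<lambda>x. p (x n)) \<in> prod_seminorms I Ps" unfolding prod_seminorms_def using F(2) n by blast
  qed
  moreover have "seminorm_on (prod_carrier I Es) (\<lambda>x. q (x n))"
    by (rule seminorm_on_comp[OF cont_seminorm_seminorm[OF q]])
      (use prod_mem n in \<open>auto simp: linear_on_def scaleR_fun_def\<close>)
  ultimately show ?thesis
    using cont_seminorm_mono[of "prod_carrier I Es" "\<lambda>x. q (x n)" "prod_seminorms I Ps" "\<lambda>x. C * (\<Sum>p\<in>F. p (x n))"]
      F(4) prod_mem[OF _ n] by auto
qed

text \<open>A generator of the product reads one coordinate, so composed with an injection it is
  either a generator of that factor or zero.\<close>

lemma cont_seminorm_prod_injection:
  assumes n: "n \<in> I" and q: "cont_seminorm (prod_carrier I Es) (prod_seminorms I Ps) q"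
  shows "cont_seminorm (Es n) (Ps n) (\<lambda>v. q (sum_injection n v))"
proof -
  have img: "sum_injection n ` Es n \<subseteq> prod_carrier I Es"
    using sum_injection_mem_prod[OF zero_mem n] by auto
  have "continuous_map (lc_topology (Es n) (Ps n)) (lc_topology (prod_carrier I Es) (prod_seminorms I Ps)) (sum_injection n)"
  proof (rule continuous_map_lcI[OF Es[OF n] lc_family_prod linear_on_sum_injection img])
    fix r assume "r \<in> prod_seminorms I Ps"
    then obtain m p where r: "r = (\<lambda>x. p (x m))" "m \<in> I" "p \<in> Ps m" unfolding prod_seminorms_def by blast
    show "cont_seminorm (Es n) (Ps n) (\<lambda>x. r (sum_injection n x))"
    proof (cases "m = n")
      case True
      then show ?thesis unfolding r(1) sum_injection_apply using cont_seminorm_member[OF Es[OF n]] r(3) by simp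
    next
      case False
      have "p 0 = 0" using seminorm_on_zero[OF sub[OF r(2)] lc_family_seminorm[OF Es[OF r(2)] r(3)]] .
      then show ?thesis unfolding r(1) sum_injection_apply using False cont_seminorm_const_zero by simp
    qed
  qed
  then show ?thesis
    using continuous_map_lc_imp_cont_seminorm[OF Es[OF n] lc_family_prod linear_on_sum_injection img _ q] by blast
qed

lemma lc_bounded_prod_iff:
  "lc_bounded (prod_carrier I Es) (prod_seminorms I Ps) B \<longleftrightarrow>
    B \<subseteq> prod_carrier I Es \<and> (\<forall>n\<in>I. lc_bounded (Es n) (Ps n) ((\<lambda>x. x n) ` B))"
proof (intro iffI conjI ballI)
  assume B: "lc_bounded (prod_carrier I Es) (prod_seminorms I Ps) B"
  show BE: "B \<subseteq> prod_carrier I Es" using lc_bounded_carrier[OF B] .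
  fix n assume n: "n \<in> I"
  show "lc_bounded (Es n) (Ps n) ((\<lambda>x. x n) ` B)"
  proof (rule lc_boundedI[OF Es[OF n]])
    show "(\<lambda>x. x n) ` B \<subseteq> Es n" using BE prod_mem n by blast
    fix p assume "p \<in> Ps n"
    then have "cont_seminorm (prod_carrier I Es) (prod_seminorms I Ps) (\<lambda>x. p (x n))"
      using cont_seminorm_prod_coordinate[OF n] cont_seminorm_member[OF Es[OF n]] by blast
    from lc_boundedD[OF lc_family_prod B this] show "\<exists>C. \<forall>v\<in>(\<lambda>x. x n) ` B. p v \<le> C" by auto
  qed
next
  assume B: "B \<subseteq> prod_carrier I Es \<and> (\<forall>n\<in>I. lc_bounded (Es n) (Ps n) ((\<lambda>x. x n) ` B))"
  show "lc_bounded (prod_carrier I Es) (prod_seminorms I Ps) B"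
  proof (rule lc_boundedI[OF lc_family_prod])
    show "B \<subseteq> prod_carrier I Es" using B by blast
    fix r assume "r \<in> prod_seminorms I Ps"
    then obtain n p where r: "r = (\<lambda>x. p (x n))" "n \<in> I" "p \<in> Ps n" unfolding prod_seminorms_def by blast
    have "lc_bounded (Es n) (Ps n) ((\<lambda>x. x n) ` B)" using B r(2) by blast
    from lc_boundedD[OF Es[OF r(2)] this cont_seminorm_member[OF Es[OF r(2)] r(3)]]
    show "\<exists>C. \<forall>x\<in>B. r x \<le> C" unfolding r(1) by auto
  qed
qed

lemma fundamental_bounded_resolution_prod:
  "fundamental_bounded_resolution (prod_carrier I Es) (prod_seminorms I Ps)"
proof -
  obtain A where A': "\<forall>n\<in>I. resolution (Es n) (A n) \<and> (\<forall>\<alpha>. lc_bounded (Es n) (Ps n) (A n \<alpha>)) \<and>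
     (\<forall>B. lc_bounded (Es n) (Ps n) B \<longrightarrow> (\<exists>\<alpha>. B \<subseteq> A n \<alpha>))"
    using bounded_resolutions by (elim exE)
  have A: "\<And>n. n \<in> I \<Longrightarrow> resolution (Es n) (A n)" "\<And>n \<alpha>. n \<in> I \<Longrightarrow> lc_bounded (Es n) (Ps n) (A n \<alpha>)"
    "\<And>n B. n \<in> I \<Longrightarrow> lc_bounded (Es n) (Ps n) B \<Longrightarrow> \<exists>\<alpha>. B \<subseteq> A n \<alpha>"
    using A' by simp_all
  define G where "G \<alpha> = {x\<in>prod_carrier I Es. \<forall>n\<in>I. x n \<in> A n (coded_row \<alpha> n)}" for \<alpha>
  have bdd: "lc_bounded (prod_carrier I Es) (prod_seminorms I Ps) (G \<alpha>)" for \<alpha>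
    unfolding lc_bounded_prod_iff
  proof (intro conjI ballI)
    show "G \<alpha> \<subseteq> prod_carrier I Es" unfolding G_def by blast
    show "lc_bounded (Es n) (Ps n) ((\<lambda>x. x n) ` G \<alpha>)" if "n \<in> I" for n
      by (rule lc_bounded_subset[OF A(2)[OF that, of "coded_row \<alpha> n"]]) (use that in \<open>auto simp: G_def\<close>)
  qed
  have fund: "\<exists>\<alpha>. B \<subseteq> G \<alpha>" if B: "lc_bounded (prod_carrier I Es) (prod_seminorms I Ps) B" for B
  proof -
    have "\<forall>n\<in>I. \<exists>\<alpha>. (\<lambda>x. x n) ` B \<subseteq> A n \<alpha>"
      using A(3) B unfolding lc_bounded_prod_iff by blast
    from bchoice[OF this] obtain a where a: "\<forall>n\<in>I. (\<lambda>x. x n) ` B \<subseteq> A n (a n)" by (elim exE)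
    obtain \<alpha> where \<alpha>: "\<And>n. coded_row \<alpha> n = a n" using coded_row_exists[of 0 a] by metis
    have "B \<subseteq> G \<alpha>" unfolding G_def \<alpha> using a lc_bounded_carrier[OF B] by auto
    then show ?thesis by blast
  qed
  have "resolution (prod_carrier I Es) G"
  proof (rule resolutionI)
    show "G \<alpha> \<subseteq> prod_carrier I Es" for \<alpha> unfolding G_def by blast
    show "\<exists>\<alpha>. x \<in> G \<alpha>" if "x \<in> prod_carrier I Es" for x
      using fund[OF lc_bounded_singleton[OF lc_family_prod that]] by simp
    show "G \<alpha> \<subseteq> G \<beta>" if "\<alpha> \<le> \<beta>" for \<alpha> \<beta>
      unfolding G_def using resolution_mono[OF A(1) coded_row_mono[OF that]] by auto
  qed
  then show ?thesis
    unfolding fundamental_bounded_resolution_def using bdd fund by (intro exI[of _ G] conjI allI impI)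
qed

lemma dual_prod_injection:
  assumes f: "f \<in> lc_dual (prod_carrier I Es) (prod_seminorms I Ps)" and n: "n \<in> I"
  shows "(\<lambda>v. f (sum_injection n v)) \<in> lc_dual (Es n) (Ps n)"
proof -
  obtain q where q: "cont_seminorm (prod_carrier I Es) (prod_seminorms I Ps) q"
    "\<forall>x\<in>prod_carrier I Es. \<bar>f x\<bar> \<le> q x" and lin: "linear_on (prod_carrier I Es) f"
    and out: "\<forall>x. x \<notin> prod_carrier I Es \<longrightarrow> f x = 0"
    using f unfolding lc_dual_iff[OF lc_family_prod] by blast
  note mem = sum_injection_mem_prod[OF zero_mem n]
  have "linear_on (Es n) (\<lambda>v. f (sum_injection n v))"
    using mem by (intro linear_on_comp[OF lin linear_on_sum_injection]) auto
  moreover have "f (sum_injection n v) = 0" if "v \<notin> Es n" for v using out mem that by blast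
  moreover have "\<bar>f (sum_injection n v)\<bar> \<le> q (sum_injection n v)" if "v \<in> Es n" for v using q(2) mem that by blast
  ultimately show ?thesis
    unfolding lc_dual_iff[OF Es[OF n]] using cont_seminorm_prod_injection[OF n q(1)]
    by (intro conjI exI[of _ "\<lambda>v. q (sum_injection n v)"]) auto
qed

text \<open>The dominating seminorm involves finitely many generators, each reading one coordinate;
  where these coordinates vanish the bound is zero.\<close>

lemma dual_prod_finitely_many_coordinates:
  assumes f: "f \<in> lc_dual (prod_carrier I Es) (prod_seminorms I Ps)"
  shows "\<exists>N. \<forall>x\<in>prod_carrier I Es. (\<forall>n\<le>N. x n = 0) \<longrightarrow> f x = 0"
proof -
  obtain q where q: "cont_seminorm (prod_carrier I Es) (prod_seminorms I Ps) q"
    "\<forall>x\<in>prod_carrier I Es. \<bar>f x\<bar> \<le> q x"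
    using f unfolding lc_dual_iff[OF lc_family_prod] by blast
  obtain F C where F: "finite F" "F \<subseteq> prod_seminorms I Ps" "\<forall>x\<in>prod_carrier I Es. q x \<le> C * (\<Sum>p\<in>F. p x)"
    using q(1) unfolding cont_seminorm_def by blast
  have "\<forall>r\<in>F. \<exists>n. \<forall>x\<in>prod_carrier I Es. x n = 0 \<longrightarrow> r x = 0"
  proof
    fix r assume "r \<in> F"
    then obtain n p where r: "r = (\<lambda>x. p (x n))" "n \<in> I" "p \<in> Ps n"
      using F(2) unfolding prod_seminorms_def by blast
    have "p 0 = 0" using seminorm_on_zero[OF sub[OF r(2)] lc_family_seminorm[OF Es[OF r(2)] r(3)]] .
    then show "\<exists>n. \<forall>x\<in>prod_carrier I Es. x n = 0 \<longrightarrow> r x = 0" unfolding r(1) by (intro exI[of _ n]) simp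
  qed
  from bchoice[OF this] obtain n where n: "\<forall>r\<in>F. \<forall>x\<in>prod_carrier I Es. x (n r) = 0 \<longrightarrow> r x = 0" by (elim exE)
  obtain N where N: "\<And>r. r \<in> F \<Longrightarrow> n r \<le> N" using finite_nat_set_iff_bounded_le[of "n ` F"] F(1) by auto
  have "f x = 0" if x: "x \<in> prod_carrier I Es" "\<forall>n\<le>N. x n = 0" for x
  proof -
    have "(\<Sum>p\<in>F. p x) = 0" using n N x by (intro sum.neutral) auto
    then have "q x \<le> 0" using F(3) x(1) by force
    then show ?thesis using bspec[OF q(2) x(1)] by linarith
  qed
  then show ?thesis by blast
qed

text \<open>The difference between \<open>x\<close> and its truncation vanishes in the coordinates
  up to \<open>N\<close>, so \<open>f\<close> annihilates it.\<close>

lemma dual_prod_expansion: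
  assumes f: "linear_on (prod_carrier I Es) f"
    and N: "\<forall>x\<in>prod_carrier I Es. (\<forall>n\<le>N. x n = 0) \<longrightarrow> f x = 0" and x: "x \<in> prod_carrier I Es"
  shows "f x = (\<Sum>n\<in>I \<inter> {..N}. f (sum_injection n (x n)))"
proof -
  let ?E = "prod_carrier I Es"
  have subE: "subspace ?E" using lc_family_subspace[OF lc_family_prod] .
  have mem: "sum_injection n (x n) \<in> ?E" if "n \<in> I \<inter> {..N}" for n
    using sum_injection_mem_prod[OF zero_mem, of n "x n"] prod_mem[OF x] that by blast
  let ?y = "\<Sum>n\<in>I \<inter> {..N}. sum_injection n (x n)"
  have yE: "?y \<in> ?E" using mem by (intro subspace_sum[OF subE])
  have "?y m = x m" if "m \<le> N" for m
  proof -
    have "?y m = (\<Sum>n\<in>I \<inter> {..N}. if m = n then x n else 0)"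
      by (simp add: sum_fun_apply sum_injection_def)
    also have "\<dots> = (if m \<in> I \<inter> {..N} then x m else 0)" by (simp add: sum.delta')
    also have "\<dots> = x m" using that x by (auto simp: prod_carrier_def dest: spec[of _ m])
    finally show ?thesis .
  qed
  then have "f (x - ?y) = 0" using N subspace_diff[OF subE x yE] by simp
  then have "f x = f ?y" using linear_on_diff[OF f subE x yE] by simp
  also have "\<dots> = (\<Sum>n\<in>I \<inter> {..N}. f (sum_injection n (x n)))" using linear_on_sum[OF f subE mem] .
  finally show ?thesis .
qed

lemma class_G_prod: "class_G (prod_carrier I Es) (prod_seminorms I Ps)"
proof -
  let ?E = "prod_carrier I Es" and ?P = "prod_seminorms I Ps"
  obtain A where A': "\<forall>n\<in>I. resolution (lc_dual (Es n) (Ps n)) (A n) \<and>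
     (\<forall>\<alpha> (s :: nat \<Rightarrow> 'a \<Rightarrow> real). range s \<subseteq> A n \<alpha> \<longrightarrow>
       (\<exists>q. cont_seminorm (Es n) (Ps n) q \<and> (\<forall>i. \<forall>x\<in>Es n. \<bar>s i x\<bar> \<le> q x)))"
    using dual_resolutions by (elim exE)
  have A: "\<And>n. n \<in> I \<Longrightarrow> resolution (lc_dual (Es n) (Ps n)) (A n)"
    and eq: "\<And>n \<alpha> (s :: nat \<Rightarrow> 'a \<Rightarrow> real). n \<in> I \<Longrightarrow> range s \<subseteq> A n \<alpha> \<Longrightarrow>
       \<exists>q. cont_seminorm (Es n) (Ps n) q \<and> (\<forall>i. \<forall>x\<in>Es n. \<bar>s i x\<bar> \<le> q x)"
    using A' by simp_all
  \<comment> \<open>Entry \<open>0\<close> caps the coordinates on which \<open>f\<close> depends,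
    uniformly over the member; the rows control the components of \<open>f\<close>.\<close>
  define G where "G \<alpha> = {f\<in>lc_dual ?E ?P. (\<forall>x\<in>?E. (\<forall>n\<le>\<alpha> 0. x n = 0) \<longrightarrow> f x = 0) \<and>
      (\<forall>n\<in>I. (\<lambda>v. f (sum_injection n v)) \<in> A n (coded_row \<alpha> n))}" for \<alpha>
  have "resolution (lc_dual ?E ?P) G"
  proof (rule resolutionI)
    show "G \<alpha> \<subseteq> lc_dual ?E ?P" for \<alpha> unfolding G_def by blast
    show "\<exists>\<alpha>. f \<in> G \<alpha>" if f: "f \<in> lc_dual ?E ?P" for f
    proof -
      obtain N where N: "\<forall>x\<in>?E. (\<forall>n\<le>N. x n = 0) \<longrightarrow> f x = 0"
        using dual_prod_finitely_many_coordinates[OF f] by (elim exE)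
      have "\<forall>n\<in>I. \<exists>\<alpha>. (\<lambda>v. f (sum_injection n v)) \<in> A n \<alpha>"
        using resolution_cover[OF A dual_prod_injection[OF f]] by blast
      from bchoice[OF this] obtain a where a: "\<forall>n\<in>I. (\<lambda>v. f (sum_injection n v)) \<in> A n (a n)" by (elim exE)
      obtain \<alpha> where \<alpha>: "\<alpha> 0 = N" "\<And>n. coded_row \<alpha> n = a n" using coded_row_exists[of N a] by metis
      have "f \<in> G \<alpha>" unfolding G_def \<alpha> using f N a by simp
      then show ?thesis by blast
    qed
    show "G \<alpha> \<subseteq> G \<beta>" if le: "\<alpha> \<le> \<beta>" for \<alpha> \<beta>
    proof
      fix f assume f: "f \<in> G \<alpha>"
      have "f x = 0" if "x \<in> ?E" "\<forall>n\<le>\<beta> 0. x n = 0" for x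
        using f that le_funD[OF le, of 0] unfolding G_def by auto
      moreover have "(\<lambda>v. f (sum_injection n v)) \<in> A n (coded_row \<beta> n)" if "n \<in> I" for n
        using f that resolution_mono[OF A[OF that] coded_row_mono[OF le]] unfolding G_def by auto
      ultimately show "f \<in> G \<beta>" using f unfolding G_def by simp
    qed
  qed
  moreover have "equicontinuous ?E ?P (range s)" if s: "range s \<subseteq> G \<alpha>" for \<alpha> and s :: "nat \<Rightarrow> (nat \<Rightarrow> 'a) \<Rightarrow> real"
  proof -
    have sG: "s i \<in> G \<alpha>" for i using s by auto
    have lin: "linear_on ?E (s i)" for i using sG[of i] lc_dual_linear unfolding G_def by blast
    have "\<forall>n\<in>I. \<exists>q. cont_seminorm (Es n) (Ps n) q \<and> (\<forall>i. \<forall>v\<in>Es n. \<bar>s i (sum_injection n v)\<bar> \<le> q v)"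
    proof
      fix n assume n: "n \<in> I"
      show "\<exists>q. cont_seminorm (Es n) (Ps n) q \<and> (\<forall>i. \<forall>v\<in>Es n. \<bar>s i (sum_injection n v)\<bar> \<le> q v)"
        using eq[OF n, of "\<lambda>i v. s i (sum_injection n v)" "coded_row \<alpha> n"] sG n unfolding G_def by auto
    qed
    from bchoice[OF this] obtain q where q: "\<And>n. n \<in> I \<Longrightarrow> cont_seminorm (Es n) (Ps n) (q n)"
      "\<And>n i v. n \<in> I \<Longrightarrow> v \<in> Es n \<Longrightarrow> \<bar>s i (sum_injection n v)\<bar> \<le> q n v" by auto
    \<comment> \<open>The common cap makes this a fixed finite sum, which is what keeps it
      continuous on the product.\<close>
    define r where "r x = (\<Sum>n\<in>I \<inter> {..\<alpha> 0}. q n (x n))" for x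
    have "cont_seminorm ?E ?P r"
      unfolding r_def using q(1)
      by (intro cont_seminorm_sum lc_family_prod cont_seminorm_prod_coordinate) auto
    moreover have "\<bar>s i x\<bar> \<le> r x" if x: "x \<in> ?E" for i x
    proof -
      have "s i x = (\<Sum>n\<in>I \<inter> {..\<alpha> 0}. s i (sum_injection n (x n)))"
        using sG[of i] unfolding G_def by (intro dual_prod_expansion[OF lin _ x]) blast
      also have "\<bar>\<dots>\<bar> \<le> (\<Sum>n\<in>I \<inter> {..\<alpha> 0}. \<bar>s i (sum_injection n (x n))\<bar>)" by (rule sum_abs)
      also have "\<dots> \<le> r x" unfolding r_def using q(2) prod_mem[OF x] by (intro sum_mono) auto
      finally show ?thesis .
    qed
    ultimately show ?thesis using lin by (intro equicontinuousI[OF lc_family_prod]) auto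
  qed
  ultimately show ?thesis unfolding class_G_def by (intro exI[of _ G]) auto
qed

lemma quasi_DF_prod: "quasi_DF (prod_carrier I Es) (prod_seminorms I Ps)"
  unfolding quasi_DF_def using fundamental_bounded_resolution_prod class_G_prod by blast

end

subsection \<open>Direct sums\<close>

text \<open>The direct sum topology is specified through its universal property
  \<open>final_lc\<close>; \<open>Q\<close> is any separated family of seminorms inducing
  it.\<close>

locale lc_direct_sum = lc_sequence I Es Ps
  for I :: "nat set" and Es :: "nat \<Rightarrow> 'a::real_vector set" and Ps +
  fixes Q
  assumes lcs_sum: "Defs.lcs (sum_carrier I Es) Q"
    and final: "final_lc (sum_carrier I Es) Q I Es Ps sum_injection"
begin

abbreviation "S \<equiv> sum_carrier I Es"

lemma S: "lc_family S Q"
  using lcs_sum lcs_imp_lc_family by blast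

lemma subS: "subspace S"
  using S lc_family_subspace by blast

lemma sum_mem: "x \<in> S \<Longrightarrow> n \<in> I \<Longrightarrow> x n \<in> Es n"
  using sum_carrier_subset prod_mem by blast

lemma sum_outside: "x \<in> S \<Longrightarrow> n \<notin> I \<Longrightarrow> x n = 0"
  by (auto simp: sum_carrier_def dest: spec[of _ n])

lemma sum_finite: "x \<in> S \<Longrightarrow> finite {n. x n \<noteq> 0}"
  by (simp add: sum_carrier_def)

lemma injection_mem: "n \<in> I \<Longrightarrow> sum_injection n v \<in> S \<longleftrightarrow> v \<in> Es n"
  using sum_injection_mem_sum[OF zero_mem] .

lemma cont_seminorm_injection:
  "n \<in> I \<Longrightarrow> cont_seminorm S Q q \<Longrightarrow> cont_seminorm (Es n) (Ps n) (\<lambda>v. q (sum_injection n v))"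
  using final_lc_comp_cont_seminorm[OF S final _ Es] by blast

lemma cont_seminormI:
  assumes "seminorm_on S q" "\<And>n. n \<in> I \<Longrightarrow> cont_seminorm (Es n) (Ps n) (\<lambda>v. q (sum_injection n v))"
  shows "cont_seminorm S Q q"
  using final_lc_cont_seminorm[OF S final Es] assms by blast

lemma seminorm_on_coordinate:
  assumes n: "n \<in> I" and p: "seminorm_on (Es n) p"
  shows "seminorm_on S (\<lambda>x. p (x n))"
  by (rule seminorm_on_comp[OF p]) (use sum_mem n in \<open>auto simp: linear_on_def scaleR_fun_def\<close>)

text \<open>Every weighted sum of coordinate seminorms is continuous on the direct sum, whatever the
  weights; this forces bounded sets into finitely many coordinates.\<close>

lemma cont_seminorm_weighted_sum:
  assumes p: "\<And>n. n \<in> I \<Longrightarrow> cont_seminorm (Es n) (Ps n) (p n)"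
  shows "cont_seminorm S Q (\<lambda>x. \<Sum>n\<in>{n\<in>I. x n \<noteq> 0}. p n (x n))"
proof (rule cont_seminormI)
  have p0: "p n 0 = 0" if "n \<in> I" for n
    using seminorm_on_zero[OF sub[OF that] cont_seminorm_seminorm[OF p[OF that]]] .
  have fin: "finite {n\<in>I. x n \<noteq> 0}" if "x \<in> S" for x
    using sum_finite[OF that] by (rule rev_finite_subset) auto
  \<comment> \<open>The support varies with \<open>x\<close>; since \<open>p n 0 = 0\<close>, sums
    may be taken over any larger finite set, so \<open>x\<close>, \<open>y\<close> and
    \<open>x + y\<close> can be compared over one index set.\<close>
  have extend: "(\<Sum>n\<in>{n\<in>I. x n \<noteq> 0}. p n (x n)) = (\<Sum>n\<in>F. p n (x n))"
    if "finite F" "F \<subseteq> I" "{n\<in>I. x n \<noteq> 0} \<subseteq> F" for x F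
    using that p0 by (intro sum.mono_neutral_left) auto
  show "seminorm_on S (\<lambda>x. \<Sum>n\<in>{n\<in>I. x n \<noteq> 0}. p n (x n))"
    unfolding seminorm_on_def
  proof (intro conjI ballI allI)
    fix x y assume x: "x \<in> S" and y: "y \<in> S"
    let ?F = "{n\<in>I. x n \<noteq> 0} \<union> {n\<in>I. y n \<noteq> 0}"
    have F: "finite ?F" "?F \<subseteq> I" using fin[OF x] fin[OF y] by auto
    have "(\<Sum>n\<in>?F. p n ((x + y) n)) \<le> (\<Sum>n\<in>?F. p n (x n) + p n (y n))"
      using seminorm_on_triangle[OF cont_seminorm_seminorm[OF p]] sum_mem[OF x] sum_mem[OF y]
      by (intro sum_mono) auto
    moreover have "{n\<in>I. (x + y) n \<noteq> 0} \<subseteq> ?F" by auto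
    ultimately show "(\<Sum>n\<in>{n\<in>I. (x + y) n \<noteq> 0}. p n ((x + y) n)) \<le>
        (\<Sum>n\<in>{n\<in>I. x n \<noteq> 0}. p n (x n)) + (\<Sum>n\<in>{n\<in>I. y n \<noteq> 0}. p n (y n))"
      using extend[OF F, of x] extend[OF F, of y] extend[OF F, of "x + y"] by (auto simp: sum.distrib)
  next
    fix x c assume x: "x \<in> S"
    let ?F = "{n\<in>I. x n \<noteq> 0}"
    have "(\<Sum>n\<in>?F. p n ((c *\<^sub>R x) n)) = (\<Sum>n\<in>?F. \<bar>c\<bar> * p n (x n))"
      using seminorm_on_scale[OF cont_seminorm_seminorm[OF p]] sum_mem[OF x]
      by (intro sum.cong) (auto simp: scaleR_fun_def)
    then show "(\<Sum>n\<in>{n\<in>I. (c *\<^sub>R x) n \<noteq> 0}. p n ((c *\<^sub>R x) n)) = \<bar>c\<bar> * (\<Sum>n\<in>?F. p n (x n))"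
      using extend[OF fin[OF x], of "c *\<^sub>R x"] by (auto simp: sum_distrib_left scaleR_fun_def)
  qed
  fix n assume n: "n \<in> I"
  have "(\<Sum>m\<in>{m\<in>I. sum_injection n v m \<noteq> 0}. p m (sum_injection n v m)) = p n v" for v
  proof -
    have "{m\<in>I. sum_injection n v m \<noteq> 0} \<subseteq> {n}" by (auto simp: sum_injection_apply)
    from extend[OF _ _ this] show ?thesis using n by (simp add: sum_injection_apply)
  qed
  then show "cont_seminorm (Es n) (Ps n) (\<lambda>v. \<Sum>m\<in>{m\<in>I. sum_injection n v m \<noteq> 0}. p m (sum_injection n v m))"
    using p[OF n] by simp
qed

text \<open>A seminorm of one coordinate is continuous on the sum, because on each summand it is
  either itself or zero.\<close>

lemma bounded_coordinate:
  assumes B: "lc_bounded S Q B" and n: "n \<in> I"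
  shows "lc_bounded (Es n) (Ps n) ((\<lambda>x. x n) ` B)"
proof (rule lc_boundedI[OF Es[OF n]])
  show "(\<lambda>x. x n) ` B \<subseteq> Es n" using lc_bounded_carrier[OF B] sum_mem n by blast
  fix p assume p: "p \<in> Ps n"
  have "cont_seminorm S Q (\<lambda>x. p (x n))"
  proof (rule cont_seminormI[OF seminorm_on_coordinate[OF n lc_family_seminorm[OF Es[OF n] p]]])
    fix m assume m: "m \<in> I"
    have "p 0 = 0" using seminorm_on_zero[OF sub[OF n] lc_family_seminorm[OF Es[OF n] p]] .
    then show "cont_seminorm (Es m) (Ps m) (\<lambda>v. p (sum_injection m v n))"
      using cont_seminorm_member[OF Es[OF n] p] cont_seminorm_const_zero
      by (cases "m = n") (simp_all add: sum_injection_def)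
  qed
  from lc_boundedD[OF S B this] show "\<exists>C. \<forall>v\<in>(\<lambda>x. x n) ` B. p v \<le> C" by auto
qed

text \<open>If \<open>B\<close> met infinitely many coordinates, a weighted sum of coordinate
  seminorms would be continuous and yet unbounded on \<open>B\<close>.\<close>

lemma bounded_finitely_many_coordinates:
  assumes B: "lc_bounded S Q B"
  shows "\<exists>N. \<forall>x\<in>B. \<forall>n>N. x n = 0"
proof (rule ccontr)
  assume no: "\<not> ?thesis"
  define J where "J = {n. \<exists>x\<in>B. x n \<noteq> 0}"
  have BS: "B \<subseteq> S" using lc_bounded_carrier[OF B] .
  have JI: "J \<subseteq> I" using BS sum_outside unfolding J_def by blast
  have "\<exists>n>N. n \<in> J" for N
  proof -
    have "\<not> (\<forall>x\<in>B. \<forall>n>N. x n = 0)" using no by blast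
    then show ?thesis unfolding J_def by auto
  qed
  have "\<forall>n\<in>J. \<exists>x. x \<in> B \<and> x n \<noteq> 0" unfolding J_def by auto
  from bchoice[OF this] obtain x where x: "\<And>n. n \<in> J \<Longrightarrow> x n \<in> B" "\<And>n. n \<in> J \<Longrightarrow> x n n \<noteq> 0" by auto
  \<comment> \<open>The Hausdorff property contained in \<open>lcs\<close> supplies a seminorm not
    vanishing at the chosen nonzero coordinate.\<close>
  have "\<forall>n\<in>J. \<exists>p. p \<in> Ps n \<and> p (x n n) \<noteq> 0"
  proof
    fix n assume n: "n \<in> J"
    then have "x n n \<in> Es n" using sum_mem BS x(1) JI by blast
    then show "\<exists>p. p \<in> Ps n \<and> p (x n n) \<noteq> 0" using lcs[of n] n JI x(2)[OF n] unfolding lcs_def by blast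
  qed
  from bchoice[OF this] obtain p where p: "\<And>n. n \<in> J \<Longrightarrow> p n \<in> Ps n" "\<And>n. n \<in> J \<Longrightarrow> p n (x n n) \<noteq> 0" by auto
  have pos: "0 < p n (x n n)" if n: "n \<in> J" for n
  proof -
    have "n \<in> I" "x n n \<in> Es n" using sum_mem BS x(1) JI n by blast+
    then have "0 \<le> p n (x n n)" using seminorm_on_nonneg[OF sub lc_family_seminorm[OF Es p(1)[OF n]]] by blast
    then show ?thesis using p(2)[OF n] by simp
  qed
  \<comment> \<open>The weight is chosen so that \<open>r n (x n n) = real n\<close>.\<close>
  define r where "r n v = (if n \<in> J then real n / p n (x n n) * p n v else 0)" for n v
  have r: "cont_seminorm (Es n) (Ps n) (r n)" if n: "n \<in> I" for n
  proof (cases "n \<in> J")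
    case True
    then have "r n = (\<lambda>v. real n / p n (x n n) * p n v)" by (simp add: r_def fun_eq_iff)
    then show ?thesis
      using cont_seminorm_mult[OF cont_seminorm_member[OF Es[OF n] p(1)[OF True]], of "real n / p n (x n n)"] pos[OF True]
      by simp
  next
    case False
    then have "r n = (\<lambda>v. 0)" by (simp add: r_def fun_eq_iff)
    then show ?thesis using cont_seminorm_const_zero by simp
  qed
  from lc_boundedD[OF S B cont_seminorm_weighted_sum[OF r]]
  obtain C where C: "\<forall>y\<in>B. (\<Sum>n\<in>{n\<in>I. y n \<noteq> 0}. r n (y n)) \<le> C" by auto
  have "real n \<le> C" if n: "n \<in> J" for n
  proof -
    have xS: "x n \<in> S" using x(1)[OF n] BS by blast
    have "real n = r n (x n n)" using pos[OF n] n by (simp add: r_def)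
    also have "\<dots> \<le> (\<Sum>m\<in>{m\<in>I. x n m \<noteq> 0}. r m (x n m))"
    proof (rule member_le_sum)
      show "n \<in> {m\<in>I. x n m \<noteq> 0}" using n JI x(2)[OF n] by auto
      show "finite {m\<in>I. x n m \<noteq> 0}" using sum_finite[OF xS] by (rule rev_finite_subset) auto
      fix m assume "m \<in> {m\<in>I. x n m \<noteq> 0} - {n}"
      then have m: "m \<in> I" by auto
      show "0 \<le> r m (x n m)" using seminorm_on_nonneg[OF sub[OF m] cont_seminorm_seminorm[OF r[OF m]] sum_mem[OF xS m]] .
    qed
    also have "\<dots> \<le> C" using C x(1)[OF n] by blast
    finally show ?thesis .
  qed
  moreover obtain n where "n > nat \<lceil>C\<rceil>" "n \<in> J" using \<open>\<And>N. \<exists>n>N. n \<in> J\<close> by blast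
  ultimately have "real n \<le> C" "n > nat \<lceil>C\<rceil>" by auto
  then show False using real_nat_ceiling_ge[of C] by linarith
qed

lemma fundamental_bounded_resolution_sum: "fundamental_bounded_resolution S Q"
proof -
  obtain A where A': "\<forall>n\<in>I. resolution (Es n) (A n) \<and> (\<forall>\<alpha>. lc_bounded (Es n) (Ps n) (A n \<alpha>)) \<and>
     (\<forall>B. lc_bounded (Es n) (Ps n) B \<longrightarrow> (\<exists>\<alpha>. B \<subseteq> A n \<alpha>))"
    using bounded_resolutions by (elim exE)
  have A: "\<And>n. n \<in> I \<Longrightarrow> resolution (Es n) (A n)" "\<And>n \<alpha>. n \<in> I \<Longrightarrow> lc_bounded (Es n) (Ps n) (A n \<alpha>)"
    "\<And>n B. n \<in> I \<Longrightarrow> lc_bounded (Es n) (Ps n) B \<Longrightarrow> \<exists>\<alpha>. B \<subseteq> A n \<alpha>"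
    using A' by simp_all
  \<comment> \<open>The cut-off in entry \<open>0\<close> makes every element a sum of boundedly
    many injected coordinates, so a seminorm on the sum is bounded by finitely many
    constants.\<close>
  define G where "G \<alpha> = {x\<in>S. (\<forall>n>\<alpha> 0. x n = 0) \<and> (\<forall>n\<in>I. x n \<in> A n (coded_row \<alpha> n))}" for \<alpha>
  have bdd: "lc_bounded S Q (G \<alpha>)" for \<alpha>
  proof (rule lc_boundedI[OF S])
    show "G \<alpha> \<subseteq> S" unfolding G_def by blast
    fix p assume p: "p \<in> Q"
    let ?F = "I \<inter> {..\<alpha> 0}"
    have "\<forall>n\<in>?F. \<exists>C. \<forall>v\<in>A n (coded_row \<alpha> n). p (sum_injection n v) \<le> C"
    proof
      fix n assume "n \<in> ?F"
      then have n: "n \<in> I" by auto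
      from lc_boundedD[OF Es[OF n] A(2)[OF n] cont_seminorm_injection[OF n cont_seminorm_member[OF S p]]]
      show "\<exists>C. \<forall>v\<in>A n (coded_row \<alpha> n). p (sum_injection n v) \<le> C" by blast
    qed
    from bchoice[OF this] obtain C where C: "\<forall>n\<in>?F. \<forall>v\<in>A n (coded_row \<alpha> n). p (sum_injection n v) \<le> C n" by (elim exE)
    have "p x \<le> (\<Sum>n\<in>?F. C n)" if x: "x \<in> G \<alpha>" for x
    proof -
      have xS: "x \<in> S" and x0: "\<And>n. n > \<alpha> 0 \<Longrightarrow> x n = 0" and xA: "\<And>n. n \<in> I \<Longrightarrow> x n \<in> A n (coded_row \<alpha> n)"
        using x unfolding G_def by auto
      have "x n = 0" if "n \<notin> ?F" for n using that sum_outside[OF xS] x0 by (cases "n \<in> I") auto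
      then have "x = (\<Sum>n\<in>?F. sum_injection n (x n))" by (intro sum_of_injections) auto
      then have "p x = p (\<Sum>n\<in>?F. sum_injection n (x n))" by (rule arg_cong)
      also have "\<dots> \<le> (\<Sum>n\<in>?F. p (sum_injection n (x n)))"
        using injection_mem sum_mem[OF xS] by (intro seminorm_on_sum_le[OF lc_family_seminorm[OF S p] subS]) auto
      also have "\<dots> \<le> (\<Sum>n\<in>?F. C n)" using C xA by (intro sum_mono) auto
      finally show ?thesis .
    qed
    then show "\<exists>C. \<forall>x\<in>G \<alpha>. p x \<le> C" by blast
  qed
  have fund: "\<exists>\<alpha>. B \<subseteq> G \<alpha>" if B: "lc_bounded S Q B" for B
  proof -
    obtain N where N: "\<forall>x\<in>B. \<forall>n>N. x n = 0" using bounded_finitely_many_coordinates[OF B] by (elim exE)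
    have "\<forall>n\<in>I. \<exists>\<alpha>. (\<lambda>x. x n) ` B \<subseteq> A n \<alpha>"
      using A(3) bounded_coordinate[OF B] by blast
    from bchoice[OF this] obtain a where a: "\<forall>n\<in>I. (\<lambda>x. x n) ` B \<subseteq> A n (a n)" by (elim exE)
    obtain \<alpha> where \<alpha>: "\<alpha> 0 = N" "\<And>n. coded_row \<alpha> n = a n" using coded_row_exists[of N a] by metis
    have "B \<subseteq> G \<alpha>" unfolding G_def \<alpha> using N a lc_bounded_carrier[OF B] by (auto simp: image_subset_iff)
    then show ?thesis by blast
  qed
  have "resolution S G"
  proof (rule resolutionI)
    show "G \<alpha> \<subseteq> S" for \<alpha> unfolding G_def by blast
    show "\<exists>\<alpha>. x \<in> G \<alpha>" if "x \<in> S" for x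
      using fund[OF lc_bounded_singleton[OF S that]] by simp
    show "G \<alpha> \<subseteq> G \<beta>" if le: "\<alpha> \<le> \<beta>" for \<alpha> \<beta>
      unfolding G_def using subsetD[OF resolution_mono[OF A(1) coded_row_mono[OF le]]] le_funD[OF le, of 0]
      by auto
  qed
  then show ?thesis
    unfolding fundamental_bounded_resolution_def using bdd fund by (intro exI[of _ G] conjI allI impI)
qed

lemma dual_sum_injection:
  assumes f: "f \<in> lc_dual S Q" and n: "n \<in> I"
  shows "(\<lambda>v. f (sum_injection n v)) \<in> lc_dual (Es n) (Ps n)"
proof -
  obtain q where q: "cont_seminorm S Q q" "\<forall>x\<in>S. \<bar>f x\<bar> \<le> q x" and lin: "linear_on S f"
    and out: "\<forall>x. x \<notin> S \<longrightarrow> f x = 0"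
    using f unfolding lc_dual_iff[OF S] by blast
  note mem = injection_mem[OF n]
  have "linear_on (Es n) (\<lambda>v. f (sum_injection n v))"
    using mem by (intro linear_on_comp[OF lin linear_on_sum_injection]) auto
  moreover have "f (sum_injection n v) = 0" if "v \<notin> Es n" for v using out mem that by blast
  moreover have "\<bar>f (sum_injection n v)\<bar> \<le> q (sum_injection n v)" if "v \<in> Es n" for v using q(2) mem that by blast
  ultimately show ?thesis
    unfolding lc_dual_iff[OF Es[OF n]] using cont_seminorm_injection[OF n q(1)]
    by (intro conjI exI[of _ "\<lambda>v. q (sum_injection n v)"]) auto
qed

text \<open>A functional on the sum may have infinitely many nonzero components, and rows alone
  index it. The infinitely many coordinate bounds combine into one continuous seminorm by
  \<open>cont_seminorm_weighted_sum\<close>.\<close>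

lemma class_G_sum: "class_G S Q"
proof -
  obtain A where A': "\<forall>n\<in>I. resolution (lc_dual (Es n) (Ps n)) (A n) \<and>
     (\<forall>\<alpha> (s :: nat \<Rightarrow> 'a \<Rightarrow> real). range s \<subseteq> A n \<alpha> \<longrightarrow>
       (\<exists>q. cont_seminorm (Es n) (Ps n) q \<and> (\<forall>i. \<forall>x\<in>Es n. \<bar>s i x\<bar> \<le> q x)))"
    using dual_resolutions by (elim exE)
  have A: "\<And>n. n \<in> I \<Longrightarrow> resolution (lc_dual (Es n) (Ps n)) (A n)"
    and eq: "\<And>n \<alpha> (s :: nat \<Rightarrow> 'a \<Rightarrow> real). n \<in> I \<Longrightarrow> range s \<subseteq> A n \<alpha> \<Longrightarrow>
       \<exists>q. cont_seminorm (Es n) (Ps n) q \<and> (\<forall>i. \<forall>x\<in>Es n. \<bar>s i x\<bar> \<le> q x)"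
    using A' by simp_all
  define G where "G \<alpha> = {f\<in>lc_dual S Q. \<forall>n\<in>I. (\<lambda>v. f (sum_injection n v)) \<in> A n (coded_row \<alpha> n)}" for \<alpha>
  have "resolution (lc_dual S Q) G"
  proof (rule resolutionI)
    show "G \<alpha> \<subseteq> lc_dual S Q" for \<alpha> unfolding G_def by blast
    show "\<exists>\<alpha>. f \<in> G \<alpha>" if f: "f \<in> lc_dual S Q" for f
    proof -
      have "\<forall>n\<in>I. \<exists>\<alpha>. (\<lambda>v. f (sum_injection n v)) \<in> A n \<alpha>"
        using resolution_cover[OF A dual_sum_injection[OF f]] by blast
      from bchoice[OF this] obtain a where a: "\<forall>n\<in>I. (\<lambda>v. f (sum_injection n v)) \<in> A n (a n)" by (elim exE)
      obtain \<alpha> where \<alpha>: "\<And>n. coded_row \<alpha> n = a n" using coded_row_exists[of 0 a] by metis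
      have "f \<in> G \<alpha>" unfolding G_def \<alpha> using f a by simp
      then show ?thesis by blast
    qed
    show "G \<alpha> \<subseteq> G \<beta>" if le: "\<alpha> \<le> \<beta>" for \<alpha> \<beta>
      unfolding G_def using resolution_mono[OF A coded_row_mono[OF le]] by auto
  qed
  moreover have "equicontinuous S Q (range s)" if s: "range s \<subseteq> G \<alpha>" for \<alpha> and s :: "nat \<Rightarrow> (nat \<Rightarrow> 'a) \<Rightarrow> real"
  proof -
    have sG: "s i \<in> G \<alpha>" for i using s by auto
    have lin: "linear_on S (s i)" for i using sG[of i] lc_dual_linear unfolding G_def by blast
    have "\<forall>n\<in>I. \<exists>q. cont_seminorm (Es n) (Ps n) q \<and> (\<forall>i. \<forall>v\<in>Es n. \<bar>s i (sum_injection n v)\<bar> \<le> q v)"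
    proof
      fix n assume n: "n \<in> I"
      show "\<exists>q. cont_seminorm (Es n) (Ps n) q \<and> (\<forall>i. \<forall>v\<in>Es n. \<bar>s i (sum_injection n v)\<bar> \<le> q v)"
        using eq[OF n, of "\<lambda>i v. s i (sum_injection n v)" "coded_row \<alpha> n"] sG n unfolding G_def by auto
    qed
    from bchoice[OF this] obtain q where q: "\<And>n. n \<in> I \<Longrightarrow> cont_seminorm (Es n) (Ps n) (q n)"
      "\<And>n i v. n \<in> I \<Longrightarrow> v \<in> Es n \<Longrightarrow> \<bar>s i (sum_injection n v)\<bar> \<le> q n v" by auto
    have bound: "\<bar>s i x\<bar> \<le> (\<Sum>n\<in>{n\<in>I. x n \<noteq> 0}. q n (x n))" if x: "x \<in> S" for i x
    proof -
      let ?F = "{n\<in>I. x n \<noteq> 0}"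
      have "finite ?F" using sum_finite[OF x] by (rule rev_finite_subset) auto
      then have "x = (\<Sum>n\<in>?F. sum_injection n (x n))" using sum_outside[OF x] by (intro sum_of_injections) auto
      then have "s i x = s i (\<Sum>n\<in>?F. sum_injection n (x n))" by (rule arg_cong)
      also have "\<dots> = (\<Sum>n\<in>?F. s i (sum_injection n (x n)))"
        using injection_mem sum_mem[OF x] by (intro linear_on_sum[OF lin subS]) auto
      also have "\<bar>\<dots>\<bar> \<le> (\<Sum>n\<in>?F. \<bar>s i (sum_injection n (x n))\<bar>)" by (rule sum_abs)
      also have "\<dots> \<le> (\<Sum>n\<in>?F. q n (x n))" using q(2) sum_mem[OF x] by (intro sum_mono) auto
      finally show ?thesis .
    qed
    show ?thesis
      by (rule equicontinuousI[OF S _ cont_seminorm_weighted_sum[OF q(1)]]) (use lin bound in auto)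
  qed
  ultimately show ?thesis unfolding class_G_def by (intro exI[of _ G]) auto
qed

lemma quasi_DF_sum: "quasi_DF S Q"
  unfolding quasi_DF_def using fundamental_bounded_resolution_sum class_G_sum by blast

end

theorem theorem4p1:
  shows
  \<comment> \<open>(i)\<close>
  "(\<forall>(E::'a::real_vector set) P. regular_LM_space E P \<longrightarrow> quasi_DF E P) \<and>
   (\<forall>(E::'a::real_vector set) P. lcs E P \<and> lc_metrizable E P \<and> infinite_dimensional E \<and>
        \<not> normable E P \<longrightarrow> quasi_DF E P \<and> \<not> DF_space E P) \<and>
  \<comment> \<open>(ii)\<close>
   (\<forall>(E::'a::real_vector set) P. regular_LM_space E P \<longrightarrow>
        quasi_DF (lc_dual E P) (strong_seminorms E P)) \<and>
  \<comment> \<open>(iii)\<close>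
   (\<forall>(I::nat set) (Es::nat \<Rightarrow> 'a::real_vector set) Ps Q.
        (\<forall>n\<in>I. lcs (Es n) (Ps n) \<and> quasi_DF (Es n) (Ps n)) \<and>
        lcs (sum_carrier I Es) Q \<and>
        final_lc (sum_carrier I Es) Q I Es Ps sum_injection
        \<longrightarrow> quasi_DF (sum_carrier I Es) Q) \<and>
  \<comment> \<open>(iv)\<close>
   (\<forall>(E::'a::real_vector set) P F. lcs E P \<and> quasi_DF E P \<and> subspace F \<and> F \<subseteq> E
        \<longrightarrow> quasi_DF F P) \<and>
  \<comment> \<open>(v)\<close>
   (\<forall>(I::nat set) (Es::nat \<Rightarrow> 'a::real_vector set) Ps.
        (\<forall>n\<in>I. lcs (Es n) (Ps n) \<and> quasi_DF (Es n) (Ps n))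
        \<longrightarrow> quasi_DF (prod_carrier I Es) (prod_seminorms I Ps)) \<and>
  \<comment> \<open>(vi)\<close>
   (\<forall>(E::'a::real_vector set) P A. lcs E P \<and> quasi_DF E P \<and> precompact E P A
        \<longrightarrow> metrizable_space (subtopology (lc_topology E P) A))"
proof (intro conjI allI impI; (elim conjE)?)
  fix E :: "'a set" and P
  assume "regular_LM_space E P"
  then show "quasi_DF E P" "quasi_DF (lc_dual E P) (strong_seminorms E P)"
    using regular_LM_space_quasi_DF strong_dual_quasi_DF by blast+
next
  fix E :: "'a set" and P
  assume E: "lcs E P" "lc_metrizable E P" "\<not> normable E P"
  show "quasi_DF E P"
    using regular_LM_space_quasi_DF[OF metrizable_regular_LM_space[OF E(1,2)]] .
  show "\<not> DF_space E P" using metrizable_DF_space_normable[OF E(1,2)] E(3) by blast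
next
  fix I :: "nat set" and Es :: "nat \<Rightarrow> 'a set" and Ps Q
  assume "\<forall>n\<in>I. lcs (Es n) (Ps n) \<and> quasi_DF (Es n) (Ps n)" "lcs (sum_carrier I Es) Q"
    "final_lc (sum_carrier I Es) Q I Es Ps sum_injection"
  then interpret lc_direct_sum I Es Ps Q by unfold_locales auto
  show "quasi_DF (sum_carrier I Es) Q" using quasi_DF_sum .
next
  fix E :: "'a set" and P F
  assume "lcs E P" "quasi_DF E P" "subspace F" "F \<subseteq> E"
  then show "quasi_DF F P" using quasi_DF_subspace lcs_imp_lc_family by blast
next
  fix I :: "nat set" and Es :: "nat \<Rightarrow> 'a set" and Ps
  assume "\<forall>n\<in>I. lcs (Es n) (Ps n) \<and> quasi_DF (Es n) (Ps n)"
  then interpret lc_sequence I Es Ps by unfold_locales auto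
  show "quasi_DF (prod_carrier I Es) (prod_seminorms I Ps)" using quasi_DF_prod .
next
  fix E :: "'a set" and P A
  assume "lcs E P" "quasi_DF E P" "precompact E P A"
  then show "metrizable_space (subtopology (lc_topology E P) A)"
    using class_G_precompact_metrizable unfolding quasi_DF_def by blast
qed

end
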